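(* Let $s\ge 0$ and $1\le p\le\infty$. Assume that there exist a velocity field $u_0$ and a not identically zero solution $\rho_0$ of the continuity equation $\partial_t\rho_0+\operatorname{div}(u_0\rho_0)=0$, both defined for $0\le t\le 1$ and $x\in\mathbb{T}^2$, such that: (i) $u_0$ is bounded, bounded in $\dot W^{s,p}(\mathbb{T}^2)$ uniformly in time, and divergence-free; (ii) $\rho_0$ is bounded and has mean zero for all times; (iii) there exists a constant $\lambda>0$, with $1/\lambda$ an integer greater than or equal to $2$, such that $\rho_0(1,x)=\rho_0(0,x/\lambda)$. Then there exist $T\in(0,\infty]$, a bounded divergence-free velocity field $u$ on $[0,T)\times\mathbb{T}^2$, and a weak solution $\rho$ on $[0,T)\times\mathbb{T}^2$ of the Cauchy problem for $\partial_t\rho+\operatorname{div}(u\rho)=0$ with initial datum $\rho(0,\cdot)=\rho_0(0,\cdot)$, such that $u$ is bounded in $\dot W^{s,p}(\mathbb{T}^2)$ uniformly in time and the functional mixing scale of $\rho$ behaves as follows: - if $s<1$: perfect mixing in finite time, that is, $T<\infty$ and $\|\rho(t,\cdot)\|_{\dot H^{-1}(\mathbb{T}^2)}\to 0$ as $t\to T$; - if $s=1$: exponential decay, that is, $T=\infty$ and there are $C,c>0$ with $\|\rho(t,\cdot)\|_{\dot H^{-1}(\mathbb{T}^2)}\le C e^{-ct}$ for all $t\ge 0$; - if $s>1$: polynomial decay, that is, $T=\infty$ and there are $C,\alpha>0$ with $\|\rho(t,\cdot)\|_{\dot H^{-1}(\mathbb{T}^2)}\le C t^{-\alpha}$ for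 all $t>0$.
   Context: $\mathbb{T}^2=\mathbb{R}^2/\mathbb{Z}^2$. For $f$ on $\mathbb{T}^2$ with zero mean, $\|f\|_{\dot H^{-1}(\mathbb{T}^2)}^2=\sum_{k\in\mathbb{Z}^2\setminus\{0\}}|k|^{-2}|\hat f(k)|^2$; this is the functional mixing scale of $f$. For $s\ge 0$ and $p<\infty$, $\|f\|_{\dot W^{s,p}(\mathbb{T}^2)}$ is the $L^p(\mathbb{T}^2)$ norm of the function with Fourier coefficients $|k|^s\hat f(k)$ (for integer $s$ and $p=1$, the $L^1$ norm of the weak derivatives of order $s$). For $p=\infty$, $\dot W^{s,\infty}$ is the homogeneous Lipschitz-Hölder space: for $s$ a positive integer, $\|f\|_{\dot W^{s,\infty}}$ is the Lipschitz constant of the derivative of order $s-1$ of $f$; for $s$ non-integer, it is the Hölder constant of exponent $s-\lfloor s\rfloor$ of the derivative of order $\lfloor s\rfloor$ of $f$; for $s=0$ it is the $L^\infty$ norm. "Bounded uniformly in time" means that the supremum over time of the norm is finite. Since $1/\lambda$ is an integer, $x\mapsto x/\lambda$ is well defined on $\mathbb{T}^2$. *)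

theory Defs
  imports "HOL-Analysis.Analysis" "HOL-Probability.Essential_Supremum"
begin

text \<open>
  Functions on the torus \<open>R^2 / Z^2\<close> are rendered as \<open>Z^2\<close>-periodic functions on \<^typ>\<open>real^2\<close>;
  integrals, norms and almost-everywhere statements refer to the unit cell.
\<close>

definition of_ivec :: "int^2 \<Rightarrow> real^2" where
  "of_ivec k = (\<chi> i. real_of_int (k $ i))"

definition periodic :: "(real^2 \<Rightarrow> 'b) \<Rightarrow> bool" where
  "periodic f \<longleftrightarrow> (\<forall>x k. f (x + of_ivec k) = f x)"

abbreviation torus :: "(real^2) measure" where
  "torus \<equiv> restrict_space lborel (cbox 0 1)"

definition fourier_coeff :: "(real^2 \<Rightarrow> real) \<Rightarrow> int^2 \<Rightarrow> complex" where
  "fourier_coeff f k = (\<integral>x. complex_of_real (f x) * cis (- 2 * pi * (of_ivec k \<bullet> x)) \<partial>torus)"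

definition ennreal_root :: "real \<Rightarrow> ennreal \<Rightarrow> ennreal" where
  "ennreal_root q a = (if a = \<infinity> then \<infinity> else ennreal (enn2real a powr (1 / q)))"

definition Hm1_norm :: "(real^2 \<Rightarrow> real) \<Rightarrow> ennreal" where
  "Hm1_norm f = ennreal_root 2
     (\<Sum>\<^sub>\<infinity>k\<in>UNIV - {0}. ennreal ((cmod (fourier_coeff f k))\<^sup>2 / (norm (of_ivec k))\<^sup>2))"

definition Lp_norm :: "ennreal \<Rightarrow> (real^2 \<Rightarrow> 'b::real_normed_vector) \<Rightarrow> ennreal" where
  "Lp_norm p f =
     (if p = \<infinity> then esssup torus (\<lambda>x. ennreal (norm (f x)))
      else ennreal_root (enn2real p) (\<integral>\<^sup>+x. ennreal (norm (f x) powr enn2real p) \<partial>torus))"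

primrec C_k :: "nat \<Rightarrow> ('a::euclidean_space \<Rightarrow> real) \<Rightarrow> bool" where
  "C_k 0 f \<longleftrightarrow> continuous_on UNIV f"
| "C_k (Suc n) f \<longleftrightarrow> (\<forall>x. f differentiable (at x)) \<and>
     (\<forall>v. C_k n (\<lambda>x. frechet_derivative f (at x) v))"

definition smooth :: "('a::euclidean_space \<Rightarrow> real) \<Rightarrow> bool" where
  "smooth f \<longleftrightarrow> (\<forall>n. C_k n f)"

definition test_fun :: "(real^2 \<Rightarrow> real) \<Rightarrow> bool" where
  "test_fun \<phi> \<longleftrightarrow> smooth \<phi> \<and> periodic \<phi>"

definition partial :: "2 \<Rightarrow> (real^2 \<Rightarrow> real) \<Rightarrow> real^2 \<Rightarrow> real" where
  "partial i \<phi> = (\<lambda>x. frechet_derivative \<phi> (at x) (axis i 1))"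

text \<open>
  \<open>weak_deriv a b f g\<close>: the weak derivative of \<open>f\<close> on the torus, of order \<open>a\<close> in the first and
  \<open>b\<close> in the second variable, is \<open>g\<close>. For \<open>a = b = 0\<close> this says that \<open>g = f\<close> almost everywhere.
\<close>

definition weak_deriv ::
    "nat \<Rightarrow> nat \<Rightarrow> (real^2 \<Rightarrow> real^2) \<Rightarrow> (real^2 \<Rightarrow> real^2) \<Rightarrow> bool" where
  "weak_deriv a b f g \<longleftrightarrow>
     integrable torus f \<and> integrable torus g \<and> periodic g \<and>
     (\<forall>\<phi>. test_fun \<phi> \<longrightarrow>
        (\<integral>x. (partial 1 ^^ a) ((partial 2 ^^ b) \<phi>) x *\<^sub>R f x \<partial>torus)
        = (-1) ^ (a + b) *\<^sub>R (\<integral>x. \<phi> x *\<^sub>R g x \<partial>torus))"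

text \<open>
  \<open>weak_derivs m f G\<close>: the functions \<open>G j\<close> for \<open>j \<le> m\<close> are all the weak derivatives of order \<open>m\<close>
  of \<open>f\<close>, where \<open>j\<close> counts the differentiations in the first variable.
\<close>

definition weak_derivs ::
    "nat \<Rightarrow> (real^2 \<Rightarrow> real^2) \<Rightarrow> (nat \<Rightarrow> real^2 \<Rightarrow> real^2) \<Rightarrow> bool" where
  "weak_derivs m f G \<longleftrightarrow> (\<forall>j\<le>m. weak_deriv j (m - j) f (G j))"

definition holder_const :: "real \<Rightarrow> nat \<Rightarrow> (nat \<Rightarrow> real^2 \<Rightarrow> real^2) \<Rightarrow> ennreal" where
  "holder_const \<gamma> m G =
     (SUP (x, y) \<in> {(x, y). x \<noteq> y}.
        ennreal ((\<Sum>j\<le>m. norm (G j x - G j y)) / norm (x - y) powr \<gamma>))"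

text \<open>
  \<open>frac_laplace s f g\<close>: the function \<open>g\<close> has the Fourier coefficients of \<open>f\<close> multiplied by
  \<open>\<bar>k\<bar>^s\<close>, with \<open>0^0 = 1\<close> (whereas \<open>0 powr 0 = 0\<close>).
\<close>

definition frac_laplace :: "real \<Rightarrow> (real^2 \<Rightarrow> real^2) \<Rightarrow> (real^2 \<Rightarrow> real^2) \<Rightarrow> bool" where
  "frac_laplace s f g \<longleftrightarrow>
     integrable torus f \<and> integrable torus g \<and> periodic g \<and>
     (\<forall>i k. fourier_coeff (\<lambda>x. g x $ i) k =
        complex_of_real (if s = 0 then 1 else norm (of_ivec k) powr s)
          * fourier_coeff (\<lambda>x. f x $ i) k)"

text \<open>
  The homogeneous norm of order \<open>s\<close> and integrability \<open>p\<close> of a vector field. The functions over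
  which the infima are taken are unique up to null sets, so each infimum just
  selects that function (in the Hoelder case, its continuous version) and is \<open>\<infinity>\<close> if there is none.
  In the Hoelder case with \<open>s > 0\<close>, \<open>m = \<lceil>s\<rceil> - 1\<close> and the exponent \<open>s - m\<close> lies in \<open>(0, 1]\<close>: for
  integer \<open>s\<close> this is the Lipschitz constant of the derivative of order \<open>s - 1\<close>, otherwise
  \<open>m = \<lfloor>s\<rfloor>\<close>. Lipschitz and Hoelder constants of a periodic function are the same
  for the distance of the plane and for the quotient distance of the torus.
\<close>

definition Wdot_norm :: "real \<Rightarrow> ennreal \<Rightarrow> (real^2 \<Rightarrow> real^2) \<Rightarrow> ennreal" where
  "Wdot_norm s p f =
     (if p = \<infinity> then
        (if s = 0 then Lp_norm \<infinity> f
         else let m = nat (\<lceil>s\<rceil> - 1)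
              in INF G \<in> {G. weak_derivs m f G}. holder_const (s - real m) m G)
      else if p = 1 \<and> s \<in> \<int> then
        (let m = nat \<lfloor>s\<rfloor> in INF G \<in> {G. weak_derivs m f G}. \<Sum>j\<le>m. Lp_norm 1 (G j))
      else INF g \<in> {g. frac_laplace s f g}. Lp_norm p g)"

definition on_torus ::
    "real set \<Rightarrow> (real \<Rightarrow> real^2 \<Rightarrow> 'b::real_normed_vector) \<Rightarrow> bool" where
  "on_torus I f \<longleftrightarrow>
     (\<lambda>(t, x). f t x) \<in> borel_measurable (restrict_space borel (I \<times> UNIV)) \<and>
     (\<forall>t\<in>I. periodic (f t))"

definition bounded_field ::
    "real set \<Rightarrow> (real \<Rightarrow> real^2 \<Rightarrow> 'b::real_normed_vector) \<Rightarrow> bool" where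
  "bounded_field I f \<longleftrightarrow> (SUP t\<in>I. Lp_norm \<infinity> (f t)) < \<infinity>"

definition div_free :: "(real^2 \<Rightarrow> real^2) \<Rightarrow> bool" where
  "div_free v \<longleftrightarrow>
     (\<forall>\<phi>. test_fun \<phi> \<longrightarrow> (\<integral>x. frechet_derivative \<phi> (at x) (v x) \<partial>torus) = 0)"

definition velocity_field ::
    "real set \<Rightarrow> real \<Rightarrow> ennreal \<Rightarrow> (real \<Rightarrow> real^2 \<Rightarrow> real^2) \<Rightarrow> bool" where
  "velocity_field I s p u \<longleftrightarrow>
     on_torus I u \<and> bounded_field I u \<and> (\<forall>t\<in>I. div_free (u t)) \<and>
     (SUP t\<in>I. Wdot_norm s p (u t)) < \<infinity>"

text \<open>
  Weak solutions on a time interval \<open>I\<close> with left endpoint \<open>0 \<in> I\<close>, of the Cauchy problem whose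
  initial datum is their own value at time \<open>0\<close>. The test functions are smooth on the whole
  space-time, periodic in space, and vanish for \<open>t > b\<close> for some \<open>b\<close> before the right end of \<open>I\<close>.
  The derivative of a test function along the space-time vector \<open>(1, u t x)\<close> is its time derivative
  plus the scalar product of \<open>u\<close> with its space gradient. Continuity of the solution
  in time, in the weak sense, gives a meaning to its values at each fixed time.
\<close>

definition weak_solution ::
    "real set \<Rightarrow> (real \<Rightarrow> real^2 \<Rightarrow> real^2) \<Rightarrow> (real \<Rightarrow> real^2 \<Rightarrow> real) \<Rightarrow> bool" where
  "weak_solution I u \<rho> \<longleftrightarrow>
     on_torus I \<rho> \<and>
     (\<forall>t\<in>I. integrable torus (\<rho> t)) \<and>
     (\<forall>b\<in>I. set_integrable lborel ({0..b} \<times> cbox 0 1) (\<lambda>(t, x). \<rho> t x) \<and>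
            set_integrable lborel ({0..b} \<times> cbox 0 1) (\<lambda>(t, x). \<rho> t x *\<^sub>R u t x)) \<and>
     (\<forall>\<psi>. test_fun \<psi> \<longrightarrow> continuous_on I (\<lambda>t. \<integral>x. \<rho> t x * \<psi> x \<partial>torus)) \<and>
     (\<forall>\<phi> :: real \<times> (real^2) \<Rightarrow> real.
        smooth \<phi> \<longrightarrow> (\<forall>t. periodic (\<lambda>x. \<phi> (t, x))) \<longrightarrow>
        (\<exists>b\<in>interior I. \<forall>t>b. \<forall>x. \<phi> (t, x) = 0) \<longrightarrow>
        set_lebesgue_integral lborel (I \<times> cbox 0 1)
          (\<lambda>(t, x). \<rho> t x * frechet_derivative \<phi> (at (t, x)) (1, u t x))
        + (\<integral>x. \<rho> 0 x * \<phi> (0, x) \<partial>torus) = 0)"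

end

theory Submission
  imports Defs "HOL-Probability.Probability"
begin

text \<open>
  Let \<open>N = 1/\<lambda>\<close>. Self-similarity says that at time \<open>1\<close> the density \<open>\<rho>0\<close> is its initial datum repeated on
  scale \<open>1/N\<close>. Hence the evolution can be run again on this scale, then on scale \<open>N^{-2}\<close>, and so on:
  during stage \<open>n\<close>, which has length \<open>\<tau>^n\<close> and starts at \<open>T_n = \<Sum>i<n. \<tau>^i\<close>, put
  \<open>\<rho>(t, x) = \<rho>0((t - T_n) / \<tau>^n, N^n x)\<close> and \<open>u(t, x) = N^{-sn} u0((t - T_n) / \<tau>^n, N^n x)\<close>.
  The continuity equation forces the amplitude of the velocity to be \<open>(N \<tau>)^{-n}\<close>, while a derivative of order
  \<open>s\<close> costs the factor \<open>N^{sn}\<close>. The choice \<open>\<tau> = N^{s - 1}\<close> makes both agree, and the bound in \<open>W^{s,p}\<close> is the same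
  in all stages. Since \<open>s \<ge> 0\<close>, the amplitude never exceeds that of \<open>u0\<close>.

  All statements about a dilated function \<open>g (M x)\<close> come from one change of variables
  (\<open>torus_integral_subdivision\<close>): integrating it against a test function is integrating \<open>g\<close> against the average of
  the test function over the \<open>M^2\<close> subcells. This transfers weak derivatives, vanishing
  divergence, Fourier coefficients and the weak form of the equation from the building block to each
  stage (\<open>weak_deriv_dilation\<close>, \<open>div_free_dilation\<close>, \<open>fourier_coeff_dilation\<close>, \<open>rescaled_increment\<close>), and it
  shows that dilations preserve the measure.

  Two stages can be glued because the solution is weakly continuous. The weak formulation only allows test
  functions that vanish before the final time; smooth cutoffs in time, whose derivatives concentrate at the
  final time, turn it into a balance that includes the value of the solution at that time
  (\<open>weak_solution_increment\<close>). These balances telescope over the stages (\<open>cumulative_increment\<close>).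

  In stage \<open>n\<close> all nonzero frequencies of \<open>\<rho>\<close> have size at least \<open>N^n\<close>, so Bessel's inequality bounds the
  mixing scale by a constant times \<open>N^{-n}\<close> (\<open>Hm1_norm_dilation\<close>). The stages have total length
  \<open>1 / (1 - \<tau>)\<close> if \<open>s < 1\<close>; they have length \<open>1\<close> if \<open>s = 1\<close>; and they grow geometrically if \<open>s > 1\<close>. The three rates
  are what \<open>N^{-n}\<close> becomes as a function of time.
\<close>

section \<open>Integer dilations of the torus\<close>

abbreviation half_open_cell :: "(real^2) set" where
  "half_open_cell \<equiv> {x. \<forall>i. 0 \<le> x $ i \<and> x $ i < 1}"

definition residues :: "nat \<Rightarrow> (int^2) set" where
  "residues M = {j. \<forall>i. 0 \<le> j $ i \<and> j $ i < int M}"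

text \<open>
  The affine parametrisation of the \<open>j\<close>-th of the \<open>M^2\<close> cells of side \<open>1/M\<close> into which the unit cell is
  cut, by the unit cell.
\<close>

definition subcell :: "nat \<Rightarrow> int^2 \<Rightarrow> real^2 \<Rightarrow> real^2" where
  "subcell M j y = (y + of_ivec j) /\<^sub>R real M"

text \<open>
  A periodic function composed with the dilation \<open>x \<mapsto> M x\<close> is the same function composed with
  \<open>x \<mapsto> frac_vec (M x)\<close>, which maps the unit cell to itself. In this form everything takes place in the
  measure space \<^term>\<open>torus\<close>, even for functions that are only known to be measurable on the unit cell.
\<close>

definition frac_vec :: "real^2 \<Rightarrow> real^2" where
  "frac_vec x = (\<chi> i. frac (x $ i))"

lemma of_ivec_nth [simp]: "of_ivec k $ i = real_of_int (k $ i)"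
  by (simp add: of_ivec_def)

lemma of_ivec_add: "of_ivec (k + l) = of_ivec k + of_ivec l"
  by (simp add: vec_eq_iff)

lemma of_ivec_scale: "of_ivec (\<chi> i. int M * k $ i) = real M *\<^sub>R of_ivec k"
  by (simp add: vec_eq_iff)

lemma in_unit_cube: "x \<in> cbox 0 (1::real^2) \<longleftrightarrow> (\<forall>i. 0 \<le> x $ i \<and> x $ i \<le> 1)"
  by (simp add: mem_box_cart)

lemma space_torus [simp]: "space torus = cbox 0 1"
  by (simp add: space_restrict_space)

lemma emeasure_cube: "emeasure lborel (cbox 0 (1::real^2)) = 1"
proof -
  have "(\<Prod>b\<in>Basis. ((1::real^2) - 0) \<bullet> b) = 1"
    by (rule prod.neutral) (auto simp: Basis_vec_def inner_axis)
  then show ?thesis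
    by (subst emeasure_lborel_cbox) (auto simp: Basis_vec_def inner_axis)
qed

interpretation torus: prob_space torus
  by (rule prob_spaceI) (simp add: emeasure_restrict_space emeasure_cube)

lemma torus_prob_cube [simp]: "torus.prob (cbox 0 1) = 1"
  using torus.prob_space by simp

lemma finite_residues [simp]: "finite (residues M)"
proof -
  have "residues M \<subseteq> (\<lambda>f. \<chi> i. f i) ` (UNIV \<rightarrow>\<^sub>E {0..<int M})"
  proof
    fix j assume "j \<in> residues M"
    then have "(\<lambda>i. j $ i) \<in> UNIV \<rightarrow>\<^sub>E {0..<int M}" by (auto simp: residues_def)
    then show "j \<in> (\<lambda>f. \<chi> i. f i) ` (UNIV \<rightarrow>\<^sub>E {0..<int M})"
      by (rule rev_image_eqI) (simp add: vec_eq_iff)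
  qed
  then show ?thesis by (rule finite_subset) (auto intro!: finite_imageI finite_PiE)
qed

text \<open>
  Adding \<open>k\<close> and reducing modulo \<open>M\<close> permutes the residues. This invariance gives the
  periodicity of averages over subcells as well as the orthogonality of characters.
\<close>

lemma sum_residues_shift:
  fixes \<psi> :: "int^2 \<Rightarrow> 'a::comm_monoid_add"
  assumes "M > 0" and per: "\<And>j q. \<psi> (j + (\<chi> i. int M * q $ i)) = \<psi> j"
  shows "(\<Sum>j\<in>residues M. \<psi> (j + k)) = (\<Sum>j\<in>residues M. \<psi> j)"
proof -
  define r where "r j = (\<chi> i. (j $ i + k $ i) mod int M)" for j :: "int^2"
  have into: "r ` residues M \<subseteq> residues M"
    using assms(1) by (auto simp: r_def residues_def)
  have "inj_on r (residues M)"
  proof (rule inj_onI)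
    fix x y assume xy: "x \<in> residues M" "y \<in> residues M" "r x = r y"
    have "x $ i = y $ i" for i
    proof -
      have "(x $ i + k $ i) mod int M = (y $ i + k $ i) mod int M"
        using xy(3) by (simp add: r_def vec_eq_iff)
      then have "(x $ i) mod int M = (y $ i) mod int M"
        by (metis add_diff_cancel_right' mod_diff_left_eq)
      then show ?thesis using xy(1,2) by (simp add: residues_def)
    qed
    then show "x = y" by (simp add: vec_eq_iff)
  qed
  then have bij: "bij_betw r (residues M) (residues M)"
    using into by (simp add: bij_betw_def endo_inj_surj)
  have "\<psi> (r j) = \<psi> (j + k)" for j
  proof -
    have "j + k = r j + (\<chi> i. int M * (\<chi> i. (j $ i + k $ i) div int M) $ i)"
      by (simp add: r_def vec_eq_iff mod_mult_div_eq)
    then show ?thesis using per by metis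
  qed
  then show ?thesis using sum.reindex_bij_betw[OF bij, of \<psi>] by simp
qed

lemma AE_half_open_cell: "AE x in lborel. x \<in> half_open_cell \<longleftrightarrow> x \<in> cbox 0 (1::real^2)"
proof -
  have "cbox 0 1 - box 0 (1::real^2) \<in> null_sets lborel"
    using emeasure_cube
    by (auto simp: null_sets_def emeasure_Diff emeasure_lborel_box_eq emeasure_lborel_cbox_eq box_subset_cbox split: if_splits)
  then have "AE x in lborel. x \<notin> cbox 0 1 - box 0 (1::real^2)" by (rule AE_not_in)
  then show ?thesis
    by eventually_elim (auto simp: mem_box_cart less_imp_le)
qed

lemma half_open_cell_borel [measurable]: "half_open_cell \<in> sets borel"
proof -
  have "half_open_cell = (\<Inter>i. {x. 0 \<le> x $ i} \<inter> {x. x $ i < 1})" by auto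
  also have "\<dots> \<in> sets borel"
    by (intro sets.finite_INT sets.Int borel_closed borel_open)
       (auto simp: closed_halfspace_component_ge_cart open_halfspace_component_lt_cart)
  finally show ?thesis .
qed

text \<open>
  The half-open cell, in contrast to the closed one, is the disjoint union of its subcells: \<open>M x - j\<close>
  lies in it exactly if \<open>j\<close> is the integer part of \<open>M x\<close>.
\<close>

lemma indicator_cell_subdivision:
  assumes "M > 0"
  shows "indicator half_open_cell x
    = (\<Sum>j\<in>residues M. indicator half_open_cell (real M *\<^sub>R x - of_ivec j) :: real)"
proof -
  define j0 where "j0 = (\<chi> i. \<lfloor>real M * x $ i\<rfloor>)"
  have 1: "real M *\<^sub>R x - of_ivec j \<in> half_open_cell \<longleftrightarrow> j = j0" for j
  proof -
    have "real M *\<^sub>R x - of_ivec j \<in> half_open_cell \<longleftrightarrow> (\<forall>i. \<lfloor>real M * x $ i\<rfloor> = j $ i)"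
      unfolding floor_eq_iff by (auto simp: algebra_simps)
    then show ?thesis by (auto simp: j0_def vec_eq_iff)
  qed
  have 2: "j0 \<in> residues M \<longleftrightarrow> x \<in> half_open_cell"
  proof -
    have "0 \<le> \<lfloor>real M * x $ i\<rfloor> \<and> \<lfloor>real M * x $ i\<rfloor> < int M \<longleftrightarrow> 0 \<le> x $ i \<and> x $ i < 1" for i
      using assms by (auto simp: floor_less_iff zero_le_mult_iff)
    then show ?thesis by (simp add: j0_def residues_def)
  qed
  have "(\<Sum>j\<in>residues M. indicator half_open_cell (real M *\<^sub>R x - of_ivec j) :: real)
      = (\<Sum>j\<in>residues M. if j = j0 then 1 else 0)"
    by (intro sum.cong refl) (simp add: 1 indicator_def del: mem_Collect_eq)
  also have "\<dots> = indicator half_open_cell x"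
    by (simp add: 2 indicator_def del: mem_Collect_eq)
  finally show ?thesis by simp
qed

lemma subcell_in_cube:
  assumes "M > 0" "j \<in> residues M" "y \<in> cbox 0 1"
  shows "subcell M j y \<in> cbox 0 1"
proof -
  have "real_of_int (j $ i) + 1 \<le> real M" for i
  proof -
    have "j $ i < int M" using assms(2) by (simp add: residues_def)
    then have "j $ i + 1 \<le> int M" by linarith
    then have "real_of_int (j $ i + 1) \<le> real_of_int (int M)" by (simp only: of_int_le_iff)
    then show ?thesis by simp
  qed
  then have "y $ i + real_of_int (j $ i) \<le> real M" for i
    using assms(3) unfolding in_unit_cube by (smt (verit))
  moreover have "0 \<le> y $ i + real_of_int (j $ i)" for i
    using assms(2,3) by (simp add: in_unit_cube residues_def)
  ultimately show ?thesis
    using assms(1) by (simp add: in_unit_cube subcell_def field_simps)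
qed

lemma lborel_integral_affine:
  fixes f :: "real^2 \<Rightarrow> 'b::{banach, second_countable_topology}"
  assumes "integrable lborel f" and "c \<noteq> 0"
  shows "integrable lborel (\<lambda>x. f (a + c *\<^sub>R x))"
    and "(\<integral>x. f x \<partial>lborel) = \<bar>c\<bar>\<^sup>2 *\<^sub>R (\<integral>x. f (a + c *\<^sub>R x) \<partial>lborel)"
proof -
  have eq: "lborel = density (distr lborel borel (\<lambda>x::real^2. a + c *\<^sub>R x)) (\<lambda>_. ennreal (\<bar>c\<bar>\<^sup>2))"
    using lborel_affine[OF assms(2), of a] by (simp add: ennreal_power)
  have fm[measurable]: "f \<in> borel_measurable borel"
    using borel_measurable_integrable[OF assms(1)] by simp
  have "integrable (density (distr lborel borel (\<lambda>x::real^2. a + c *\<^sub>R x)) (\<lambda>_. ennreal (\<bar>c\<bar>\<^sup>2))) f"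
    using assms(1) eq by simp
  then have "integrable lborel (\<lambda>x. \<bar>c\<bar>\<^sup>2 *\<^sub>R f (a + c *\<^sub>R x))"
    by (subst (asm) integrable_density) (auto simp: integrable_distr_eq)
  then show "integrable lborel (\<lambda>x. f (a + c *\<^sub>R x))"
    using assms(2) integrable_scaleR_right[of "1 / \<bar>c\<bar>\<^sup>2" lborel "\<lambda>x. \<bar>c\<bar>\<^sup>2 *\<^sub>R f (a + c *\<^sub>R x)"]
    by simp
  have "(\<integral>x. f x \<partial>lborel)
      = (\<integral>x. f x \<partial>density (distr lborel borel (\<lambda>x::real^2. a + c *\<^sub>R x)) (\<lambda>_. ennreal (\<bar>c\<bar>\<^sup>2)))"
    using eq by simp
  also have "\<dots> = (\<integral>x. \<bar>c\<bar>\<^sup>2 *\<^sub>R f (a + c *\<^sub>R x) \<partial>lborel)"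
    by (subst integral_density) (auto simp: integral_distr)
  also have "\<dots> = \<bar>c\<bar>\<^sup>2 *\<^sub>R (\<integral>x. f (a + c *\<^sub>R x) \<partial>lborel)"
    by simp
  finally show "(\<integral>x. f x \<partial>lborel) = \<bar>c\<bar>\<^sup>2 *\<^sub>R (\<integral>x. f (a + c *\<^sub>R x) \<partial>lborel)" .
qed

lemma integrable_torus_iff:
  fixes F :: "real^2 \<Rightarrow> 'b::{banach, second_countable_topology}"
  shows "integrable torus F \<longleftrightarrow> integrable lborel (\<lambda>x. indicator (cbox 0 1) x *\<^sub>R F x)"
  by (rule integrable_restrict_space) simp

lemma integral_torus:
  fixes F :: "real^2 \<Rightarrow> 'b::{banach, second_countable_topology}"
  shows "(\<integral>x. F x \<partial>torus) = (\<integral>x. indicator (cbox 0 1) x *\<^sub>R F x \<partial>lborel)"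
  by (rule integral_restrict_space) simp

text \<open>
  The change of variables behind everything that follows: cut the unit cell into subcells and
  rescale each of them to the unit cell.
\<close>

lemma torus_integral_subdivision:
  fixes F :: "real^2 \<Rightarrow> 'b::{banach, second_countable_topology}"
  assumes "M > 0" and F: "integrable torus F"
  shows "\<And>j. j \<in> residues M \<Longrightarrow> integrable torus (\<lambda>y. F (subcell M j y))"
    and "(\<integral>x. F x \<partial>torus) = (\<integral>y. (1 / (real M)\<^sup>2) *\<^sub>R (\<Sum>j\<in>residues M. F (subcell M j y)) \<partial>torus)"
proof -
  let ?H = half_open_cell
  define G where "G x = indicator (cbox 0 1) x *\<^sub>R F x" for x
  have G: "integrable lborel G" using F by (simp add: G_def[abs_def] integrable_torus_iff)
  then have Gm[measurable]: "G \<in> borel_measurable borel" by auto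
  define K where "K j x = indicator ?H (real M *\<^sub>R x - of_ivec j) *\<^sub>R G x" for j x
  have Kint: "integrable lborel (K j)" for j
  proof -
    have "integrable lborel (\<lambda>x. indicator ((\<lambda>x. real M *\<^sub>R x - of_ivec j) -` ?H) x *\<^sub>R G x)"
    proof (rule integrable_mult_indicator[OF _ G])
      have "(\<lambda>x. real M *\<^sub>R x - of_ivec j) \<in> borel_measurable borel" by measurable
      from measurable_sets_borel[OF this half_open_cell_borel]
      show "(\<lambda>x. real M *\<^sub>R x - of_ivec j) -` ?H \<in> sets lborel" by simp
    qed
    then show ?thesis unfolding K_def by (simp add: indicator_def vimage_def)
  qed
  have Kaff: "K j (of_ivec j /\<^sub>R real M + (1 / real M) *\<^sub>R y) = indicator ?H y *\<^sub>R G (subcell M j y)" for j y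
  proof -
    have "of_ivec j /\<^sub>R real M + (1 / real M) *\<^sub>R y = subcell M j y"
      by (simp add: subcell_def divide_inverse_commute scaleR_add_right add.commute)
    moreover have "real M *\<^sub>R subcell M j y - of_ivec j = y"
      using assms(1) by (simp add: subcell_def)
    ultimately show ?thesis by (simp add: K_def)
  qed
  have eqAE: "AE y in lborel. indicator ?H y *\<^sub>R G (subcell M j y) = indicator (cbox 0 1) y *\<^sub>R F (subcell M j y)"
    if "j \<in> residues M" for j
    using AE_half_open_cell
  proof eventually_elim
    case (elim y)
    show ?case
    proof (cases "y \<in> cbox 0 1")
      case True
      then show ?thesis using elim subcell_in_cube[OF assms(1) that True] by (simp add: G_def)
    next
      case False then show ?thesis using elim by (simp add: indicator_def del: mem_Collect_eq)
    qed
  qed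
  have subm: "subcell M j \<in> torus \<rightarrow>\<^sub>M torus" if "j \<in> residues M" for j
    unfolding subcell_def
    by (rule measurable_restrict_space3)
       (use subcell_in_cube[OF assms(1) that] in \<open>auto simp: subcell_def Pi_iff\<close>)
  have Ij: "integrable lborel (\<lambda>y. indicator (cbox 0 1) y *\<^sub>R F (subcell M j y))"
    and Vj: "(\<integral>x. K j x \<partial>lborel) = (1 / (real M)\<^sup>2) *\<^sub>R (\<integral>y. F (subcell M j y) \<partial>torus)"
    if j: "j \<in> residues M" for j
  proof -
    have m1: "(\<lambda>y. indicator (cbox 0 1) y *\<^sub>R F (subcell M j y)) \<in> borel_measurable lborel"
      using measurable_comp[OF subm[OF j] borel_measurable_integrable[OF F]]
      by (simp add: comp_def borel_measurable_restrict_space_iff)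
    have m2: "(\<lambda>y. indicator ?H y *\<^sub>R G (subcell M j y)) \<in> borel_measurable lborel"
      unfolding subcell_def by measurable
    have i2: "integrable lborel (\<lambda>y. indicator ?H y *\<^sub>R G (subcell M j y))"
      using lborel_integral_affine(1)[OF Kint[of j], where c = "1 / real M" and a = "of_ivec j /\<^sub>R real M"] assms(1)
      unfolding Kaff by simp
    show "integrable lborel (\<lambda>y. indicator (cbox 0 1) y *\<^sub>R F (subcell M j y))"
      by (rule integrable_cong_AE_imp[OF i2 m1 eqAE[OF j]])
    have "(\<integral>x. K j x \<partial>lborel) = (1 / (real M)\<^sup>2) *\<^sub>R (\<integral>y. indicator ?H y *\<^sub>R G (subcell M j y) \<partial>lborel)"
      using lborel_integral_affine(2)[OF Kint[of j], where c = "1 / real M" and a = "of_ivec j /\<^sub>R real M"] assms(1)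
      unfolding Kaff by (simp add: power_divide)
    also have "(\<integral>y. indicator ?H y *\<^sub>R G (subcell M j y) \<partial>lborel)
        = (\<integral>y. indicator (cbox 0 1) y *\<^sub>R F (subcell M j y) \<partial>lborel)"
      by (rule integral_cong_AE[OF m2 m1 eqAE[OF j]])
    finally show "(\<integral>x. K j x \<partial>lborel) = (1 / (real M)\<^sup>2) *\<^sub>R (\<integral>y. F (subcell M j y) \<partial>torus)"
      by (simp add: integral_torus)
  qed
  show I: "integrable torus (\<lambda>y. F (subcell M j y))" if "j \<in> residues M" for j
    using Ij[OF that] by (simp add: integrable_torus_iff)
  have "(\<integral>x. F x \<partial>torus) = (\<integral>x. indicator ?H x *\<^sub>R G x \<partial>lborel)"
    unfolding integral_torus
  proof (rule integral_cong_AE)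
    show "AE x in lborel. indicator (cbox 0 1) x *\<^sub>R F x = indicator ?H x *\<^sub>R G x"
      using AE_half_open_cell by eventually_elim (simp add: G_def indicator_def del: mem_Collect_eq)
    show "(\<lambda>x. indicator (cbox 0 1) x *\<^sub>R F x) \<in> borel_measurable lborel"
      using Gm by (simp add: G_def[abs_def])
  qed measurable
  also have "(\<lambda>x. indicator ?H x *\<^sub>R G x) = (\<lambda>x. \<Sum>j\<in>residues M. K j x)"
    unfolding K_def by (subst indicator_cell_subdivision[OF assms(1)]) (simp add: scaleR_left.sum)
  also have "(\<integral>x. (\<Sum>j\<in>residues M. K j x) \<partial>lborel) = (\<Sum>j\<in>residues M. \<integral>x. K j x \<partial>lborel)"
    by (intro Bochner_Integration.integral_sum Kint)
  also have "\<dots> = (\<Sum>j\<in>residues M. (1 / (real M)\<^sup>2) *\<^sub>R (\<integral>y. F (subcell M j y) \<partial>torus))"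
    by (intro sum.cong refl Vj)
  also have "\<dots> = (\<integral>y. (1 / (real M)\<^sup>2) *\<^sub>R (\<Sum>j\<in>residues M. F (subcell M j y)) \<partial>torus)"
    using I by (simp add: scaleR_right.sum Bochner_Integration.integral_sum)
  finally show "(\<integral>x. F x \<partial>torus)
    = (\<integral>y. (1 / (real M)\<^sup>2) *\<^sub>R (\<Sum>j\<in>residues M. F (subcell M j y)) \<partial>torus)" .
qed

text \<open>
  The constant function \<open>1\<close> in the subdivision formula counts the residues.
\<close>

lemma card_residues:
  assumes "M > 0" shows "real (card (residues M)) = (real M)\<^sup>2"
  using torus_integral_subdivision(2)[OF assms, of "\<lambda>_. 1::real"] assms
  by (simp add: torus.prob_space field_simps)

lemma frac_vec_cube: "frac_vec x \<in> cbox 0 1"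
  by (simp add: in_unit_cube frac_vec_def frac_ge_0 less_imp_le frac_lt_1)

lemma frac_vec_eq: "frac_vec x = x - of_ivec (\<chi> i. \<lfloor>x $ i\<rfloor>)"
  by (simp add: vec_eq_iff frac_vec_def frac_def)

lemma periodic_frac_vec: "periodic f \<Longrightarrow> f (frac_vec x) = f x"
  unfolding periodic_def by (metis frac_vec_eq diff_add_cancel)

lemma periodicD: "periodic f \<Longrightarrow> f (x + of_ivec k) = f x"
  by (simp add: periodic_def)

lemma frac_vec_borel [measurable]: "frac_vec \<in> borel_measurable borel"
proof -
  have "(\<lambda>x. frac_vec x \<bullet> b) \<in> borel_measurable borel" if b0: "b \<in> Basis" for b
  proof -
    obtain i where b: "b = axis i 1" using b0 by (auto simp: Basis_vec_def)
    have "(\<lambda>x. x $ i) \<in> borel_measurable (borel :: (real^2) measure)"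
      by (intro borel_measurable_continuous_onI continuous_intros)
    then have "(\<lambda>x. x $ i - real_of_int \<lfloor>x $ i\<rfloor>) \<in> borel_measurable (borel :: (real^2) measure)"
      by measurable
    then show ?thesis by (simp add: b inner_axis frac_vec_def frac_def)
  qed
  then show ?thesis by (subst borel_measurable_euclidean_space) auto
qed

lemma frac_dilation_measurable: "(\<lambda>x. frac_vec (c *\<^sub>R x)) \<in> torus \<rightarrow>\<^sub>M torus"
  by (rule measurable_restrict_space2) (auto simp: frac_vec_cube intro!: measurable_restrict_space1)

text \<open>
  Each subcell is mapped onto the whole cell, and stretching multiplies its area \<open>M^{-2}\<close> by \<open>M^2\<close>; so
  the preimage of a set collects \<open>M^2\<close> copies of it, each of \<open>M^{-2}\<close> times its measure.
\<close>

lemma distr_frac_dilation: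
  assumes "M > 0"
  shows "distr torus torus (\<lambda>x. frac_vec (real M *\<^sub>R x)) = torus" (is "?D = torus")
proof (rule measure_eqI)
  fix A assume "A \<in> sets ?D"
  then have A[measurable]: "A \<in> sets torus" by simp
  let ?V = "(\<lambda>x. frac_vec (real M *\<^sub>R x)) -` A \<inter> space torus"
  have V: "?V \<in> sets torus"
    by (rule measurable_sets[OF frac_dilation_measurable A])
  have *: "frac_vec (real M *\<^sub>R subcell M j y) = frac_vec y" for j y
    using assms by (simp add: subcell_def vec_eq_iff frac_vec_def frac_def)
  have "measure torus ?V = (\<integral>x. indicator ?V x \<partial>torus)"
    using V by simp
  also have "\<dots> = (\<integral>y. (1 / (real M)\<^sup>2) *\<^sub>R (\<Sum>j\<in>residues M. indicator ?V (subcell M j y)) \<partial>torus)"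
    by (rule torus_integral_subdivision(2)[OF assms integrable_real_indicator[OF V]])
       (simp add: less_top[symmetric] torus.emeasure_finite)
  also have "\<dots> = (\<integral>y. indicator A (frac_vec y) \<partial>torus)"
  proof (rule Bochner_Integration.integral_cong[OF refl])
    fix y assume y: "y \<in> space torus"
    have "(\<Sum>j\<in>residues M. indicator ?V (subcell M j y)) = (\<Sum>j\<in>residues M. indicator A (frac_vec y) :: real)"
      by (intro sum.cong refl) (use y subcell_in_cube[OF assms] in \<open>simp add: indicator_def *\<close>)
    then show "(1 / (real M)\<^sup>2) *\<^sub>R (\<Sum>j\<in>residues M. indicator ?V (subcell M j y)) = (indicator A (frac_vec y) :: real)"
      using assms by (simp add: card_residues)
  qed
  also have "\<dots> = (\<integral>y. indicator A y \<partial>torus)"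
  proof (rule integral_cong_AE)
    have "AE x in torus. x \<in> half_open_cell"
      using AE_half_open_cell by (subst AE_restrict_space_iff) auto
    then show "AE y in torus. indicator A (frac_vec y) = (indicator A y :: real)"
    proof eventually_elim
      case (elim y)
      then have "frac_vec y = y" by (simp add: frac_vec_def vec_eq_iff frac_eq)
      then show ?case by simp
    qed
    have "(\<lambda>x. frac_vec (1 *\<^sub>R x)) \<in> torus \<rightarrow>\<^sub>M torus" by (rule frac_dilation_measurable)
    then show "(\<lambda>y. indicator A (frac_vec y) :: real) \<in> borel_measurable torus"
      by simp
  qed simp
  also have "\<dots> = measure torus A"
    using sets.sets_into_space[OF A] by (simp add: Int_absorb2)
  finally have "measure torus ?V = measure torus A" .
  then show "emeasure ?D A = emeasure torus A"
    by (simp add: emeasure_distr[OF frac_dilation_measurable] torus.emeasure_eq_measure)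
qed simp

lemma torus_dilation:
  assumes "M > 0" and "periodic f"
  shows AE_torus_dilation: "(AE x in torus. P (f x)) \<Longrightarrow> AE x in torus. P (f (real M *\<^sub>R x))"
    and measurable_torus_dilation: "f \<in> torus \<rightarrow>\<^sub>M N \<Longrightarrow> (\<lambda>x. f (real M *\<^sub>R x)) \<in> torus \<rightarrow>\<^sub>M N"
proof -
  have eq: "f (real M *\<^sub>R x) = f (frac_vec (real M *\<^sub>R x))" for x
    by (simp add: periodic_frac_vec[OF assms(2)])
  show "AE x in torus. P (f (real M *\<^sub>R x))" if "AE x in torus. P (f x)"
    unfolding eq
    by (rule AE_distrD[OF frac_dilation_measurable]) (use that in \<open>simp only: distr_frac_dilation[OF assms(1)]\<close>)
  show "(\<lambda>x. f (real M *\<^sub>R x)) \<in> torus \<rightarrow>\<^sub>M N" if "f \<in> torus \<rightarrow>\<^sub>M N"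
    unfolding eq using measurable_comp[OF frac_dilation_measurable that] by (simp add: comp_def)
qed

lemma integrable_torus_dilation:
  fixes f :: "real^2 \<Rightarrow> 'b::{banach, second_countable_topology}"
  assumes "M > 0" and "periodic f" and "integrable torus f"
  shows "integrable torus (\<lambda>x. f (real M *\<^sub>R x))"
proof -
  have eq: "f (real M *\<^sub>R x) = f (frac_vec (real M *\<^sub>R x))" for x
    by (simp add: periodic_frac_vec[OF assms(2)])
  have "integrable (distr torus torus (\<lambda>x. frac_vec (real M *\<^sub>R x))) f"
    using assms by (simp add: distr_frac_dilation)
  then show ?thesis unfolding eq by (rule integrable_distr[OF frac_dilation_measurable])
qed

lemma nn_integral_torus_dilation:
  assumes "M > 0" and "periodic f" and "f \<in> borel_measurable torus"
  shows "(\<integral>\<^sup>+x. f (real M *\<^sub>R x) \<partial>torus) = (\<integral>\<^sup>+x. f x \<partial>torus)"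
proof -
  have eq: "f (real M *\<^sub>R x) = f (frac_vec (real M *\<^sub>R x))" for x
    by (simp add: periodic_frac_vec[OF assms(2)])
  show ?thesis unfolding eq
    using nn_integral_distr[OF frac_dilation_measurable, of f "real M"] assms
    by (simp add: distr_frac_dilation)
qed

text \<open>
  This is the adjoint of the dilation operator \<open>g \<mapsto> g (M x)\<close>. Integrals of a dilated
  function against a test function become integrals of the original function against the average,
  which is again a test function.
\<close>

definition cell_average :: "nat \<Rightarrow> (real^2 \<Rightarrow> 'b::real_vector) \<Rightarrow> real^2 \<Rightarrow> 'b" where
  "cell_average M F y = (1 / (real M)\<^sup>2) *\<^sub>R (\<Sum>j\<in>residues M. F (subcell M j y))"

lemma scale_subcell: "M > 0 \<Longrightarrow> real M *\<^sub>R subcell M j y = y + of_ivec j"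
  by (simp add: subcell_def)

text \<open>
  The dilated function \<open>g (M x)\<close> takes the same value at corresponding points of all subcells, so only
  the other factor is averaged. The pairing \<open>B\<close> is left arbitrary, because the transport term depends
  on the density and on the velocity at once.
\<close>

lemma torus_integral_dilation:
  fixes g :: "real^2 \<Rightarrow> 'b::{banach, second_countable_topology}" and L :: "real^2 \<Rightarrow> 'a"
    and B :: "'a \<Rightarrow> 'b \<Rightarrow> 'c::{banach, second_countable_topology}"
  assumes M: "M > 0" and g: "periodic g"
    and int: "integrable torus (\<lambda>x. B (L x) (g (real M *\<^sub>R x)))"
  shows "(\<integral>x. B (L x) (g (real M *\<^sub>R x)) \<partial>torus)
       = (\<integral>y. (1 / (real M)\<^sup>2) *\<^sub>R (\<Sum>j\<in>residues M. B (L (subcell M j y)) (g y)) \<partial>torus)"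
  by (subst torus_integral_subdivision(2)[OF M int])
     (simp add: scale_subcell[OF M] periodicD[OF g])

lemma torus_integral_dilation_average:
  fixes g :: "real^2 \<Rightarrow> 'b::{banach, second_countable_topology}"
  assumes "M > 0" and "periodic g"
    and "integrable torus (\<lambda>x. L x *\<^sub>R g (real M *\<^sub>R x))"
  shows "(\<integral>x. L x *\<^sub>R g (real M *\<^sub>R x) \<partial>torus) = (\<integral>y. cell_average M L y *\<^sub>R g y \<partial>torus)"
  using torus_integral_dilation[OF assms(1,2), of scaleR L] assms(3)
  by (simp add: cell_average_def scaleR_left.sum scaleR_right.sum sum_divide_distrib)

section \<open>Smooth functions and their averages over subcells\<close>

lemma C_k_mono: "C_k (Suc n) f \<Longrightarrow> C_k n f"
proof (induction n arbitrary: f)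
  case 0
  then have "isCont f x" for x
    using differentiable_imp_continuous_within[of f x UNIV] by simp
  then show ?case
    by (simp add: continuous_at_imp_continuous_on)
next
  case (Suc n)
  then show ?case by simp
qed

lemma frechet_derivative_eqI: "(f has_derivative f') (at x) \<Longrightarrow> frechet_derivative f (at x) v = f' v"
  by (simp add: frechet_derivative_at[symmetric])

lemma C_k_const: "C_k n (\<lambda>x. c)"
proof (induction n arbitrary: c)
  case (Suc n)
  then show ?case by (simp add: frechet_derivative_eqI[OF has_derivative_const])
qed simp

lemma C_k_SucI:
  assumes "\<And>x. (f has_derivative f' x) (at x)" and "\<And>v. C_k n (\<lambda>x. f' x v)"
  shows "C_k (Suc n) f"
  using assms by (auto simp: frechet_derivative_eqI[OF assms(1)] differentiable_def)

lemma C_k_SucD: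
  assumes "C_k (Suc n) f"
  shows "(f has_derivative frechet_derivative f (at x)) (at x)"
    and "C_k n (\<lambda>x. frechet_derivative f (at x) v)"
  using assms by (auto simp: frechet_derivative_works[symmetric])

lemma C_k_add: "C_k n f \<Longrightarrow> C_k n g \<Longrightarrow> C_k n (\<lambda>x. f x + g x)"
proof (induction n arbitrary: f g)
  case 0 then show ?case by (simp add: continuous_on_add)
next
  case (Suc n)
  show ?case
    by (rule C_k_SucI[OF has_derivative_add[OF C_k_SucD(1)[OF Suc.prems(1)] C_k_SucD(1)[OF Suc.prems(2)]]])
       (rule Suc.IH[OF C_k_SucD(2)[OF Suc.prems(1)] C_k_SucD(2)[OF Suc.prems(2)]])
qed

lemma C_k_mult: "C_k n f \<Longrightarrow> C_k n g \<Longrightarrow> C_k n (\<lambda>x. f x * g x)"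
proof (induction n arbitrary: f g)
  case 0 then show ?case by (simp add: continuous_on_mult)
next
  case (Suc n)
  note f = Suc.prems(1) and g = Suc.prems(2)
  show ?case
  proof (rule C_k_SucI)
    show "((\<lambda>x. f x * g x) has_derivative
        (\<lambda>v. f x * frechet_derivative g (at x) v + frechet_derivative f (at x) v * g x)) (at x)" for x
      by (rule has_derivative_mult[OF C_k_SucD(1)[OF f] C_k_SucD(1)[OF g]])
    show "C_k n (\<lambda>x. f x * frechet_derivative g (at x) v + frechet_derivative f (at x) v * g x)" for v
      by (rule C_k_add[OF Suc.IH[OF C_k_mono[OF f] C_k_SucD(2)[OF g]] Suc.IH[OF C_k_SucD(2)[OF f] C_k_mono[OF g]]])
  qed
qed

lemma C_k_sum: "(\<And>i. i \<in> S \<Longrightarrow> C_k n (f i)) \<Longrightarrow> C_k n (\<lambda>x. \<Sum>i\<in>S. f i x)"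
  by (induction S rule: infinite_finite_induct) (auto simp: C_k_const C_k_add)

text \<open>
  The constant derivative \<open>L\<close> makes \<open>A\<close> affine. Slices of space-time functions, averages over subcells,
  rescalings of time and cutoffs in time are all compositions of this kind.
\<close>

lemma C_k_compose_affine:
  fixes A :: "'a::euclidean_space \<Rightarrow> 'b::euclidean_space"
  assumes A: "\<And>x. (A has_derivative L) (at x)"
  shows "C_k n f \<Longrightarrow> C_k n (\<lambda>x. f (A x))"
proof (induction n arbitrary: f)
  case 0
  have "continuous_on UNIV A"
    using A by (auto intro!: continuous_at_imp_continuous_on has_derivative_continuous)
  then show ?case using 0 by (auto intro: continuous_on_compose2)
next
  case (Suc n)
  have "((\<lambda>x. f (A x)) has_derivative (\<lambda>v. frechet_derivative f (at (A x)) (L v))) (at x)" for x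
    using has_derivative_compose[OF A C_k_SucD(1)[OF Suc.prems]] .
  then show ?case
    by (rule C_k_SucI) (rule Suc.IH[OF C_k_SucD(2)[OF Suc.prems]])
qed

lemma smooth_mult: "smooth f \<Longrightarrow> smooth g \<Longrightarrow> smooth (\<lambda>x. f x * g x)"
  by (simp add: smooth_def C_k_mult)

lemma smooth_const: "smooth (\<lambda>x. c)"
  by (simp add: smooth_def C_k_const)

lemma smooth_sum: "(\<And>i. i \<in> S \<Longrightarrow> smooth (f i)) \<Longrightarrow> smooth (\<lambda>x. \<Sum>i\<in>S. f i x)"
  by (simp add: smooth_def C_k_sum)

lemma smooth_compose_affine:
  fixes A :: "'a::euclidean_space \<Rightarrow> 'b::euclidean_space"
  assumes "\<And>x. (A has_derivative L) (at x)" and "smooth f"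
  shows "smooth (\<lambda>x. f (A x))"
  using assms C_k_compose_affine[OF assms(1)] by (simp add: smooth_def)

lemma smooth_has_derivative: "smooth f \<Longrightarrow> (f has_derivative frechet_derivative f (at x)) (at x)"
  using C_k_SucD(1)[of 0 f x] by (simp add: smooth_def del: C_k.simps)

lemma smooth_directional: "smooth f \<Longrightarrow> smooth (\<lambda>x. frechet_derivative f (at x) v)"
  using C_k_SucD(2)[of _ f v] by (simp add: smooth_def del: C_k.simps)

lemma smooth_continuous: "smooth f \<Longrightarrow> continuous_on S f"
  using continuous_on_subset[of UNIV f S] C_k.simps(1)[of f] by (simp add: smooth_def del: C_k.simps)

lemma smooth_borel: "smooth f \<Longrightarrow> f \<in> borel_measurable borel"
  by (intro borel_measurable_continuous_onI smooth_continuous)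

lemma frechet_derivative_periodic:
  assumes "smooth f" and "\<And>x. f (x + k) = f x"
  shows "frechet_derivative f (at (x + k)) v = frechet_derivative f (at x) v"
proof -
  have "((\<lambda>x. x + k) has_derivative (\<lambda>v. v)) (at x)" by (auto intro!: derivative_eq_intros)
  from has_derivative_compose[OF this smooth_has_derivative[OF assms(1)]]
  have "(f has_derivative frechet_derivative f (at (x + k))) (at x)"
    by (simp add: assms(2))
  then show ?thesis by (simp add: frechet_derivative_eqI)
qed

lemma frechet_derivative_basis_expansion:
  fixes f :: "'a::euclidean_space \<Rightarrow> real"
  assumes "smooth f"
  shows "frechet_derivative f (at x) v = (\<Sum>b\<in>Basis. (v \<bullet> b) * frechet_derivative f (at x) b)"
proof -
  interpret linear "frechet_derivative f (at x)"
    using smooth_has_derivative[OF assms] by (rule has_derivative_linear)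
  have "frechet_derivative f (at x) (\<Sum>b\<in>Basis. (v \<bullet> b) *\<^sub>R b)
    = (\<Sum>b\<in>Basis. (v \<bullet> b) * frechet_derivative f (at x) b)"
    by (simp add: sum scale)
  then show ?thesis by (simp add: euclidean_representation)
qed

lemma test_fun_partial:
  assumes "test_fun \<phi>" shows "test_fun (partial i \<phi>)"
  using assms frechet_derivative_periodic[of \<phi>]
  by (auto simp: test_fun_def partial_def smooth_directional periodic_def)

lemma test_fun_partials: "test_fun \<phi> \<Longrightarrow> test_fun ((partial i ^^ a) \<phi>)"
  by (induction a) (auto simp: test_fun_partial)

lemma subcell_has_derivative: "(subcell M j has_derivative (\<lambda>v. v /\<^sub>R real M)) (at y)"
  unfolding subcell_def[abs_def] by (auto intro!: derivative_eq_intros)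

lemma cell_average_periodic:
  fixes \<phi> :: "real^2 \<Rightarrow> 'b::real_vector"
  assumes "M > 0" and "periodic \<phi>"
  shows "periodic (cell_average M \<phi>)"
proof -
  have "cell_average M \<phi> (y + of_ivec k) = cell_average M \<phi> y" for y k
  proof -
    have "\<phi> (subcell M (j + (\<chi> i. int M * q $ i)) y) = \<phi> (subcell M j y)" for j q
    proof -
      have "subcell M (j + (\<chi> i. int M * q $ i)) y = subcell M j y + of_ivec q"
        using assms(1) by (simp add: subcell_def vec_eq_iff field_simps)
      then show ?thesis by (simp add: periodicD[OF assms(2)])
    qed
    from sum_residues_shift[where \<psi> = "\<lambda>j. \<phi> (subcell M j y)", OF assms(1) this]
    have "(\<Sum>j\<in>residues M. \<phi> (subcell M (j + k) y)) = (\<Sum>j\<in>residues M. \<phi> (subcell M j y))" .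
    moreover have "subcell M j (y + of_ivec k) = subcell M (j + k) y" for j
      by (simp add: subcell_def vec_eq_iff)
    ultimately show ?thesis by (simp add: cell_average_def)
  qed
  then show ?thesis by (simp add: periodic_def)
qed

lemma cell_average_smooth:
  assumes "smooth \<phi>" shows "smooth (cell_average M \<phi>)"
proof -
  have "smooth (\<lambda>y. (1 / (real M)\<^sup>2) * (\<Sum>j\<in>residues M. \<phi> (subcell M j y)))"
    by (intro smooth_mult smooth_const smooth_sum
        smooth_compose_affine[OF subcell_has_derivative assms])
  then show ?thesis by (simp add: cell_average_def[abs_def])
qed

lemma cell_average_test_fun: "M > 0 \<Longrightarrow> test_fun \<phi> \<Longrightarrow> test_fun (cell_average M \<phi>)"
  by (simp add: test_fun_def cell_average_periodic cell_average_smooth)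

lemma frechet_derivative_cell_average:
  assumes "smooth \<phi>"
  shows "frechet_derivative (cell_average M \<phi>) (at y) v
    = (1 / real M) * cell_average M (\<lambda>x. frechet_derivative \<phi> (at x) v) y"
proof -
  have "(cell_average M \<phi> has_derivative (\<lambda>v. (1 / (real M)\<^sup>2) *\<^sub>R
      (\<Sum>j\<in>residues M. frechet_derivative \<phi> (at (subcell M j y)) (v /\<^sub>R real M)))) (at y)"
    unfolding cell_average_def[abs_def]
    by (intro has_derivative_scaleR_right has_derivative_sum
          has_derivative_compose[OF subcell_has_derivative smooth_has_derivative[OF assms]])
  moreover have "frechet_derivative \<phi> (at x) (v /\<^sub>R real M)
      = (1 / real M) * frechet_derivative \<phi> (at x) v" for x
    using linear_cmul[OF has_derivative_linear[OF smooth_has_derivative[OF assms]]]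
    by (simp add: divide_inverse_commute)
  ultimately show ?thesis
    by (simp add: frechet_derivative_eqI cell_average_def flip: sum_divide_distrib)
qed

lemma partial_cell_average:
  "test_fun \<phi> \<Longrightarrow> partial i (cell_average M \<phi>) = (\<lambda>y. (1 / real M) * cell_average M (partial i \<phi>) y)"
  unfolding partial_def by (simp add: frechet_derivative_cell_average test_fun_def)

lemma partial_scale:
  assumes "test_fun \<phi>"
  shows "partial i (\<lambda>y. c * \<phi> y) = (\<lambda>y. c * partial i \<phi> y)"
proof -
  have "((\<lambda>y. c * \<phi> y) has_derivative (\<lambda>v. c * frechet_derivative \<phi> (at x) v)) (at x)" for x
    using assms by (intro has_derivative_mult_right smooth_has_derivative) (simp add: test_fun_def)
  from frechet_derivative_eqI[OF this] show ?thesis unfolding partial_def by simp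
qed

text \<open>
  Each derivative of an average gains a factor \<open>1/M\<close>; dually, each derivative of a dilated function
  costs a factor \<open>M\<close>. The factor \<open>c\<close> allows the two directions to be treated one after the other.
\<close>

lemma partials_cell_average:
  assumes "M > 0" "test_fun \<phi>"
  shows "(partial i ^^ a) (\<lambda>y. c * cell_average M \<phi> y)
    = (\<lambda>y. c * (1 / real M) ^ a * cell_average M ((partial i ^^ a) \<phi>) y)"
proof (induction a)
  case (Suc a)
  let ?\<phi> = "(partial i ^^ a) \<phi>"
  have t: "test_fun ?\<phi>" by (rule test_fun_partials[OF assms(2)])
  have "(partial i ^^ Suc a) (\<lambda>y. c * cell_average M \<phi> y)
    = partial i (\<lambda>y. c * (1 / real M) ^ a * cell_average M ?\<phi> y)"
    by (simp add: Suc)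
  also have "\<dots> = (\<lambda>y. c * (1 / real M) ^ a * partial i (cell_average M ?\<phi>) y)"
    by (rule partial_scale[OF cell_average_test_fun[OF assms(1) t]])
  finally show ?case by (simp add: partial_cell_average[OF t] mult.assoc)
qed simp

text \<open>
  The functions \<open>q(1/x) exp(-1/x)\<close> for \<open>x > 0\<close>, extended by zero. For \<open>q = 1\<close> this is the standard smooth
  function that vanishes on a half-line; the other polynomials make the family closed under
  differentiation.
\<close>

definition flat_exp :: "real poly \<Rightarrow> real \<Rightarrow> real" where
  "flat_exp q x = (if x > 0 then poly q (1 / x) * exp (- (1 / x)) else 0)"

definition flat_exp_poly :: "real poly \<Rightarrow> real poly" where
  "flat_exp_poly q = [:0, 0, 1:] * (q - pderiv q)"

lemma poly_times_exp_tendsto_0: "((\<lambda>y. poly q y * exp (- y)) \<longlongrightarrow> (0::real)) at_top"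
proof -
  have "((\<lambda>y. \<Sum>i\<le>degree q. coeff q i * (y ^ i / exp y)) \<longlongrightarrow> (\<Sum>i\<le>degree q. coeff q i * 0)) at_top"
    by (intro tendsto_intros tendsto_power_div_exp_0)
  moreover have "poly q y * exp (- y) = (\<Sum>i\<le>degree q. coeff q i * (y ^ i / exp y))" for y
    by (simp add: poly_altdef exp_minus sum_distrib_right divide_inverse mult.assoc)
  ultimately show ?thesis by simp
qed

lemma flat_exp_has_derivative: "(flat_exp q has_real_derivative flat_exp (flat_exp_poly q) x) (at x)"
proof -
  consider "x > 0" | "x < 0" | "x = 0" by linarith
  then show ?thesis
  proof cases
    case 1
    have "((\<lambda>x. poly q (1 / x) * exp (- (1 / x))) has_real_derivative
        (- (1 / x\<^sup>2) * poly (pderiv q) (1 / x)) * exp (- (1 / x))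
        + (exp (- (1 / x)) * (1 / x\<^sup>2)) * poly q (1 / x)) (at x)"
      using 1 by (auto intro!: derivative_eq_intros DERIV_chain2[OF poly_DERIV] simp: power2_eq_square)
    also have "(- (1 / x\<^sup>2) * poly (pderiv q) (1 / x)) * exp (- (1 / x))
        + (exp (- (1 / x)) * (1 / x\<^sup>2)) * poly q (1 / x) = flat_exp (flat_exp_poly q) x"
      using 1 by (simp add: flat_exp_def flat_exp_poly_def power2_eq_square) (simp add: field_simps)
    finally have "((\<lambda>x. poly q (1 / x) * exp (- (1 / x))) has_real_derivative flat_exp (flat_exp_poly q) x) (at x)" .
    moreover have "\<forall>\<^sub>F y in nhds x. poly q (1 / y) * exp (- (1 / y)) = flat_exp q y"
      using eventually_nhds_in_open[of "{0<..}" x] 1 by (auto elim!: eventually_mono simp: flat_exp_def)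
    ultimately show ?thesis using DERIV_cong_ev[OF refl _ refl, THEN iffD1] by fast
  next
    case 2
    have "((\<lambda>x. 0) has_real_derivative flat_exp (flat_exp_poly q) x) (at x)"
      using 2 by (simp add: flat_exp_def)
    moreover have "\<forall>\<^sub>F y in nhds x. 0 = flat_exp q y"
      using eventually_nhds_in_open[of "{..<0}" x] 2 by (auto elim!: eventually_mono simp: flat_exp_def)
    ultimately show ?thesis using DERIV_cong_ev[OF refl _ refl, THEN iffD1] by fast
  next
    case 3
    have r: "((\<lambda>h. flat_exp q h / h) \<longlongrightarrow> 0) (at_right 0)"
    proof -
      have "((\<lambda>h. poly ([:0,1:] * q) (inverse h) * exp (- inverse h)) \<longlongrightarrow> 0) (at_right 0)"
        by (rule filterlim_compose[OF poly_times_exp_tendsto_0 filterlim_inverse_at_top_right])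
      moreover have "\<forall>\<^sub>F h in at_right 0. poly ([:0,1:] * q) (inverse h) * exp (- inverse h) = flat_exp q h / h"
        by (rule eventually_at_rightI[of 0 1]) (auto simp: flat_exp_def divide_inverse mult.commute)
      ultimately show ?thesis by (rule Lim_transform_eventually)
    qed
    have l: "((\<lambda>h. flat_exp q h / h) \<longlongrightarrow> 0) (at_left 0)"
      by (rule Lim_transform_eventually[OF tendsto_const], rule eventually_at_leftI[of "-1"])
         (auto simp: flat_exp_def)
    have "((\<lambda>h. flat_exp q h / h) \<longlongrightarrow> 0) (at 0)"
      using r l by (simp add: filterlim_split_at)
    then show ?thesis using 3 by (simp add: DERIV_def flat_exp_def)
  qed
qed

lemma flat_exp_smooth: "smooth (flat_exp q)"
proof -
  have "C_k n (flat_exp q)" for n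
  proof (induction n arbitrary: q)
    case 0
    show ?case using flat_exp_has_derivative
      by (auto intro!: continuous_at_imp_continuous_on DERIV_isCont)
  next
    case (Suc n)
    show ?case
    proof (rule C_k_SucI)
      show "(flat_exp q has_derivative (\<lambda>v. flat_exp (flat_exp_poly q) x * v)) (at x)" for x
        using flat_exp_has_derivative[of q x] by (simp add: has_field_derivative_def)
      show "C_k n (\<lambda>x. flat_exp (flat_exp_poly q) x * v)" for v
        by (rule C_k_mult[OF Suc C_k_const])
    qed
  qed
  then show ?thesis by (simp add: smooth_def)
qed

section \<open>Scaling of divergence, regularity and Fourier coefficients\<close>

lemma integrable_continuous_scaleR:
  fixes f :: "real^2 \<Rightarrow> 'b::{banach, second_countable_topology}"
  assumes h: "continuous_on UNIV h" and f: "integrable torus f"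
  shows "integrable torus (\<lambda>x. h x *\<^sub>R f x)"
proof -
  have "compact (h ` cbox 0 1)"
    by (rule compact_continuous_image[OF continuous_on_subset[OF h]]) auto
  then obtain B where B: "\<And>x. x \<in> cbox 0 1 \<Longrightarrow> \<bar>h x\<bar> \<le> B"
    using compact_imp_bounded[of "h ` cbox 0 1"] by (auto simp: bounded_iff)
  have "h \<in> borel_measurable torus"
    using borel_measurable_continuous_onI[OF h] by (simp add: measurable_restrict_space1)
  then have m: "(\<lambda>x. h x *\<^sub>R f x) \<in> borel_measurable torus"
    using f by (intro borel_measurable_scaleR) auto
  show ?thesis
  proof (rule Bochner_Integration.integrable_bound[OF _ m])
    show "integrable torus (\<lambda>x. B * norm (f x))" using f by simp
    show "AE x in torus. norm (h x *\<^sub>R f x) \<le> norm (B * norm (f x))"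
      using B by (intro AE_I2) (auto simp: abs_mult intro!: mult_right_mono order_trans[OF _ abs_ge_self])
  qed
qed

text \<open>
  The gradient of the average of \<open>\<phi>\<close> is \<open>1/M\<close> times the average of the gradient of \<open>\<phi>\<close>, so the
  pairing with the dilated field is \<open>M\<close> times the pairing of the original field with the gradient of a test function.
\<close>

lemma div_free_dilation:
  assumes M: "M > 0" and per: "periodic v" and int: "integrable torus v" and v: "div_free v"
  shows "div_free (\<lambda>x. c *\<^sub>R v (real M *\<^sub>R x))"
  unfolding div_free_def
proof (intro allI impI)
  fix \<phi> assume \<phi>: "test_fun \<phi>"
  then have sm: "smooth \<phi>" by (simp add: test_fun_def)
  note lin = has_derivative_linear[OF smooth_has_derivative[OF sm]]
  have eq: "frechet_derivative \<phi> (at x) w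
      = (\<Sum>b\<in>Basis. frechet_derivative \<phi> (at x) b *\<^sub>R (w \<bullet> b))" for x w
    using frechet_derivative_basis_expansion[OF sm, of x w] by (simp add: mult.commute)
  have I: "integrable torus (\<lambda>x. frechet_derivative \<phi> (at x) (v (real M *\<^sub>R x)))"
    by (subst Bochner_Integration.integrable_cong[OF refl eq])
       (intro Bochner_Integration.integrable_sum integrable_continuous_scaleR smooth_continuous
          smooth_directional sm integrable_inner_left integrable_torus_dilation M per int)
  have "(\<integral>x. frechet_derivative \<phi> (at x) (v (real M *\<^sub>R x)) \<partial>torus)
    = (\<integral>y. (1 / (real M)\<^sup>2) *\<^sub>R (\<Sum>j\<in>residues M. frechet_derivative \<phi> (at (subcell M j y)) (v y)) \<partial>torus)"
    by (rule torus_integral_dilation[OF M per, of "\<lambda>x w. frechet_derivative \<phi> (at x) w" "\<lambda>x. x"]) (rule I)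
  also have "\<dots> = (\<integral>y. real M * frechet_derivative (cell_average M \<phi>) (at y) (v y) \<partial>torus)"
    using M by (simp add: frechet_derivative_cell_average[OF sm] cell_average_def)
  also have "\<dots> = 0"
    using v cell_average_test_fun[OF M \<phi>] by (simp add: div_free_def)
  finally show "(\<integral>x. frechet_derivative \<phi> (at x) (c *\<^sub>R v (real M *\<^sub>R x)) \<partial>torus) = 0"
    by (simp add: linear_cmul[OF lin])
qed

lemma weak_deriv_dilation:
  assumes M: "M > 0" and per: "periodic f" and fg: "weak_deriv a b f g"
  shows "weak_deriv a b (\<lambda>x. c *\<^sub>R f (real M *\<^sub>R x)) (\<lambda>x. (c * real M ^ (a + b)) *\<^sub>R g (real M *\<^sub>R x))"
proof -
  have f: "integrable torus f" and g: "integrable torus g" and pg: "periodic g"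
    using fg by (auto simp: weak_deriv_def)
  have fM: "integrable torus (\<lambda>x. f (real M *\<^sub>R x))" and gM: "integrable torus (\<lambda>x. g (real M *\<^sub>R x))"
    using f g M per pg by (auto intro: integrable_torus_dilation)
  have "(\<integral>x. (partial 1 ^^ a) ((partial 2 ^^ b) \<phi>) x *\<^sub>R (c *\<^sub>R f (real M *\<^sub>R x)) \<partial>torus)
      = (-1) ^ (a + b) *\<^sub>R (\<integral>x. \<phi> x *\<^sub>R ((c * real M ^ (a + b)) *\<^sub>R g (real M *\<^sub>R x)) \<partial>torus)"
    if \<phi>: "test_fun \<phi>" for \<phi>
  proof -
    define h where "h = (partial 1 ^^ a) ((partial 2 ^^ b) \<phi>)"
    have h: "test_fun h" unfolding h_def by (intro test_fun_partials \<phi>)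
    have dh: "(partial 1 ^^ a) ((partial 2 ^^ b) (cell_average M \<phi>))
        = (\<lambda>y. (1 / real M) ^ b * (1 / real M) ^ a * cell_average M h y)"
      using partials_cell_average[OF M \<phi>, where i = 2 and a = b and c = 1]
        partials_cell_average[OF M test_fun_partials[OF \<phi>, where i = 2 and a = b],
          where i = 1 and a = a and c = "(1 / real M) ^ b"]
      by (simp add: h_def)
    have avg: "cell_average M h y
        = real M ^ (a + b) * (partial 1 ^^ a) ((partial 2 ^^ b) (cell_average M \<phi>)) y" for y
      unfolding dh using M by (simp add: power_add power_divide)
    have "(\<integral>x. h x *\<^sub>R (c *\<^sub>R f (real M *\<^sub>R x)) \<partial>torus) = c *\<^sub>R (\<integral>x. h x *\<^sub>R f (real M *\<^sub>R x) \<partial>torus)"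
      by (subst scaleR_left_commute) (simp only: integral_scaleR_right)
    also have "(\<integral>x. h x *\<^sub>R f (real M *\<^sub>R x) \<partial>torus) = (\<integral>y. cell_average M h y *\<^sub>R f y \<partial>torus)"
      using h by (intro torus_integral_dilation_average M per integrable_continuous_scaleR fM)
                 (auto simp: test_fun_def smooth_continuous)
    also have "\<dots> = real M ^ (a + b) *\<^sub>R
        (\<integral>y. (partial 1 ^^ a) ((partial 2 ^^ b) (cell_average M \<phi>)) y *\<^sub>R f y \<partial>torus)"
      by (simp add: avg flip: scaleR_scaleR)
    also have "(\<integral>y. (partial 1 ^^ a) ((partial 2 ^^ b) (cell_average M \<phi>)) y *\<^sub>R f y \<partial>torus)
        = (-1) ^ (a + b) *\<^sub>R (\<integral>y. cell_average M \<phi> y *\<^sub>R g y \<partial>torus)"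
      using fg cell_average_test_fun[OF M \<phi>] by (simp add: weak_deriv_def)
    also have "(\<integral>y. cell_average M \<phi> y *\<^sub>R g y \<partial>torus) = (\<integral>x. \<phi> x *\<^sub>R g (real M *\<^sub>R x) \<partial>torus)"
      using \<phi> by (intro torus_integral_dilation_average[symmetric] M pg integrable_continuous_scaleR gM)
                 (auto simp: test_fun_def smooth_continuous)
    finally have "(\<integral>x. h x *\<^sub>R (c *\<^sub>R f (real M *\<^sub>R x)) \<partial>torus)
        = (-1) ^ (a + b) *\<^sub>R ((c * real M ^ (a + b)) *\<^sub>R (\<integral>x. \<phi> x *\<^sub>R g (real M *\<^sub>R x) \<partial>torus))"
      by (simp add: mult.left_commute mult.commute)
    also have "(c * real M ^ (a + b)) *\<^sub>R (\<integral>x. \<phi> x *\<^sub>R g (real M *\<^sub>R x) \<partial>torus)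
        = (\<integral>x. \<phi> x *\<^sub>R ((c * real M ^ (a + b)) *\<^sub>R g (real M *\<^sub>R x)) \<partial>torus)"
      by (subst scaleR_left_commute) (simp only: integral_scaleR_right)
    finally show ?thesis by (simp add: h_def)
  qed
  moreover have "periodic (\<lambda>x. (c * real M ^ (a + b)) *\<^sub>R g (real M *\<^sub>R x))"
    unfolding periodic_def
    by (auto simp: scaleR_add_right periodicD[OF pg] simp flip: of_ivec_scale)
  ultimately show ?thesis
    using fM gM by (simp add: weak_deriv_def)
qed

lemma weak_derivs_dilation:
  assumes "M > 0" and "periodic f" and "weak_derivs m f G"
  shows "weak_derivs m (\<lambda>x. c *\<^sub>R f (real M *\<^sub>R x)) (\<lambda>j x. (c * real M ^ m) *\<^sub>R G j (real M *\<^sub>R x))"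
  using weak_deriv_dilation[OF assms(1,2)] assms(3) unfolding weak_derivs_def
  by (metis le_add_diff_inverse)

lemma cis_inner_measurable: "(\<lambda>x. cis (c * (k \<bullet> x))) \<in> borel_measurable torus"
proof -
  have "(\<lambda>x. cis (c * (k \<bullet> x))) \<in> borel_measurable (borel :: (real^2) measure)"
    by (intro borel_measurable_continuous_onI continuous_intros)
  then show ?thesis by (intro measurable_restrict_space1) simp
qed

lemma integrable_cis_mult:
  assumes "integrable torus f"
  shows "integrable torus (\<lambda>x. complex_of_real (f x) * cis (c * (k \<bullet> x)))"
proof (rule Bochner_Integration.integrable_bound[OF assms])
  show "(\<lambda>x. complex_of_real (f x) * cis (c * (k \<bullet> x))) \<in> borel_measurable torus"
    using assms by (intro borel_measurable_times borel_measurable_of_real cis_inner_measurable) auto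
qed (simp add: norm_mult)

lemma cis_eq_1_imp_Ints:
  assumes "cis (2 * pi * r) = 1" shows "r \<in> \<int>"
proof -
  have "cos (2 * pi * r) = 1" using assms by (metis cis.sel(1) one_complex.sel(1))
  then obtain n :: int where "2 * pi * r = real_of_int n * 2 * pi"
    by (rule iffD1[OF cos_one_2pi_int, THEN exE])
  then have "r = real_of_int n" by simp
  then show ?thesis by simp
qed

text \<open>
  A shift by a unit vector multiplies the sum by a root of unity, which differs from \<open>1\<close> for a suitable
  direction unless \<open>M\<close> divides \<open>k\<close>; since the shift does not change the sum, the sum is then zero.
\<close>

lemma sum_characters_residues:
  assumes M: "M > 0"
  shows "(\<Sum>j\<in>residues M. cis (- 2 * pi * (of_ivec k \<bullet> (of_ivec j /\<^sub>R real M))))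
    = (if \<forall>i. int M dvd k $ i then complex_of_real ((real M)\<^sup>2) else 0)" (is "?S = _")
proof (cases "\<forall>i. int M dvd k $ i")
  case True
  then obtain q where q: "\<And>i. k $ i = int M * q i" unfolding dvd_def by metis
  have "cis (- 2 * pi * (of_ivec k \<bullet> (of_ivec j /\<^sub>R real M))) = 1" for j
  proof -
    have "- (of_ivec k \<bullet> (of_ivec j /\<^sub>R real M)) = of_int (- (\<Sum>i\<in>UNIV. q i * j $ i))"
      using M by (simp add: inner_vec_def q field_simps sum_negf)
    then have "cis (2 * pi * (- (of_ivec k \<bullet> (of_ivec j /\<^sub>R real M)))) = 1"
      by (metis cis_multiple_2pi Ints_of_int)
    then show ?thesis by simp
  qed
  then have "?S = (\<Sum>j\<in>residues M. 1)" by (intro sum.cong) auto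
  also have "\<dots> = complex_of_real (real (card (residues M)))" by simp
  finally show ?thesis using True by (simp add: card_residues[OF M])
next
  case False
  then obtain i where i: "\<not> int M dvd k $ i" by blast
  let ?\<psi> = "\<lambda>j. cis (- 2 * pi * (of_ivec k \<bullet> (of_ivec j /\<^sub>R real M)))"
  let ?w = "cis (- 2 * pi * (real_of_int (k $ i) / real M))"
  have "?\<psi> (j + (\<chi> i. int M * q $ i)) = ?\<psi> j" for j q
  proof -
    have "- 2 * pi * (of_ivec k \<bullet> (of_ivec (j + (\<chi> i. int M * q $ i)) /\<^sub>R real M))
      = - 2 * pi * (of_ivec k \<bullet> (of_ivec j /\<^sub>R real M)) + 2 * pi * (- (of_ivec k \<bullet> of_ivec q))"
      unfolding of_ivec_add of_ivec_scale using M
      by (simp add: inner_add_right scaleR_add_right algebra_simps)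
    moreover have "- (of_ivec k \<bullet> of_ivec q) \<in> \<int>"
      by (auto simp: inner_vec_def)
    ultimately show ?thesis by (simp only: cis_multiple_2pi mult_1_right flip: cis_mult)
  qed
  from sum_residues_shift[where \<psi> = ?\<psi> and k = "axis i 1", OF M this]
  have "(\<Sum>j\<in>residues M. ?\<psi> (j + axis i 1)) = ?S" .
  moreover have "?\<psi> (j + axis i 1) = ?w * ?\<psi> j" for j
  proof -
    have "of_ivec (axis i 1) = axis i 1" by (simp add: vec_eq_iff axis_def)
    then have "- 2 * pi * (of_ivec k \<bullet> (of_ivec (j + axis i 1) /\<^sub>R real M))
      = - 2 * pi * (real_of_int (k $ i) / real M) + - 2 * pi * (of_ivec k \<bullet> (of_ivec j /\<^sub>R real M))"
      by (simp add: of_ivec_add inner_add_right scaleR_add_right inner_axis divide_inverse algebra_simps)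
    then show ?thesis by (simp only: cis_mult)
  qed
  ultimately have "?w * ?S = ?S" by (simp only: sum_distrib_left)
  moreover have "?w \<noteq> 1"
  proof
    assume "?w = 1"
    then have "cis (2 * pi * (- (real_of_int (k $ i) / real M))) = 1" by simp
    then obtain n where "- (real_of_int (k $ i) / real M) = real_of_int n"
      by (rule Ints_cases[OF cis_eq_1_imp_Ints])
    then have "real_of_int (k $ i) = real_of_int (int M * (- n))"
      using M by (simp add: field_simps)
    then have "k $ i = int M * (- n)" by (simp only: of_int_eq_iff)
    with i show False by simp
  qed
  moreover have "z = 0" if "w * z = z" "w \<noteq> 1" for w z :: complex
    using that by simp
  ultimately have "?S = 0" by blast
  then show ?thesis by (simp only: False if_False)
qed

text \<open>
  Averaging a character of frequency \<open>k\<close> over the subcells gives the character of frequency \<open>k/M\<close> times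
  a character sum, so the frequencies of a dilated function are \<open>M\<close> times those of the original one.
\<close>

lemma fourier_coeff_dilation:
  assumes M: "M > 0" and per: "periodic f" and f: "integrable torus f"
  shows "fourier_coeff (\<lambda>x. f (real M *\<^sub>R x)) k
    = (if \<forall>i. int M dvd k $ i then fourier_coeff f (\<chi> i. k $ i div int M) else 0)"
proof -
  let ?e = "\<lambda>x. cis (- 2 * pi * (of_ivec k \<bullet> x))"
  have fM: "integrable torus (\<lambda>x. f (real M *\<^sub>R x))"
    using M per f by (rule integrable_torus_dilation)
  have e: "?e (subcell M j y) = ?e (y /\<^sub>R real M) * ?e (of_ivec j /\<^sub>R real M)" for j y
    by (simp add: cis_mult subcell_def scaleR_add_right inner_add_right algebra_simps)
  have "fourier_coeff (\<lambda>x. f (real M *\<^sub>R x)) k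
    = (\<integral>y. (1 / (real M)\<^sup>2) *\<^sub>R (\<Sum>j\<in>residues M. complex_of_real (f y) * ?e (subcell M j y)) \<partial>torus)"
    unfolding fourier_coeff_def
    by (rule torus_integral_dilation[OF M per, of "\<lambda>x r. complex_of_real r * ?e x" "\<lambda>x. x"])
       (rule integrable_cis_mult[OF fM])
  also have "\<dots> = (\<integral>y. complex_of_real (f y) * ?e (y /\<^sub>R real M) *
      ((1 / (real M)\<^sup>2) *\<^sub>R (\<Sum>j\<in>residues M. ?e (of_ivec j /\<^sub>R real M))) \<partial>torus)"
    unfolding e by (simp only: sum_distrib_left scaleR_right.sum mult_scaleR_right mult.assoc)
  also have "\<dots> = (if \<forall>i. int M dvd k $ i then fourier_coeff f (\<chi> i. k $ i div int M) else 0)"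
  proof (cases "\<forall>i. int M dvd k $ i")
    case True
    have "of_ivec k \<bullet> (y /\<^sub>R real M) = of_ivec (\<chi> i. k $ i div int M) \<bullet> y" for y
    proof -
      have "k = (\<chi> i. int M * (\<chi> i. k $ i div int M) $ i)"
        using True by (simp add: vec_eq_iff)
      then have "of_ivec k = real M *\<^sub>R of_ivec (\<chi> i. k $ i div int M)"
        using of_ivec_scale by metis
      then show ?thesis using M by simp
    qed
    moreover have "(1 / (real M)\<^sup>2) *\<^sub>R complex_of_real ((real M)\<^sup>2) = 1"
      using M by (simp add: scaleR_conv_of_real)
    ultimately show ?thesis
      unfolding sum_characters_residues[OF M]
      using True by (simp only: if_True fourier_coeff_def mult_1_right simp_thms)
  next
    case False
    then show ?thesis by (simp only: sum_characters_residues[OF M] if_False scaleR_zero_right mult_zero_right) simp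
  qed
  finally show ?thesis .
qed

text \<open>
  The constant function is its own dilation by every \<open>M\<close>. For an \<open>M\<close> that does not divide \<open>m\<close>,
  its coefficient at \<open>m\<close> is therefore zero.
\<close>

lemma integral_character:
  assumes "m \<noteq> 0" shows "(\<integral>x. cis (- 2 * pi * (of_ivec m \<bullet> x)) \<partial>torus) = 0"
proof -
  obtain i where i: "m $ i \<noteq> 0" using assms by (auto simp: vec_eq_iff)
  \<comment> \<open>larger than the nonzero entry, hence not a divisor of it\<close>
  define M where "M = nat \<bar>m $ i\<bar> + 1"
  have "\<not> int M dvd m $ i"
    using zdvd_imp_le[of "int M" "\<bar>m $ i\<bar>"] i by (auto simp: M_def)
  then have "fourier_coeff (\<lambda>x. 1) m = 0"
    using fourier_coeff_dilation[of M "\<lambda>x. 1" m] by (auto simp: M_def periodic_def)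
  then show ?thesis by (simp add: fourier_coeff_def)
qed

text \<open>
  The distance in \<open>L^2\<close> of \<open>f\<close> from its partial Fourier sum over \<open>F\<close> is nonnegative.
\<close>

lemma bessel_inequality:
  fixes f :: "real^2 \<Rightarrow> real"
  assumes f: "f \<in> borel_measurable torus" and B: "AE x in torus. \<bar>f x\<bar> \<le> B" and F: "finite F"
  shows "(\<Sum>k\<in>F. (cmod (fourier_coeff f k))\<^sup>2) \<le> B\<^sup>2"
proof -
  define E where "E k x = cis (- 2 * pi * (of_ivec k \<bullet> x))" for k x
  let ?c = "fourier_coeff f"
  define P where "P x = (\<Sum>k\<in>F. ?c k * cnj (E k x))" for x
  have Em: "E k \<in> borel_measurable torus" for k
    unfolding E_def[abs_def] by (rule cis_inner_measurable)
  have fi: "integrable torus f"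
    using f B by (intro torus.integrable_const_bound[of _ B]) auto
  have fE: "integrable torus (\<lambda>x. complex_of_real (f x) * E k x)" for k
    unfolding E_def by (rule integrable_cis_mult[OF fi])
  have fcE: "integrable torus (\<lambda>x. complex_of_real (f x) * cnj (E k x))" for k
    using integrable_cnj[OF fE[of k]] by simp
  have E_cnj_mult: "cnj (E k x) * E l x = cis (- 2 * pi * (of_ivec (l - k) \<bullet> x))" for k l x
    by (simp add: E_def cis_cnj cis_mult inner_vec_def algebra_simps sum_subtractf sum_distrib_left)
  have EE: "integrable torus (\<lambda>x. cnj (E k x) * E l x)" for k l
    unfolding E_cnj_mult
    by (rule torus.integrable_const_bound[where B = 1, OF _ cis_inner_measurable]) simp
  have orth: "(\<integral>x. cnj (E k x) * E l x \<partial>torus) = (if k = l then 1 else 0)" for k l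
  proof (cases "k = l")
    case True
    have "of_ivec 0 = 0" by (simp add: vec_eq_iff)
    with True show ?thesis by (simp add: E_cnj_mult)
  next
    case False
    then show ?thesis unfolding E_cnj_mult using integral_character[of "l - k"] by simp
  qed
  let ?S = "\<Sum>k\<in>F. (cmod (?c k))\<^sup>2"
  have expand: "complex_of_real ((cmod (complex_of_real (f x) - P x))\<^sup>2)
      = complex_of_real ((f x)\<^sup>2) - (\<Sum>k\<in>F. cnj (?c k) * (complex_of_real (f x) * E k x))
        - (\<Sum>k\<in>F. ?c k * (complex_of_real (f x) * cnj (E k x)))
        + (\<Sum>k\<in>F. \<Sum>l\<in>F. ?c k * cnj (?c l) * (cnj (E k x) * E l x))" for x
  proof -
    have 1: "P x * cnj (P x) = (\<Sum>k\<in>F. \<Sum>l\<in>F. ?c k * cnj (?c l) * (cnj (E k x) * E l x))"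
      unfolding P_def cnj_sum sum_product by (intro sum.cong refl) (simp add: algebra_simps)
    have 2: "complex_of_real (f x) * cnj (P x) = (\<Sum>k\<in>F. cnj (?c k) * (complex_of_real (f x) * E k x))"
      unfolding P_def cnj_sum sum_distrib_left by (intro sum.cong refl) (simp add: algebra_simps)
    have 3: "complex_of_real (f x) * P x = (\<Sum>k\<in>F. ?c k * (complex_of_real (f x) * cnj (E k x)))"
      unfolding P_def sum_distrib_left by (intro sum.cong refl) (simp add: algebra_simps)
    show ?thesis
      unfolding complex_norm_square 1[symmetric] 2[symmetric] 3[symmetric]
      by (simp add: algebra_simps power2_eq_square)
  qed
  have f2: "integrable torus (\<lambda>x. (f x)\<^sup>2)"
    using f B by (intro torus.integrable_const_bound[of _ "B\<^sup>2"])
      (auto simp: abs_le_square_iff[symmetric] elim!: eventually_mono)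
  have "complex_of_real (\<integral>x. (cmod (complex_of_real (f x) - P x))\<^sup>2 \<partial>torus)
      = (\<integral>x. complex_of_real ((cmod (complex_of_real (f x) - P x))\<^sup>2) \<partial>torus)"
    by (rule integral_complex_of_real[symmetric])
  also have "\<dots> = complex_of_real (\<integral>x. (f x)\<^sup>2 \<partial>torus)
      - (\<Sum>k\<in>F. cnj (?c k) * ?c k) - (\<Sum>k\<in>F. ?c k * cnj (?c k)) + (\<Sum>k\<in>F. ?c k * cnj (?c k))"
  proof -
    have 1: "(\<integral>x. complex_of_real (f x) * cnj (E k x) \<partial>torus) = cnj (?c k)" for k
      using Bochner_Integration.integral_cnj[of torus "\<lambda>x. complex_of_real (f x) * E k x"]
      by (simp add: fourier_coeff_def E_def)
    have 2: "(\<integral>x. complex_of_real (f x) * E k x \<partial>torus) = ?c k" for k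
      by (simp add: fourier_coeff_def E_def)
    have 3: "(\<Sum>k\<in>F. \<Sum>l\<in>F. ?c k * cnj (?c l) * (if k = l then 1 else 0)) = (\<Sum>k\<in>F. ?c k * cnj (?c k))"
      using F by (intro sum.cong refl) (simp add: if_distrib[of "\<lambda>z. _ * z"] sum.delta' cong: if_cong)
    show ?thesis
      unfolding expand using f2 fE fcE EE
      by (simp add: Bochner_Integration.integral_sum Bochner_Integration.integrable_sum orth 1 2 3
          del: of_real_power)
  qed
  also have "\<dots> = complex_of_real ((\<integral>x. (f x)\<^sup>2 \<partial>torus) - ?S)"
    by (simp add: complex_norm_square mult.commute del: of_real_power)
  finally have "(\<integral>x. (cmod (complex_of_real (f x) - P x))\<^sup>2 \<partial>torus) = (\<integral>x. (f x)\<^sup>2 \<partial>torus) - ?S"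
    by (simp only: of_real_eq_iff)
  moreover have "0 \<le> (\<integral>x. (cmod (complex_of_real (f x) - P x))\<^sup>2 \<partial>torus)" by simp
  moreover have "(\<integral>x. (f x)\<^sup>2 \<partial>torus) \<le> (\<integral>x. B\<^sup>2 \<partial>torus)"
    using B f2 by (intro integral_mono_AE) (auto simp: abs_le_square_iff[symmetric] elim!: eventually_mono)
  ultimately show ?thesis by simp
qed

lemma norm_of_ivec_ge:
  assumes "k \<noteq> 0" and "\<forall>i. int M dvd k $ i" shows "real M \<le> norm (of_ivec k)"
proof -
  obtain i where i: "k $ i \<noteq> 0" using assms(1) by (auto simp: vec_eq_iff)
  have "int M \<le> \<bar>k $ i\<bar>" using i assms(2) by (simp add: zdvd_imp_le)
  then have "real M \<le> \<bar>of_ivec k $ i\<bar>" by simp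
  also have "\<dots> \<le> norm (of_ivec k)" by (rule component_le_norm_cart)
  finally show ?thesis .
qed

text \<open>
  The mixing estimate. Nonzero frequencies of the dilated function have size at least \<open>M\<close>, so the weight
  \<open>\<bar>k\<bar>^{-2}\<close> is at most \<open>M^{-2}\<close> wherever the coefficient does not vanish. The dilated function obeys the same
  pointwise bound as the original one, and Bessel's inequality bounds the sum of its squared coefficients.
\<close>

lemma Hm1_norm_dilation:
  fixes f :: "real^2 \<Rightarrow> real"
  assumes M: "M > 0" and per: "periodic f" and f: "f \<in> borel_measurable torus"
    and B: "AE x in torus. \<bar>f x\<bar> \<le> B" "0 \<le> B"
  shows "Hm1_norm (\<lambda>x. f (real M *\<^sub>R x)) \<le> ennreal (B / real M)"
proof -
  let ?f = "\<lambda>x. f (real M *\<^sub>R x)"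
  have fm: "?f \<in> borel_measurable torus" by (rule measurable_torus_dilation[OF M per f])
  have fb: "AE x in torus. \<bar>?f x\<bar> \<le> B" by (rule AE_torus_dilation[OF M per B(1)])
  have fi: "integrable torus f"
    using f B by (intro torus.integrable_const_bound[of _ B]) auto
  let ?t = "\<lambda>k. (cmod (fourier_coeff ?f k))\<^sup>2 / (norm (of_ivec k))\<^sup>2"
  have le: "?t k \<le> (cmod (fourier_coeff ?f k))\<^sup>2 / (real M)\<^sup>2" if "k \<noteq> 0" for k
  proof (cases "\<forall>i. int M dvd k $ i")
    case True
    have "real M \<le> norm (of_ivec k)" by (rule norm_of_ivec_ge[OF that True])
    then have "(real M)\<^sup>2 \<le> (norm (of_ivec k))\<^sup>2" by (intro power_mono) auto
    with M show ?thesis by (intro divide_left_mono mult_pos_pos) auto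
  next
    case False
    then have "fourier_coeff ?f k = 0" by (simp only: fourier_coeff_dilation[OF M per fi, of k] if_False)
    then show ?thesis by simp
  qed
  have total: "(\<Sum>\<^sub>\<infinity>k\<in>UNIV - {0}. ennreal (?t k)) \<le> ennreal ((B / real M)\<^sup>2)"
  proof (rule infsum_le_finite_sums[OF nonneg_summable_on_complete])
    fix F :: "(int^2) set" assume F: "finite F" "F \<subseteq> UNIV - {0}"
    have "(\<Sum>k\<in>F. ennreal (?t k)) = ennreal (\<Sum>k\<in>F. ?t k)" by (rule sum_ennreal) simp
    also have "(\<Sum>k\<in>F. ?t k) \<le> (\<Sum>k\<in>F. (cmod (fourier_coeff ?f k))\<^sup>2 / (real M)\<^sup>2)"
      using F by (intro sum_mono le) auto
    also have "\<dots> \<le> (B / real M)\<^sup>2"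
      using bessel_inequality[OF fm fb F(1)] by (simp add: power_divide divide_right_mono flip: sum_divide_distrib)
    finally show "(\<Sum>k\<in>F. ennreal (?t k)) \<le> ennreal ((B / real M)\<^sup>2)" by (simp add: ennreal_leI)
  qed simp
  define X where "X = (\<Sum>\<^sub>\<infinity>k\<in>UNIV - {0}. ennreal (?t k))"
  have X: "X \<le> ennreal ((B / real M)\<^sup>2)" using total by (simp only: X_def)
  have "X \<noteq> \<infinity>" using X by (auto simp: top_unique)
  have "enn2real X \<le> (B / real M)\<^sup>2" by (rule enn2real_leI[OF _ X]) simp
  then have "enn2real X powr (1 / 2) \<le> B / real M"
    using B(2) by (simp add: powr_half_sqrt real_le_lsqrt)
  then have "ennreal_root 2 X \<le> ennreal (B / real M)"
    using \<open>X \<noteq> \<infinity>\<close> by (simp only: ennreal_root_def if_False ennreal_leI)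
  then show ?thesis by (simp only: Hm1_norm_def X_def)
qed

lemma Lp_norm_dilation:
  fixes f :: "real^2 \<Rightarrow> 'b::{real_normed_vector, second_countable_topology}"
  assumes M: "M > 0" and per: "periodic f" and f: "f \<in> borel_measurable torus"
  shows "Lp_norm p (\<lambda>x. f (real M *\<^sub>R x)) \<le> Lp_norm p f"
proof (cases "p = \<infinity>")
  case True
  have "AE x in torus. ennreal (norm (f (real M *\<^sub>R x))) \<le> esssup torus (\<lambda>x. ennreal (norm (f x)))"
    by (rule AE_torus_dilation[OF M per]) (rule esssup_AE)
  moreover have "(\<lambda>x. f (real M *\<^sub>R x)) \<in> borel_measurable torus"
    by (rule measurable_torus_dilation[OF M per f])
  ultimately show ?thesis using True by (auto simp: Lp_norm_def intro!: esssup_I)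
next
  case False
  let ?g = "\<lambda>x. ennreal (norm (f x) powr enn2real p)"
  have "periodic ?g" using per by (simp add: periodic_def)
  moreover have "?g \<in> borel_measurable torus" using f by measurable
  ultimately have "(\<integral>\<^sup>+x. ?g (real M *\<^sub>R x) \<partial>torus) = (\<integral>\<^sup>+x. ?g x \<partial>torus)"
    by (rule nn_integral_torus_dilation[OF M])
  then show ?thesis using False by (simp add: Lp_norm_def)
qed

lemma periodic_dilation: "periodic f \<Longrightarrow> periodic (\<lambda>x. h (f (real M *\<^sub>R x)))"
  unfolding periodic_def scaleR_add_right of_ivec_scale[symmetric] by simp

lemma frac_laplace_dilation:
  assumes M: "M > 0" and per: "periodic f" and fg: "frac_laplace s f g"
  shows "frac_laplace s (\<lambda>x. (real M powr (- s)) *\<^sub>R f (real M *\<^sub>R x)) (\<lambda>x. g (real M *\<^sub>R x))"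
proof -
  have f: "integrable torus f" and g: "integrable torus g" and pg: "periodic g"
    and fc: "\<And>i k. fourier_coeff (\<lambda>x. g x $ i) k =
        complex_of_real (if s = 0 then 1 else norm (of_ivec k) powr s) * fourier_coeff (\<lambda>x. f x $ i) k"
    using fg by (auto simp: frac_laplace_def)
  have int: "integrable torus (\<lambda>x. h x $ i)" if "integrable torus h" for h :: "real^2 \<Rightarrow> real^2" and i
    using integrable_inner_left[OF that, of "axis i 1"] by (simp add: inner_axis)
  have pc: "periodic (\<lambda>x. h x $ i)" if "periodic h" for h :: "real^2 \<Rightarrow> real^2" and i
    using that by (simp add: periodic_def)
  have "fourier_coeff (\<lambda>x. g (real M *\<^sub>R x) $ i) k =
      complex_of_real (if s = 0 then 1 else norm (of_ivec k) powr s)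
      * fourier_coeff (\<lambda>x. ((real M powr (- s)) *\<^sub>R f (real M *\<^sub>R x)) $ i) k" for i k
  proof -
    let ?l = "(\<chi> i. k $ i div int M) :: int^2"
    have lin: "fourier_coeff (\<lambda>x. ((real M powr (- s)) *\<^sub>R f (real M *\<^sub>R x)) $ i) k
      = complex_of_real (real M powr (- s)) * fourier_coeff (\<lambda>x. f (real M *\<^sub>R x) $ i) k"
      by (simp add: fourier_coeff_def mult.assoc)
    have G: "fourier_coeff (\<lambda>x. g (real M *\<^sub>R x) $ i) k
        = (if \<forall>i. int M dvd k $ i then fourier_coeff (\<lambda>x. g x $ i) ?l else 0)"
      by (rule fourier_coeff_dilation[OF M pc[OF pg] int[OF g]])
    have F: "fourier_coeff (\<lambda>x. f (real M *\<^sub>R x) $ i) k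
        = (if \<forall>i. int M dvd k $ i then fourier_coeff (\<lambda>x. f x $ i) ?l else 0)"
      by (rule fourier_coeff_dilation[OF M pc[OF per] int[OF f]])
    show ?thesis
    proof (cases "\<forall>i. int M dvd k $ i")
      case True
      have "k = (\<chi> i. int M * ?l $ i)" using True by (simp add: vec_eq_iff)
      then have k: "of_ivec k = real M *\<^sub>R of_ivec ?l" using of_ivec_scale by metis
      have "complex_of_real (if s = 0 then 1 else norm (of_ivec ?l) powr s)
        = complex_of_real (if s = 0 then 1 else norm (of_ivec k) powr s) * complex_of_real (real M powr (- s))"
        using M by (simp add: k powr_mult powr_minus field_simps)
      then show ?thesis using True unfolding lin G F by (simp add: fc)
    next
      case False
      then show ?thesis unfolding lin G F by (simp only: if_False mult_zero_right)
    qed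
  qed
  then show ?thesis
    using integrable_torus_dilation[OF M per f] integrable_torus_dilation[OF M pg g]
      periodic_dilation[OF pg, of "\<lambda>x. x" M]
    by (auto simp: frac_laplace_def)
qed

lemma holder_const_dilation:
  assumes M: "M > 0"
  shows "holder_const \<gamma> m (\<lambda>j x. (real M powr (- \<gamma>)) *\<^sub>R G j (real M *\<^sub>R x)) \<le> holder_const \<gamma> m G"
  unfolding holder_const_def
proof (rule SUP_least, clarify)
  fix x y :: "real^2" assume "x \<noteq> y"
  have nrm: "norm ((real M powr (- \<gamma>)) *\<^sub>R a - (real M powr (- \<gamma>)) *\<^sub>R b) = real M powr (- \<gamma>) * norm (a - b)"
    for a b :: "real^2"
    by (simp only: norm_scaleR flip: scaleR_diff_right) simp
  have dist: "norm (real M *\<^sub>R x - real M *\<^sub>R y) = real M * norm (x - y)"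
    by (simp only: norm_scaleR flip: scaleR_diff_right)
  have "(\<Sum>j\<le>m. norm ((real M powr (- \<gamma>)) *\<^sub>R G j (real M *\<^sub>R x) - (real M powr (- \<gamma>)) *\<^sub>R G j (real M *\<^sub>R y)))
      / norm (x - y) powr \<gamma>
    = (\<Sum>j\<le>m. norm (G j (real M *\<^sub>R x) - G j (real M *\<^sub>R y))) / norm (real M *\<^sub>R x - real M *\<^sub>R y) powr \<gamma>"
    unfolding nrm dist sum_distrib_left[symmetric] using M
    by (simp add: powr_mult powr_minus divide_inverse)
  also have "ennreal \<dots> \<le> (SUP (x, y) \<in> {(x, y). x \<noteq> y}. ennreal ((\<Sum>j\<le>m. norm (G j x - G j y)) / norm (x - y) powr \<gamma>))"
    using \<open>x \<noteq> y\<close> M by (intro SUP_upper2[of "(real M *\<^sub>R x, real M *\<^sub>R y)"]) auto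
  finally show "ennreal ((\<Sum>j\<le>m. norm ((real M powr (- \<gamma>)) *\<^sub>R G j (real M *\<^sub>R x) - (real M powr (- \<gamma>)) *\<^sub>R G j (real M *\<^sub>R y)))
      / norm (x - y) powr \<gamma>)
    \<le> (SUP (x, y) \<in> {(x, y). x \<noteq> y}. ennreal ((\<Sum>j\<le>m. norm (G j x - G j y)) / norm (x - y) powr \<gamma>))" .
qed

text \<open>
  A derivative of order \<open>s\<close> of \<open>f (M x)\<close> is \<open>M^s\<close> times the dilated derivative of \<open>f\<close>, and dilation changes
  no \<open>L^p\<close> norm. Each function that competes in the infimum for \<open>f\<close> thus yields one for the rescaled
  field with the same norm or a smaller one. In the Hoelder case the derivatives have order \<open>m < s\<close>,
  and the remaining factor \<open>M^{m - s}\<close> is absorbed by the change of distances.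
\<close>

lemma Wdot_norm_dilation:
  assumes M: "M > 0" and s: "s \<ge> 0" and per: "periodic f" and f: "f \<in> borel_measurable torus"
  shows "Wdot_norm s p (\<lambda>x. (real M powr (- s)) *\<^sub>R f (real M *\<^sub>R x)) \<le> Wdot_norm s p f"
proof -
  let ?f = "\<lambda>x. (real M powr (- s)) *\<^sub>R f (real M *\<^sub>R x)"
  consider "p = \<infinity>" "s = 0" | "p = \<infinity>" "s \<noteq> 0" | "p = 1" "s \<in> \<int>" | "p \<noteq> \<infinity>" "\<not> (p = 1 \<and> s \<in> \<int>)"
    by blast
  then show ?thesis
  proof cases
    case 1
    then show ?thesis using M Lp_norm_dilation[OF M per f] by (simp add: Wdot_norm_def)
  next
    case 2
    define m where "m = nat (\<lceil>s\<rceil> - 1)"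
    have c: "real M powr (- s) * real M ^ m = real M powr (- (s - real m))"
      using M by (simp add: powr_diff powr_minus powr_realpow divide_inverse)
    have "(INF G \<in> {G. weak_derivs m ?f G}. holder_const (s - real m) m G)
        \<le> (INF G \<in> {G. weak_derivs m f G}. holder_const (s - real m) m G)"
    proof (rule INF_mono)
      fix G assume "G \<in> {G. weak_derivs m f G}"
      then have "weak_derivs m ?f (\<lambda>j x. (real M powr (- (s - real m))) *\<^sub>R G j (real M *\<^sub>R x))"
        using weak_derivs_dilation[OF M per, of m G "real M powr (- s)"] unfolding c by simp
      with holder_const_dilation[OF M, of "s - real m" m G]
      show "\<exists>G'\<in>{G. weak_derivs m ?f G}. holder_const (s - real m) m G' \<le> holder_const (s - real m) m G"
        by (intro bexI[of _ "\<lambda>j x. (real M powr (- (s - real m))) *\<^sub>R G j (real M *\<^sub>R x)"]) simp_all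
    qed
    then show ?thesis using 2 by (simp add: Wdot_norm_def m_def Let_def)
  next
    case 3
    define m where "m = nat \<lfloor>s\<rfloor>"
    have "s = real m" using 3 s by (auto simp: m_def elim!: Ints_cases)
    then have c: "real M powr (- s) * real M ^ m = 1"
      using M by (simp add: powr_minus powr_realpow)
    have "(INF G \<in> {G. weak_derivs m ?f G}. \<Sum>j\<le>m. Lp_norm 1 (G j))
        \<le> (INF G \<in> {G. weak_derivs m f G}. \<Sum>j\<le>m. Lp_norm 1 (G j))"
    proof (rule INF_mono)
      fix G assume G: "G \<in> {G. weak_derivs m f G}"
      have "(\<Sum>j\<le>m. Lp_norm 1 (\<lambda>x. G j (real M *\<^sub>R x))) \<le> (\<Sum>j\<le>m. Lp_norm 1 (G j))"
        using G by (intro sum_mono Lp_norm_dilation[OF M]) (auto simp: weak_derivs_def weak_deriv_def)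
      moreover have "weak_derivs m ?f (\<lambda>j x. G j (real M *\<^sub>R x))"
        using weak_derivs_dilation[OF M per, of m G "real M powr (- s)"] G unfolding c by simp
      ultimately show "\<exists>G'\<in>{G. weak_derivs m ?f G}. (\<Sum>j\<le>m. Lp_norm 1 (G' j)) \<le> (\<Sum>j\<le>m. Lp_norm 1 (G j))"
        by (intro bexI[of _ "\<lambda>j x. G j (real M *\<^sub>R x)"]) auto
    qed
    then show ?thesis using 3 by (simp add: Wdot_norm_def m_def Let_def)
  next
    case 4
    have "(INF g \<in> {g. frac_laplace s ?f g}. Lp_norm p g) \<le> (INF g \<in> {g. frac_laplace s f g}. Lp_norm p g)"
    proof (rule INF_mono)
      fix g assume "g \<in> {g. frac_laplace s f g}"
      then have g: "frac_laplace s f g" by simp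
      show "\<exists>g'\<in>{g. frac_laplace s ?f g}. Lp_norm p g' \<le> Lp_norm p g"
        using frac_laplace_dilation[OF M per g] Lp_norm_dilation[OF M, of g p] g
        by (intro bexI[of _ "\<lambda>x. g (real M *\<^sub>R x)"]) (auto simp: frac_laplace_def)
    qed
    then show ?thesis using 4 by (simp only: Wdot_norm_def if_False)
  qed
qed

section \<open>Bounded fields in space-time\<close>

text \<open>
  A function that is not measurable has infinite essential supremum, so the bound on the norm contains
  the measurability that the pointwise bound needs.
\<close>

lemma bounded_fieldD:
  assumes "bounded_field I f"
  obtains B where "B \<ge> 0" and "\<And>t. t \<in> I \<Longrightarrow> AE x in torus. norm (f t x) \<le> B"
proof -
  define S where "S = (SUP t\<in>I. Lp_norm \<infinity> (f t))"
  have "S < \<infinity>" using assms by (simp only: bounded_field_def S_def)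
  then have S: "S \<noteq> \<top>" by simp
  have "AE x in torus. norm (f t x) \<le> enn2real S" if "t \<in> I" for t
  proof -
    have "esssup torus (\<lambda>x. ennreal (norm (f t x))) \<le> S"
      using SUP_upper[OF that, of "\<lambda>t. Lp_norm \<infinity> (f t)"] by (simp add: S_def Lp_norm_def)
    moreover have "AE x in torus. ennreal (norm (f t x)) \<le> esssup torus (\<lambda>x. ennreal (norm (f t x)))"
      by (rule esssup_AE)
    ultimately have "AE x in torus. ennreal (norm (f t x)) \<le> S"
      by (auto elim: eventually_mono)
    then show ?thesis
    proof eventually_elim
      case (elim x)
      then show ?case using S by (cases S) auto
    qed
  qed
  then show thesis by (rule that[OF enn2real_nonneg])
qed

lemma on_torus_section:
  assumes "on_torus I f" and "t \<in> I"
  shows "f t \<in> borel_measurable borel" and "f t \<in> borel_measurable torus" and "periodic (f t)"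
proof -
  have "(\<lambda>x. (t, x)) \<in> borel \<rightarrow>\<^sub>M restrict_space borel (I \<times> UNIV)"
    using assms(2)
    by (intro measurable_restrict_space2 borel_measurable_continuous_onI continuous_intros) auto
  from measurable_comp[OF this, of "\<lambda>(t, x). f t x"] assms(1)
  show "f t \<in> borel_measurable borel" by (simp add: on_torus_def comp_def)
  then show "f t \<in> borel_measurable torus" by (intro measurable_restrict_space1) simp
  show "periodic (f t)" using assms by (simp add: on_torus_def)
qed

lemma bounded_fieldI:
  fixes f :: "real \<Rightarrow> real^2 \<Rightarrow> 'b::{real_normed_vector, second_countable_topology}"
  assumes "on_torus I f" and "\<And>t. t \<in> I \<Longrightarrow> AE x in torus. norm (f t x) \<le> B"
  shows "bounded_field I f"
proof -
  have "Lp_norm \<infinity> (f t) \<le> ennreal B" if "t \<in> I" for t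
    using on_torus_section(2)[OF assms(1) that] assms(2)[OF that]
    by (auto simp: Lp_norm_def intro!: esssup_I elim!: eventually_mono intro: ennreal_leI)
  then have "(SUP t\<in>I. Lp_norm \<infinity> (f t)) \<le> ennreal B" by (rule SUP_least)
  then show ?thesis unfolding bounded_field_def by (rule le_less_trans) simp
qed

lemma on_torus_subset: "on_torus I f \<Longrightarrow> J \<subseteq> I \<Longrightarrow> on_torus J f"
  unfolding on_torus_def by (auto intro: measurable_restrict_mono)

lemma integrable_bounded_section:
  fixes f :: "real \<Rightarrow> real^2 \<Rightarrow> 'b::{banach, second_countable_topology}"
  assumes "on_torus I f" and "t \<in> I" and "AE x in torus. norm (f t x) \<le> B"
  shows "integrable torus (f t)"
  by (rule torus.integrable_const_bound[OF assms(3) on_torus_section(2)[OF assms(1,2)]])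

text \<open>
  A uniform bound for almost every point at each time gives, by Fubini's theorem for null sets, a bound
  almost everywhere in space-time, hence integrability.
\<close>

lemma space_time_fubini:
  fixes f :: "real \<Rightarrow> real^2 \<Rightarrow> 'b::{banach, second_countable_topology}"
  assumes f: "on_torus {a..b} f" and B: "\<And>t. t \<in> {a..b} \<Longrightarrow> AE x in torus. norm (f t x) \<le> B"
  shows "set_integrable lborel ({a..b} \<times> cbox 0 1) (\<lambda>(t, x). f t x)"
    and "set_integrable lborel {a..b} (\<lambda>t. \<integral>x. f t x \<partial>torus)"
    and "set_lebesgue_integral lborel ({a..b} \<times> cbox 0 1) (\<lambda>(t, x). f t x)
       = (LINT t:{a..b}|lborel. \<integral>x. f t x \<partial>torus)"
proof -
  let ?A = "{a..b} \<times> cbox 0 (1::real^2)"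
  define g where "g z = indicator ({a..b} \<times> UNIV) z *\<^sub>R (case z of (t, x) \<Rightarrow> f t x)" for z :: "real \<times> (real^2)"
  have slab: "{a..b} \<times> UNIV \<in> sets (borel :: (real \<times> (real^2)) measure)"
    by (intro borel_closed closed_Times) auto
  have A: "?A \<in> sets (lborel \<Otimes>\<^sub>M lborel)"
    by (intro pair_measureI) auto
  have g: "g \<in> borel_measurable (lborel \<Otimes>\<^sub>M lborel)"
  proof -
    have "g \<in> borel_measurable borel"
      using f slab unfolding g_def[abs_def] on_torus_def
      by (subst borel_measurable_restrict_space_iff[symmetric]) auto
    then show ?thesis by (simp add: lborel_prod)
  qed
  have "AE z in lborel \<Otimes>\<^sub>M lborel. z \<in> ?A \<longrightarrow> norm (g z) \<le> B"
  proof (rule lborel_pair.AE_pair_measure)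
    show "{z \<in> space (lborel \<Otimes>\<^sub>M lborel). z \<in> ?A \<longrightarrow> norm (g z) \<le> B} \<in> sets (lborel \<Otimes>\<^sub>M lborel)"
      using g A by measurable
    have "AE x in lborel. (t, x) \<in> ?A \<longrightarrow> norm (g (t, x)) \<le> B" for t
    proof (cases "t \<in> {a..b}")
      case True
      from B[OF True] have "AE x in lborel. x \<in> cbox 0 1 \<longrightarrow> norm (f t x) \<le> B"
        by (subst (asm) AE_restrict_space_iff) auto
      then show ?thesis by eventually_elim (use True in \<open>simp add: g_def\<close>)
    next
      case False
      then show ?thesis by (intro AE_I2) auto
    qed
    then show "AE t in lborel. AE x in lborel. (t, x) \<in> ?A \<longrightarrow> norm (g (t, x)) \<le> B" by simp
  qed
  moreover have "emeasure (lborel \<Otimes>\<^sub>M lborel) ?A < \<infinity>"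
    by (simp add: lborel.emeasure_pair_measure_Times emeasure_cube emeasure_lborel_Icc_eq)
  ultimately have int: "integrable (lborel \<Otimes>\<^sub>M lborel) (\<lambda>z. indicator ?A z *\<^sub>R g z)"
    by (intro integrableI_bounded_set_indicator A g)
  have eq: "indicator ?A (t, x) *\<^sub>R g (t, x) = indicator {a..b} t *\<^sub>R (indicator (cbox 0 1) x *\<^sub>R f t x)" for t x
    by (simp add: g_def indicator_def)
  have eq': "(\<lambda>z. indicator ?A z *\<^sub>R g z) = (\<lambda>z. indicator ?A z *\<^sub>R (case z of (t, x) \<Rightarrow> f t x))"
    by (auto simp: g_def indicator_def)
  show "set_integrable lborel ?A (\<lambda>(t, x). f t x)"
    using int unfolding eq' by (simp add: set_integrable_def lborel_prod)
  show "set_integrable lborel {a..b} (\<lambda>t. \<integral>x. f t x \<partial>torus)"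
    using lborel_pair.integrable_fst'[OF int] unfolding eq
    by (simp add: set_integrable_def integral_torus del: scaleR_scaleR)
  show "set_lebesgue_integral lborel ?A (\<lambda>(t, x). f t x) = (LINT t:{a..b}|lborel. \<integral>x. f t x \<partial>torus)"
    using lborel_pair.integral_fst'[OF int, symmetric] unfolding eq unfolding eq'
    by (simp add: set_lebesgue_integral_def integral_torus lborel_prod del: scaleR_scaleR)
qed

text \<open>
  The integrand of the weak formulation.
\<close>

definition transport :: "(real \<times> (real^2) \<Rightarrow> real) \<Rightarrow> (real \<Rightarrow> real^2 \<Rightarrow> real^2) \<Rightarrow> (real \<Rightarrow> real^2 \<Rightarrow> real)
    \<Rightarrow> real \<Rightarrow> real^2 \<Rightarrow> real" where
  "transport \<phi> u \<rho> t x = \<rho> t x * frechet_derivative \<phi> (at (t, x)) (1, u t x)"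

lemma compact_slab_bound:
  fixes \<phi> :: "real \<times> (real^2) \<Rightarrow> real"
  assumes "smooth \<phi>"
  obtains K where "K \<ge> 0" and "\<And>t x. t \<in> {a..b} \<Longrightarrow> x \<in> cbox 0 1 \<Longrightarrow> \<bar>\<phi> (t, x)\<bar> \<le> K"
proof -
  have "compact (\<phi> ` ({a..b} \<times> cbox 0 1))"
    by (intro compact_continuous_image smooth_continuous assms compact_Times) auto
  then have "bounded (\<phi> ` ({a..b} \<times> cbox 0 1))" by (rule compact_imp_bounded)
  then obtain K where "K > 0" and "\<forall>y\<in>\<phi> ` ({a..b} \<times> cbox 0 1). norm y \<le> K"
    unfolding bounded_pos by blast
  then show thesis using that[of K] by auto
qed

lemma smooth_transport_periodic:
  fixes \<phi> :: "real \<times> (real^2) \<Rightarrow> real"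
  assumes "smooth \<phi>" and "\<And>t. periodic (\<lambda>x. \<phi> (t, x))"
  shows "frechet_derivative \<phi> (at (t, x + of_ivec k)) v = frechet_derivative \<phi> (at (t, x)) v"
  using frechet_derivative_periodic[OF assms(1), of "(0, of_ivec k)" "(t, x)" v] assms(2)
  by (auto simp: periodic_def)

lemma on_torus_mult:
  fixes f g :: "real \<Rightarrow> real^2 \<Rightarrow> real"
  shows "on_torus I f \<Longrightarrow> on_torus I g \<Longrightarrow> on_torus I (\<lambda>t x. f t x * g t x)"
  by (auto simp: on_torus_def periodic_def case_prod_beta')

lemma on_torus_transport:
  fixes \<phi> :: "real \<times> (real^2) \<Rightarrow> real"
  assumes \<phi>: "smooth \<phi>" "\<And>t. periodic (\<lambda>x. \<phi> (t, x))" and u: "on_torus I u" and \<rho>: "on_torus I \<rho>"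
  shows "on_torus I (transport \<phi> u \<rho>)"
proof -
  let ?M = "restrict_space borel (I \<times> UNIV) :: (real \<times> (real^2)) measure"
  have um: "(\<lambda>z. u (fst z) (snd z)) \<in> borel_measurable ?M"
    using u by (simp add: on_torus_def case_prod_beta')
  have "(\<lambda>z. \<Sum>b\<in>Basis. ((1, u (fst z) (snd z)) \<bullet> b) * frechet_derivative \<phi> (at z) b) \<in> borel_measurable ?M"
  proof (intro borel_measurable_sum borel_measurable_times borel_measurable_inner)
    show "(\<lambda>z. frechet_derivative \<phi> (at z) b) \<in> borel_measurable ?M" for b
      by (intro measurable_restrict_space1 smooth_borel smooth_directional \<phi>)
    show "(\<lambda>z. (1::real, u (fst z) (snd z))) \<in> borel_measurable ?M"
      by (intro borel_measurable_Pair um) simp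
  qed simp
  then have "(\<lambda>z. frechet_derivative \<phi> (at z) (1, u (fst z) (snd z))) \<in> borel_measurable ?M"
    by (subst frechet_derivative_basis_expansion[OF \<phi>(1)])
  then have "on_torus I (\<lambda>t x. frechet_derivative \<phi> (at (t, x)) (1, u t x))"
    using u by (simp add: on_torus_def case_prod_beta' periodic_def smooth_transport_periodic[OF \<phi>])
  then show ?thesis unfolding transport_def[abs_def] by (rule on_torus_mult[OF \<rho>])
qed

lemma transport_bounded:
  fixes \<phi> :: "real \<times> (real^2) \<Rightarrow> real"
  assumes \<phi>: "smooth \<phi>"
    and u: "\<And>t. t \<in> {a..b} \<Longrightarrow> AE x in torus. norm (u t x) \<le> U"
    and \<rho>: "\<And>t. t \<in> {a..b} \<Longrightarrow> AE x in torus. norm (\<rho> t x) \<le> R" and "R \<ge> 0"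
  shows "\<exists>C. \<forall>t\<in>{a..b}. AE x in torus. norm (transport \<phi> u \<rho> t x) \<le> C"
proof -
  have "\<exists>K. K \<ge> 0 \<and> (\<forall>t\<in>{a..b}. \<forall>x\<in>cbox 0 1. \<bar>frechet_derivative \<phi> (at (t, x)) e\<bar> \<le> K)" for e
    by (rule compact_slab_bound[OF smooth_directional[OF \<phi>], of a b e]) blast
  then obtain K where K: "\<And>e. K e \<ge> 0"
    "\<And>e t x. t \<in> {a..b} \<Longrightarrow> x \<in> cbox 0 1 \<Longrightarrow> \<bar>frechet_derivative \<phi> (at (t, x)) e\<bar> \<le> K e" by metis
  show ?thesis
  proof (intro exI ballI)
    fix t assume t: "t \<in> {a..b}"
    have "AE x in torus. x \<in> cbox 0 1" by (rule AE_I2) simp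
    with u[OF t] \<rho>[OF t]
    show "AE x in torus. norm (transport \<phi> u \<rho> t x) \<le> R * (\<Sum>e\<in>Basis. (1 + U) * K e)"
    proof eventually_elim
      case (elim x)
      have "norm (1::real, u t x) \<le> 1 + U"
        using norm_Pair_le[of "1::real" "u t x"] elim(1) by simp
      then have inner: "\<bar>(1::real, u t x) \<bullet> e\<bar> \<le> 1 + U" if "e \<in> Basis" for e
        using Basis_le_norm[OF that, of "(1, u t x)"] by linarith
      have U: "0 \<le> 1 + U" using \<open>norm (1::real, u t x) \<le> 1 + U\<close> norm_ge_zero order_trans by blast
      have "\<bar>frechet_derivative \<phi> (at (t, x)) (1, u t x)\<bar>
          \<le> (\<Sum>e\<in>Basis. \<bar>((1, u t x) \<bullet> e) * frechet_derivative \<phi> (at (t, x)) e\<bar>)"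
        by (subst frechet_derivative_basis_expansion[OF \<phi>]) (rule sum_abs)
      also have "\<dots> \<le> (\<Sum>e\<in>Basis. (1 + U) * K e)"
        unfolding abs_mult by (intro sum_mono mult_mono inner K(2) t elim(3) U abs_ge_zero)
      finally show ?case
        using elim(2) \<open>R \<ge> 0\<close> by (auto simp: transport_def abs_mult intro!: mult_mono)
    qed
  qed
qed

lemma smooth_slice:
  fixes \<phi> :: "real \<times> (real^2) \<Rightarrow> real"
  assumes "smooth \<phi>" shows "smooth (\<lambda>x. \<phi> (t, x))"
  by (rule smooth_compose_affine[where L = "\<lambda>v. (0, v)", OF _ assms])
     (auto intro!: derivative_eq_intros)

lemma integrable_pairing:
  fixes \<phi> :: "real \<times> (real^2) \<Rightarrow> real"
  assumes "smooth \<phi>" and "on_torus I \<rho>" and "t \<in> I" and "AE x in torus. norm (\<rho> t x) \<le> R"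
  shows "integrable torus (\<lambda>x. \<rho> t x * \<phi> (t', x))"
  using integrable_continuous_scaleR[OF smooth_continuous[OF smooth_slice[OF assms(1), of t']]
      integrable_bounded_section[OF assms(2-4)]]
  by (simp add: mult.commute)

text \<open>
  Weak continuity is a statement about test functions that do not depend on time. Freezing the time of
  the test function costs \<open>R\<close> times the variation of \<open>\<phi>\<close> in time, which is uniformly small in space
  by compactness.
\<close>

lemma continuous_pairing:
  fixes \<phi> :: "real \<times> (real^2) \<Rightarrow> real"
  assumes \<phi>: "smooth \<phi>" "\<And>t. periodic (\<lambda>x. \<phi> (t, x))"
    and \<rho>: "on_torus I \<rho>" "\<And>t. t \<in> I \<Longrightarrow> AE x in torus. norm (\<rho> t x) \<le> R" "R \<ge> 0"
    and cont: "\<And>\<psi>. test_fun \<psi> \<Longrightarrow> continuous_on I (\<lambda>t. \<integral>x. \<rho> t x * \<psi> x \<partial>torus)"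
  shows "continuous_on I (\<lambda>t. \<integral>x. \<rho> t x * \<phi> (t, x) \<partial>torus)"
  unfolding continuous_on_iff
proof (intro ballI allI impI)
  fix t0 and e :: real assume t0: "t0 \<in> I" and e: "0 < e"
  have test: "test_fun (\<lambda>x. \<phi> (t, x))" for t
    using \<phi> smooth_slice by (simp add: test_fun_def)
  have int: "integrable torus (\<lambda>x. \<rho> t x * \<phi> (t', x))" if "t \<in> I" for t t'
    by (rule integrable_pairing[OF \<phi>(1) \<rho>(1) that \<rho>(2)[OF that]])
  obtain d1 where d1: "d1 > 0"
    "\<And>t. t \<in> I \<Longrightarrow> dist t t0 < d1 \<Longrightarrow>
      dist (\<integral>x. \<rho> t x * \<phi> (t0, x) \<partial>torus) (\<integral>x. \<rho> t0 x * \<phi> (t0, x) \<partial>torus) < e / 2"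
    using cont[OF test[of t0]] t0 e unfolding continuous_on_iff by (meson half_gt_zero)
  define \<epsilon> where "\<epsilon> = e / (2 * (R + 1))"
  have eps: "\<epsilon> > 0" "R * \<epsilon> < e / 2" using e \<rho>(3) by (auto simp: \<epsilon>_def field_simps)
  have "uniformly_continuous_on ({t0 - 1..t0 + 1} \<times> cbox 0 1) \<phi>"
    by (intro compact_uniformly_continuous smooth_continuous \<phi> compact_Times) auto
  then obtain d2 where d2: "d2 > 0"
    "\<And>z z'. z \<in> {t0 - 1..t0 + 1} \<times> cbox 0 1 \<Longrightarrow> z' \<in> {t0 - 1..t0 + 1} \<times> cbox 0 1 \<Longrightarrow>
      dist z' z < d2 \<Longrightarrow> dist (\<phi> z') (\<phi> z) < \<epsilon>"
    using eps(1) unfolding uniformly_continuous_on_def by metis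
  show "\<exists>d>0. \<forall>t\<in>I. dist t t0 < d \<longrightarrow>
      dist (\<integral>x. \<rho> t x * \<phi> (t, x) \<partial>torus) (\<integral>x. \<rho> t0 x * \<phi> (t0, x) \<partial>torus) < e"
  proof (intro exI conjI ballI impI)
    show "min d1 (min d2 1) > 0" using d1(1) d2(1) by simp
    fix t assume t: "t \<in> I" "dist t t0 < min d1 (min d2 1)"
    have close: "\<bar>\<phi> (t, x) - \<phi> (t0, x)\<bar> \<le> \<epsilon>" if "x \<in> cbox 0 1" for x
    proof -
      have "t \<in> {t0 - 1..t0 + 1}" using t(2) by (auto simp: dist_real_def abs_less_iff)
      moreover have "dist (t, x) (t0, x) < d2" using t(2) by (simp add: dist_Pair_Pair)
      ultimately have "dist (\<phi> (t, x)) (\<phi> (t0, x)) < \<epsilon>"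
        using d2(2)[of "(t0, x)" "(t, x)"] that by auto
      then show ?thesis by (simp add: dist_real_def)
    qed
    have "\<bar>\<integral>x. \<rho> t x * (\<phi> (t, x) - \<phi> (t0, x)) \<partial>torus\<bar>
        \<le> (\<integral>x. \<bar>\<rho> t x * (\<phi> (t, x) - \<phi> (t0, x))\<bar> \<partial>torus)"
      by (rule integral_abs_bound)
    also have "\<dots> \<le> (\<integral>x. R * \<epsilon> \<partial>torus)"
    proof (rule integral_mono_AE)
      show "integrable torus (\<lambda>x. \<bar>\<rho> t x * (\<phi> (t, x) - \<phi> (t0, x))\<bar>)"
        using int[OF t(1), of t] int[OF t(1), of t0] by (simp add: right_diff_distrib)
      have "AE x in torus. x \<in> cbox 0 1" by (rule AE_I2) simp
      with \<rho>(2)[OF t(1)] show "AE x in torus. \<bar>\<rho> t x * (\<phi> (t, x) - \<phi> (t0, x))\<bar> \<le> R * \<epsilon>"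
        by eventually_elim (use close \<rho>(3) in \<open>auto simp: abs_mult intro!: mult_mono\<close>)
    qed simp
    also have "\<dots> = R * \<epsilon>" by simp
    finally have 1: "\<bar>\<integral>x. \<rho> t x * (\<phi> (t, x) - \<phi> (t0, x)) \<partial>torus\<bar> < e / 2" using eps(2) by linarith
    have 2: "(\<integral>x. \<rho> t x * (\<phi> (t, x) - \<phi> (t0, x)) \<partial>torus)
        = (\<integral>x. \<rho> t x * \<phi> (t, x) \<partial>torus) - (\<integral>x. \<rho> t x * \<phi> (t0, x) \<partial>torus)"
      using int[OF t(1), of t] int[OF t(1), of t0] by (simp add: right_diff_distrib)
    show "dist (\<integral>x. \<rho> t x * \<phi> (t, x) \<partial>torus) (\<integral>x. \<rho> t0 x * \<phi> (t0, x) \<partial>torus) < e"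
      using 1 d1(2)[OF t(1)] t(2) unfolding 2 dist_real_def by linarith
  qed
qed

section \<open>The balance of a weak solution up to the final time\<close>

lemma flat_exp_1_bounds: "0 \<le> flat_exp 1 x" "flat_exp 1 x \<le> 1"
  by (auto simp: flat_exp_def)

lemma flat_exp_1_tendsto: "(flat_exp 1 \<longlongrightarrow> 1) at_top"
proof -
  have "((\<lambda>x::real. exp (- (1 / x))) \<longlongrightarrow> exp (- 0)) at_top"
    by (intro tendsto_intros tendsto_divide_0[OF tendsto_const] filterlim_at_top_imp_at_infinity filterlim_ident)
  moreover have "\<forall>\<^sub>F x in at_top. exp (- (1 / x)) = flat_exp 1 x"
    using eventually_gt_at_top[of 0] by eventually_elim (simp add: flat_exp_def)
  ultimately show ?thesis using Lim_transform_eventually by fastforce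
qed

text \<open>
  The derivative of \<open>exp(-1/x)\<close>. It vanishes for nonpositive arguments and has total mass \<open>1\<close>.
\<close>

definition bump :: "real \<Rightarrow> real" where
  "bump = flat_exp (flat_exp_poly 1)"

lemma bump_nonneg: "0 \<le> bump x"
  by (simp add: bump_def flat_exp_def flat_exp_poly_def)

lemma bump_nonpos_eq_0: "x \<le> 0 \<Longrightarrow> bump x = 0"
  by (simp add: bump_def flat_exp_def)

lemma bump_borel [measurable]: "bump \<in> borel_measurable borel"
  unfolding bump_def by (rule smooth_borel[OF flat_exp_smooth])

lemma bump_integral: "has_bochner_integral lborel bump 1"
proof (rule has_bochner_integral_nn_integral)
  have "(\<integral>\<^sup>+x. ennreal (bump x) * indicator {0..} x \<partial>lborel) = ennreal (1 - flat_exp 1 0)"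
    by (rule nn_integral_FTC_atLeast[OF bump_borel _ bump_nonneg flat_exp_1_tendsto])
       (unfold bump_def, rule flat_exp_has_derivative)
  moreover have "ennreal (bump x) * indicator {0..} x = ennreal (bump x)" for x
    using bump_nonpos_eq_0[of x] by (auto simp: indicator_def)
  ultimately show "(\<integral>\<^sup>+x. ennreal (bump x) \<partial>lborel) = ennreal 1"
    by (simp add: flat_exp_def)
qed (auto simp: bump_nonneg)

text \<open>
  The cutoff at scale \<open>1/n\<close> in the proof below is \<open>exp(-1/r)\<close> at \<open>r = n (1 - t) - 1\<close>. Up to sign, its derivative
  is a probability density that concentrates at \<open>t = 1\<close>. In the variable \<open>r\<close> the density does
  not depend on \<open>n\<close> any more, and dominated convergence applies.
\<close>

lemma cutoff_derivative_concentrates: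
  fixes g :: "real \<Rightarrow> real"
  assumes g: "continuous_on {0..1} g"
  shows "(\<lambda>n. LINT t:{0..1}|lborel. real n * bump (real n * (1 - t) - 1) * g t) \<longlonglongrightarrow> g 1"
proof -
  obtain G where G: "\<And>t. t \<in> {0..1} \<Longrightarrow> \<bar>g t\<bar> \<le> G"
  proof -
    have "bounded (g ` {0..1})" by (intro compact_imp_bounded compact_continuous_image g) auto
    then obtain G where "\<And>t. t \<in> {0..1} \<Longrightarrow> norm (g t) \<le> G"
      unfolding bounded_iff by (meson imageI)
    then show thesis by (intro that[of G]) simp
  qed
  \<comment> \<open>extended by zero, so that the substitution can be made on the whole line\<close>
  define F where "F t = indicator {0..1} t *\<^sub>R g t" for t :: real
  have Fm[measurable]: "F \<in> borel_measurable borel"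
    unfolding F_def[abs_def] using borel_measurable_continuous_on_indicator[OF _ g] by simp
  have Fb: "\<bar>F t\<bar> \<le> G" for t
    using G[of t] G[of 0] by (auto simp: F_def indicator_def)
  have eq: "(LINT t:{0..1}|lborel. real n * bump (real n * (1 - t) - 1) * g t)
      = (\<integral>r. bump r * F (1 - 1 / real n - r / real n) \<partial>lborel)" if "n > 0" for n
  proof -
    have "(LINT t:{0..1}|lborel. real n * bump (real n * (1 - t) - 1) * g t)
        = (\<integral>t. real n * bump (real n * (1 - t) - 1) * F t \<partial>lborel)"
      unfolding set_lebesgue_integral_def F_def by (intro Bochner_Integration.integral_cong) auto
    also have "\<dots> = \<bar>- 1 / real n\<bar> *\<^sub>R (\<integral>r. real n * bump (real n * (1 - ((1 - 1 / real n) + (- 1 / real n) * r)) - 1)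
        * F ((1 - 1 / real n) + (- 1 / real n) * r) \<partial>lborel)"
      using that by (intro lborel_integral_real_affine) auto
    also have "(\<lambda>r. real n * bump (real n * (1 - ((1 - 1 / real n) + (- 1 / real n) * r)) - 1)
        * F ((1 - 1 / real n) + (- 1 / real n) * r))
      = (\<lambda>r. real n * (bump r * F (1 - 1 / real n - r / real n)))"
    proof
      fix r
      have "real n * (1 - ((1 - 1 / real n) + (- 1 / real n) * r)) - 1 = r"
        using that by (simp add: field_simps)
      then show "real n * bump (real n * (1 - ((1 - 1 / real n) + (- 1 / real n) * r)) - 1)
          * F ((1 - 1 / real n) + (- 1 / real n) * r) = real n * (bump r * F (1 - 1 / real n - r / real n))"
        by simp
    qed
    finally show ?thesis using that by simp
  qed
  have "(\<lambda>n. \<integral>r. bump r * F (1 - 1 / real n - r / real n) \<partial>lborel) \<longlonglongrightarrow> (\<integral>r. bump r * g 1 \<partial>lborel)"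
  proof (rule integral_dominated_convergence[where w = "\<lambda>r. bump r * G"])
    show "integrable lborel (\<lambda>r. bump r * G)"
      using bump_integral by (simp add: has_bochner_integral_iff)
    show "AE r in lborel. norm (bump r * F (1 - 1 / real n - r / real n)) \<le> bump r * G" for n
      using Fb bump_nonneg by (auto simp: abs_mult intro!: mult_left_mono)
    show "AE r in lborel. (\<lambda>n. bump r * F (1 - 1 / real n - r / real n)) \<longlonglongrightarrow> bump r * g 1"
    proof (rule AE_I2)
      fix r :: real
      show "(\<lambda>n. bump r * F (1 - 1 / real n - r / real n)) \<longlonglongrightarrow> bump r * g 1"
      proof (cases "r \<le> 0")
        case True then show ?thesis by (simp add: bump_nonpos_eq_0)
      next
        case False
        have lim: "(\<lambda>n. 1 - 1 / real n - r / real n) \<longlonglongrightarrow> 1"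
          using tendsto_diff[OF tendsto_diff[OF tendsto_const lim_const_over_n[of 1]] lim_const_over_n[of r], of 1]
          by simp
        have ev: "\<forall>\<^sub>F n in sequentially. 1 - 1 / real n - r / real n \<in> {0..1}"
          using order_tendstoD(1)[OF lim zero_less_one] eventually_gt_at_top[of 0]
          by eventually_elim (use False in \<open>auto simp: field_simps\<close>)
        have "(\<lambda>n. g (1 - 1 / real n - r / real n)) \<longlonglongrightarrow> g 1"
          by (rule continuous_on_tendsto_compose[OF g lim _ ev]) simp
        moreover have "\<forall>\<^sub>F n in sequentially. g (1 - 1 / real n - r / real n) = F (1 - 1 / real n - r / real n)"
          using ev by eventually_elim (simp add: F_def)
        ultimately have "(\<lambda>n. F (1 - 1 / real n - r / real n)) \<longlonglongrightarrow> g 1"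
          by (rule Lim_transform_eventually)
        then show ?thesis by (intro tendsto_intros)
      qed
    qed
  qed measurable
  also have "(\<integral>r. bump r * g 1 \<partial>lborel) = g 1"
    using bump_integral by (simp add: has_bochner_integral_iff)
  finally show ?thesis
  proof (rule Lim_transform_eventually)
    show "\<forall>\<^sub>F n in sequentially. (\<integral>r. bump r * F (1 - 1 / real n - r / real n) \<partial>lborel)
        = (LINT t:{0..1}|lborel. real n * bump (real n * (1 - t) - 1) * g t)"
      using eventually_gt_at_top[of "0::nat"] by eventually_elim (rule eq[symmetric])
  qed
qed

text \<open>
  The weak formulation on \<open>[0, 1]\<close> admits only test functions that vanish near \<open>t = 1\<close>, but gluing needs
  the balance up to time \<open>1\<close>. Multiply an arbitrary \<open>\<phi>\<close> by cutoffs in time that vanish for \<open>t > 1 - 1/n\<close>. The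
  terms in which the cutoff is not differentiated converge to those without cutoff. The term with its derivative
  converges to the value at time \<open>1\<close> of the pairing of the solution with \<open>\<phi>\<close>, which is continuous in time.
\<close>

lemma weak_solution_increment:
  assumes sol: "weak_solution {0..1} u \<rho>"
    and u: "on_torus {0..1} u" "\<And>t. t \<in> {0..1} \<Longrightarrow> AE x in torus. norm (u t x) \<le> U"
    and \<rho>: "\<And>t. t \<in> {0..1} \<Longrightarrow> AE x in torus. norm (\<rho> t x) \<le> R" "R \<ge> 0"
    and \<phi>: "smooth \<phi>" "\<And>t. periodic (\<lambda>x. \<phi> (t, x))"
  shows "(LINT t:{0..1}|lborel. \<integral>x. transport \<phi> u \<rho> t x \<partial>torus)
    = (\<integral>x. \<rho> 1 x * \<phi> (1, x) \<partial>torus) - (\<integral>x. \<rho> 0 x * \<phi> (0, x) \<partial>torus)"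
proof -
  have \<rho>T: "on_torus {0..1} \<rho>" using sol by (simp add: weak_solution_def)
  define g where "g t = (\<integral>x. \<rho> t x * \<phi> (t, x) \<partial>torus)" for t
  define h where "h t = (\<integral>x. transport \<phi> u \<rho> t x \<partial>torus)" for t
  define cut where "cut n t = flat_exp 1 (real n * (1 - t) - 1)" for n t
  obtain C where "\<forall>t\<in>{0..1}. AE x in torus. norm (transport \<phi> u \<rho> t x) \<le> C"
    using transport_bounded[OF \<phi>(1) u(2) \<rho>] ..
  note C = bspec[OF this]
  note T = on_torus_transport[OF \<phi> u(1) \<rho>T]
  have hint: "set_integrable lborel {0..1} h"
    unfolding h_def[abs_def] by (rule space_time_fubini(2)[OF T C])
  have gcont: "continuous_on {0..1} g"
    unfolding g_def[abs_def]
    by (rule continuous_pairing[OF \<phi> \<rho>T \<rho>]) (use sol in \<open>auto simp: weak_solution_def\<close>)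
  have aff: "((\<lambda>z. real n * (1 - fst z) - 1) has_derivative (\<lambda>v. - real n * fst v)) (at z)"
    for n and z :: "real \<times> (real^2)"
    by (auto intro!: derivative_eq_intros)
  have cut_bounds: "0 \<le> cut n t" "cut n t \<le> 1" for n t
    by (simp_all add: cut_def flat_exp_1_bounds)
  have cut_borel: "cut n \<in> borel_measurable borel" for n
    unfolding cut_def[abs_def] using smooth_borel[OF flat_exp_smooth[of 1]] by measurable
  have cuth: "(\<lambda>t. indicator {0..1} t *\<^sub>R (cut n t * h t)) \<in> borel_measurable lborel" for n
  proof -
    have "(\<lambda>t. indicator {0..1} t *\<^sub>R h t) \<in> borel_measurable lborel"
      using hint unfolding set_integrable_def by (rule borel_measurable_integrable)
    with cut_borel[of n] have "(\<lambda>t. cut n t * (indicator {0..1} t *\<^sub>R h t)) \<in> borel_measurable lborel"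
      by (intro borel_measurable_times) simp_all
    then show ?thesis by (simp add: mult.left_commute)
  qed
  have hcut: "set_integrable lborel {0..1} (\<lambda>t. cut n t * h t)" for n
    unfolding set_integrable_def
  proof (rule Bochner_Integration.integrable_bound[OF hint[unfolded set_integrable_def] cuth])
    show "AE t in lborel. norm (indicator {0..1} t *\<^sub>R (cut n t * h t)) \<le> norm (indicator {0..1} t *\<^sub>R h t)"
      using cut_bounds[of n] by (auto simp: abs_mult indicator_def intro!: mult_left_le_one_le)
  qed
  have gint: "set_integrable lborel {0..1} (\<lambda>t. real n * bump (real n * (1 - t) - 1) * g t)" for n
    unfolding set_integrable_def bump_def
    by (rule borel_integrable_compact)
       (auto intro!: continuous_intros gcont continuous_on_compose2[OF smooth_continuous[OF flat_exp_smooth, of UNIV]])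
  have identity: "(LINT t:{0..1}|lborel. cut n t * h t)
      - (LINT t:{0..1}|lborel. real n * bump (real n * (1 - t) - 1) * g t) + cut n 0 * g 0 = 0"
    if n: "n \<ge> 2" for n
  proof -
    define \<Phi> where "\<Phi> z = \<phi> z * flat_exp 1 (real n * (1 - fst z) - 1)" for z
    have sm: "smooth \<Phi>"
      unfolding \<Phi>_def[abs_def]
      by (rule smooth_mult[OF \<phi>(1) smooth_compose_affine[OF aff flat_exp_smooth]])
    have per: "periodic (\<lambda>x. \<Phi> (t, x))" for t
      using \<phi>(2)[of t] by (simp add: \<Phi>_def periodic_def)
    have \<Phi>': "(\<Phi> has_derivative (\<lambda>v. \<phi> z * (bump (real n * (1 - fst z) - 1) * (- real n * fst v))
        + frechet_derivative \<phi> (at z) v * flat_exp 1 (real n * (1 - fst z) - 1))) (at z)" for z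
      unfolding \<Phi>_def[abs_def] bump_def
      by (intro has_derivative_mult smooth_has_derivative \<phi>(1)
          has_derivative_compose[OF aff flat_exp_has_derivative[unfolded has_field_derivative_def]])
    have tr: "transport \<Phi> u \<rho> t x = cut n t * transport \<phi> u \<rho> t x
        - (real n * bump (real n * (1 - t) - 1)) * (\<rho> t x * \<phi> (t, x))" for t x
      unfolding transport_def cut_def frechet_derivative_eqI[OF \<Phi>'] by (simp add: algebra_simps)
    obtain C' where "\<forall>t\<in>{0..1}. AE x in torus. norm (transport \<Phi> u \<rho> t x) \<le> C'"
      using transport_bounded[OF sm u(2) \<rho>] ..
    note C' = bspec[OF this]
    have "\<exists>b\<in>interior {0..1}. \<forall>t>b. \<forall>x. \<Phi> (t, x) = 0"
    proof (intro bexI[of _ "1 - 1 / real n"] allI impI)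
      fix t x assume "1 - 1 / real n < t"
      then have "real n * (1 - t) - 1 \<le> 0" using n by (simp add: field_simps)
      then show "\<Phi> (t, x) = 0" by (simp add: \<Phi>_def flat_exp_def)
    qed (use n in \<open>auto simp: field_simps\<close>)
    then have "set_lebesgue_integral lborel ({0..1} \<times> cbox 0 1)
          (\<lambda>(t, x). \<rho> t x * frechet_derivative \<Phi> (at (t, x)) (1, u t x))
        + (\<integral>x. \<rho> 0 x * \<Phi> (0, x) \<partial>torus) = 0"
      using sol sm per unfolding weak_solution_def by blast
    moreover have "set_lebesgue_integral lborel ({0..1} \<times> cbox 0 1)
          (\<lambda>(t, x). \<rho> t x * frechet_derivative \<Phi> (at (t, x)) (1, u t x))
        = (LINT t:{0..1}|lborel. \<integral>x. transport \<Phi> u \<rho> t x \<partial>torus)"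
      using space_time_fubini(3)[OF on_torus_transport[OF sm per u(1) \<rho>T] C'] by (simp add: transport_def)
    moreover have "(\<integral>x. \<rho> 0 x * \<Phi> (0, x) \<partial>torus) = cut n 0 * g 0"
      by (simp add: \<Phi>_def g_def cut_def mult.assoc[symmetric])
    moreover have "(LINT t:{0..1}|lborel. \<integral>x. transport \<Phi> u \<rho> t x \<partial>torus)
        = (LINT t:{0..1}|lborel. cut n t * h t - real n * bump (real n * (1 - t) - 1) * g t)"
    proof (rule set_lebesgue_integral_cong)
      show "\<forall>t. t \<in> {0..1} \<longrightarrow> (\<integral>x. transport \<Phi> u \<rho> t x \<partial>torus)
          = cut n t * h t - real n * bump (real n * (1 - t) - 1) * g t"
      proof (intro allI impI)
        fix t :: real assume t: "t \<in> {0..1}"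
        have 1: "integrable torus (transport \<phi> u \<rho> t)"
          by (rule integrable_bounded_section[OF T t C[OF t]])
        have 2: "integrable torus (\<lambda>x. \<rho> t x * \<phi> (t, x))"
          by (rule integrable_pairing[OF \<phi>(1) \<rho>T t \<rho>(1)[OF t]])
        show "(\<integral>x. transport \<Phi> u \<rho> t x \<partial>torus) = cut n t * h t - real n * bump (real n * (1 - t) - 1) * g t"
          unfolding tr h_def g_def using 1 2 by (subst Bochner_Integration.integral_diff) auto
      qed
    qed simp
    moreover have "(LINT t:{0..1}|lborel. cut n t * h t - real n * bump (real n * (1 - t) - 1) * g t)
        = (LINT t:{0..1}|lborel. cut n t * h t) - (LINT t:{0..1}|lborel. real n * bump (real n * (1 - t) - 1) * g t)"
      by (rule set_integral_diff(2)[OF hcut gint])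
    ultimately show ?thesis by simp
  qed
  have cut_lim: "(\<lambda>n. cut n t) \<longlonglongrightarrow> 1" if "t < 1" for t
  proof -
    have "filterlim (\<lambda>n. - 1 + (1 - t) * real n) at_top sequentially"
      using that by (intro filterlim_tendsto_add_at_top[OF tendsto_const]
          filterlim_tendsto_pos_mult_at_top[OF tendsto_const] filterlim_real_sequentially) auto
    from filterlim_compose[OF flat_exp_1_tendsto this] show ?thesis
      by (simp add: cut_def algebra_simps)
  qed
  have "(\<lambda>n. LINT t:{0..1}|lborel. cut n t * h t) \<longlonglongrightarrow> (LINT t:{0..1}|lborel. h t)"
    unfolding set_lebesgue_integral_def
  proof (rule integral_dominated_convergence[where w = "\<lambda>t. norm (indicator {0..1} t *\<^sub>R h t)"])
    show "integrable lborel (\<lambda>t. norm (indicator {0..1} t *\<^sub>R h t))"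
      by (rule integrable_norm) (use hint in \<open>simp add: set_integrable_def\<close>)
    show "(\<lambda>t. indicator {0..1} t *\<^sub>R h t) \<in> borel_measurable lborel"
      using hint unfolding set_integrable_def by (rule borel_measurable_integrable)
    show "AE t in lborel. norm (indicator {0..1} t *\<^sub>R (cut n t * h t)) \<le> norm (indicator {0..1} t *\<^sub>R h t)" for n
      using cut_bounds[of n] by (auto simp: abs_mult indicator_def intro!: mult_left_le_one_le)
    show "AE t in lborel. (\<lambda>n. indicator {0..1} t *\<^sub>R (cut n t * h t)) \<longlonglongrightarrow> indicator {0..1} t *\<^sub>R h t"
      using AE_lborel_singleton[of 1]
    proof eventually_elim
      case (elim t)
      show ?case
      proof (cases "t \<in> {0..1}")
        case True
        then have "(\<lambda>n. cut n t * h t) \<longlonglongrightarrow> 1 * h t"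
          using elim by (intro tendsto_mult cut_lim tendsto_const) auto
        then show ?thesis using True by simp
      qed simp
    qed
  qed (rule cuth)
  moreover have "(\<lambda>n. cut n 0 * g 0) \<longlonglongrightarrow> 1 * g 0"
    by (rule tendsto_mult[OF cut_lim tendsto_const]) simp
  ultimately have "(\<lambda>n. (LINT t:{0..1}|lborel. cut n t * h t)
      - (LINT t:{0..1}|lborel. real n * bump (real n * (1 - t) - 1) * g t) + cut n 0 * g 0)
    \<longlonglongrightarrow> (LINT t:{0..1}|lborel. h t) - g 1 + 1 * g 0"
    by (intro tendsto_add tendsto_diff cutoff_derivative_concentrates[OF gcont])
  moreover have "\<forall>\<^sub>F n in sequentially. (LINT t:{0..1}|lborel. cut n t * h t)
      - (LINT t:{0..1}|lborel. real n * bump (real n * (1 - t) - 1) * g t) + cut n 0 * g 0 = 0"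
    using eventually_ge_at_top[of "2::nat"] by eventually_elim (rule identity)
  ultimately have "(LINT t:{0..1}|lborel. h t) - g 1 + 1 * g 0 = 0"
    by (rule tendsto_unique[OF sequentially_bot _ tendsto_eventually])
  then show ?thesis by (simp add: g_def h_def)
qed

lemma on_torus_rescale:
  fixes f :: "real \<Rightarrow> real^2 \<Rightarrow> 'b::{real_normed_vector, second_countable_topology}"
  assumes f: "on_torus {0..1} f" and "\<tau> > 0"
  shows "on_torus {a..a + \<tau>} (\<lambda>t x. c *\<^sub>R f ((t - a) / \<tau>) (real M *\<^sub>R x))"
proof -
  have 1: "(\<lambda>z. ((fst z - a) / \<tau>, real M *\<^sub>R snd z))
      \<in> restrict_space borel ({a..a + \<tau>} \<times> UNIV) \<rightarrow>\<^sub>M restrict_space borel ({0..1} \<times> (UNIV :: (real^2) set))"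
    using assms(2)
    by (intro measurable_restrict_space3 borel_measurable_continuous_onI continuous_intros)
       (auto simp: field_simps)
  have 2: "(\<lambda>z. f (fst z) (snd z)) \<in> borel_measurable (restrict_space borel ({0..1} \<times> UNIV))"
    using f by (simp add: on_torus_def case_prod_beta')
  have "(\<lambda>z. f ((fst z - a) / \<tau>) (real M *\<^sub>R snd z)) \<in> borel_measurable (restrict_space borel ({a..a + \<tau>} \<times> UNIV))"
    using measurable_comp[OF 1 2] by (simp add: comp_def)
  moreover have "periodic (\<lambda>x. c *\<^sub>R f ((t - a) / \<tau>) (real M *\<^sub>R x))" if "t \<in> {a..a + \<tau>}" for t
  proof -
    have "(t - a) / \<tau> \<in> {0..1}" using that assms(2) by (auto simp: field_simps)
    from on_torus_section(3)[OF f this] show ?thesis by (rule periodic_dilation)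
  qed
  ultimately show ?thesis by (simp add: on_torus_def case_prod_beta')
qed

lemma rescaled_bound:
  assumes f: "on_torus {0..1} f" "\<And>t. t \<in> {0..1} \<Longrightarrow> AE x in torus. norm (f t x) \<le> B"
    and "\<tau> > 0" "M > 0" "t \<in> {a..a + \<tau>}"
  shows "AE x in torus. norm (c *\<^sub>R f ((t - a) / \<tau>) (real M *\<^sub>R x)) \<le> \<bar>c\<bar> * B"
proof -
  have "(t - a) / \<tau> \<in> {0..1}" using assms(3,5) by (auto simp: field_simps)
  from AE_torus_dilation[OF assms(4) on_torus_section(3)[OF f(1) this] f(2)[OF this]]
  show ?thesis by eventually_elim (simp add: mult_left_mono)
qed

text \<open>
  The pair of rescaled fields satisfies the same balance on \<open>[a, a + \<tau>]\<close>. Pairing it with \<open>\<phi>\<close> is pairing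
  the original solution with \<open>\<Phi>\<close>, the average over subcells of \<open>\<phi>\<close> in rescaled time. A derivative of \<open>\<Phi>\<close>
  along \<open>(1, w)\<close> is one of \<open>\<phi>\<close> along \<open>(\<tau>, w / M)\<close>, and this is parallel to \<open>(1, c w)\<close> precisely if
  \<open>c \<tau> M = 1\<close>.
\<close>

lemma rescaled_increment:
  assumes sol: "weak_solution {0..1} u \<rho>"
    and u: "on_torus {0..1} u" "\<And>t. t \<in> {0..1} \<Longrightarrow> AE x in torus. norm (u t x) \<le> U"
    and \<rho>: "\<And>t. t \<in> {0..1} \<Longrightarrow> AE x in torus. norm (\<rho> t x) \<le> R" "R \<ge> 0"
    and \<phi>: "smooth \<phi>" "\<And>t. periodic (\<lambda>x. \<phi> (t, x))"
    and M: "M > 0" and \<tau>: "\<tau> > 0" and c: "c * (\<tau> * real M) = 1"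
  shows "(LINT t:{a..a + \<tau>}|lborel. \<integral>x. transport \<phi> (\<lambda>t x. c *\<^sub>R u ((t - a) / \<tau>) (real M *\<^sub>R x))
      (\<lambda>t x. \<rho> ((t - a) / \<tau>) (real M *\<^sub>R x)) t x \<partial>torus)
    = (\<integral>x. \<rho> 1 (real M *\<^sub>R x) * \<phi> (a + \<tau>, x) \<partial>torus) - (\<integral>x. \<rho> 0 (real M *\<^sub>R x) * \<phi> (a, x) \<partial>torus)"
proof -
  have \<rho>T: "on_torus {0..1} \<rho>" using sol by (simp add: weak_solution_def)
  define uM where "uM t x = c *\<^sub>R u ((t - a) / \<tau>) (real M *\<^sub>R x)" for t x
  define \<rho>M where "\<rho>M t x = \<rho> ((t - a) / \<tau>) (real M *\<^sub>R x)" for t x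
  define \<Phi> where "\<Phi> z = (1 / (real M)\<^sup>2) * (\<Sum>j\<in>residues M. \<phi> (a + \<tau> * fst z, subcell M j (snd z)))" for z
  have uM: "on_torus {a..a + \<tau>} uM" "\<And>t. t \<in> {a..a + \<tau>} \<Longrightarrow> AE x in torus. norm (uM t x) \<le> \<bar>c\<bar> * U"
    unfolding uM_def[abs_def] using on_torus_rescale[OF u(1) \<tau>] rescaled_bound[OF u \<tau> M] by auto
  have \<rho>M: "on_torus {a..a + \<tau>} \<rho>M" "\<And>t. t \<in> {a..a + \<tau>} \<Longrightarrow> AE x in torus. norm (\<rho>M t x) \<le> R"
    unfolding \<rho>M_def[abs_def] using on_torus_rescale[OF \<rho>T \<tau>, of a 1 M] rescaled_bound[OF \<rho>T \<rho>(1) \<tau> M, of _ a 1] by auto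
  have aff: "((\<lambda>z. (a + \<tau> * fst z, subcell M j (snd z))) has_derivative (\<lambda>v. (\<tau> * fst v, snd v /\<^sub>R real M))) (at z)" for j z
    by (intro has_derivative_Pair has_derivative_compose[OF _ subcell_has_derivative])
       (auto intro!: derivative_eq_intros)
  have sm: "smooth \<Phi>"
    unfolding \<Phi>_def[abs_def]
    by (intro smooth_mult smooth_const smooth_sum smooth_compose_affine[OF aff \<phi>(1)])
  have \<Phi>_avg: "\<Phi> (r, y) = cell_average M (\<lambda>x. \<phi> (a + \<tau> * r, x)) y" for r y
    by (simp add: \<Phi>_def cell_average_def)
  have per: "periodic (\<lambda>y. \<Phi> (r, y))" for r
    unfolding \<Phi>_avg by (rule cell_average_periodic[OF M \<phi>(2)])
  have "(\<Phi> has_derivative (\<lambda>v. (1 / (real M)\<^sup>2) * (\<Sum>j\<in>residues M.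
      frechet_derivative \<phi> (at (a + \<tau> * fst z, subcell M j (snd z))) (\<tau> * fst v, snd v /\<^sub>R real M)))) (at z)" for z
    unfolding \<Phi>_def[abs_def]
    by (intro has_derivative_mult_right has_derivative_sum
        has_derivative_compose[OF aff smooth_has_derivative[OF \<phi>(1)]])
  note \<Phi>' = frechet_derivative_eqI[OF this]
  have direction: "frechet_derivative \<phi> (at z) (\<tau> * 1, w /\<^sub>R real M)
      = \<tau> * frechet_derivative \<phi> (at z) (1, c *\<^sub>R w)" for z w
  proof -
    have "c * \<tau> = inverse (real M)" using c M by (simp add: field_simps)
    then have "(\<tau> * 1, w /\<^sub>R real M) = \<tau> *\<^sub>R (1, c *\<^sub>R w)" by (simp add: mult.commute)
    then have "frechet_derivative \<phi> (at z) (\<tau> * 1, w /\<^sub>R real M)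
        = \<tau> *\<^sub>R frechet_derivative \<phi> (at z) (1, c *\<^sub>R w)"
      by (simp only: linear_cmul[OF has_derivative_linear[OF smooth_has_derivative[OF \<phi>(1)]]])
    then show ?thesis by simp
  qed
  have stage: "\<tau> * (\<integral>x. transport \<phi> uM \<rho>M (a + \<tau> * r) x \<partial>torus) = (\<integral>y. transport \<Phi> u \<rho> r y \<partial>torus)"
    if r: "r \<in> {0..1}" for r
  proof -
    have at: "a + \<tau> * r \<in> {a..a + \<tau>}" using r \<tau> by (simp add: mult_left_le)
    have sc: "(a + \<tau> * r - a) / \<tau> = r" using \<tau> by simp
    obtain C where "\<forall>t\<in>{a..a + \<tau>}. AE x in torus. norm (transport \<phi> uM \<rho>M t x) \<le> C"
      using transport_bounded[OF \<phi>(1) uM(2) \<rho>M(2) \<rho>(2)] ..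
    note C = bspec[OF this]
    have int: "integrable torus (transport \<phi> uM \<rho>M (a + \<tau> * r))"
      by (rule integrable_bounded_section[OF on_torus_transport[OF \<phi> uM(1) \<rho>M(1)] at C[OF at]])
    have eq: "transport \<phi> uM \<rho>M (a + \<tau> * r) x
        = \<rho> r (real M *\<^sub>R x) * frechet_derivative \<phi> (at (a + \<tau> * r, x)) (1, c *\<^sub>R u r (real M *\<^sub>R x))" for x
      unfolding transport_def uM_def \<rho>M_def sc ..
    have int': "integrable torus (\<lambda>x. \<rho> r (real M *\<^sub>R x)
        * frechet_derivative \<phi> (at (a + \<tau> * r, x)) (1, c *\<^sub>R u r (real M *\<^sub>R x)))"
      unfolding eq[symmetric] by (rule int)
    have "(\<integral>x. transport \<phi> uM \<rho>M (a + \<tau> * r) x \<partial>torus)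
        = (\<integral>y. (1 / (real M)\<^sup>2) *\<^sub>R (\<Sum>j\<in>residues M.
            \<rho> r y * frechet_derivative \<phi> (at (a + \<tau> * r, subcell M j y)) (1, c *\<^sub>R u r y)) \<partial>torus)"
      using torus_integral_dilation[OF M, where g = "\<lambda>y. (\<rho> r y, u r y)" and L = "\<lambda>x. x"
          and B = "\<lambda>x (p, w). p * frechet_derivative \<phi> (at (a + \<tau> * r, x)) (1, c *\<^sub>R w)"]
        int' on_torus_section(3)[OF u(1) r] on_torus_section(3)[OF \<rho>T r]
      by (simp add: eq periodic_def)
    also have "\<tau> * \<dots> = (\<integral>y. transport \<Phi> u \<rho> r y \<partial>torus)"
      unfolding integral_mult_right_zero[symmetric] transport_def \<Phi>' fst_conv snd_conv direction
      by (intro Bochner_Integration.integral_cong refl) (simp add: sum_distrib_left algebra_simps)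
    finally show ?thesis .
  qed
  have pairing: "(\<integral>y. \<rho> r y * \<Phi> (r, y) \<partial>torus) = (\<integral>x. \<rho> r (real M *\<^sub>R x) * \<phi> (a + \<tau> * r, x) \<partial>torus)"
    if r: "r \<in> {0..1}" for r
  proof -
    have "integrable torus (\<lambda>x. \<rho> r (real M *\<^sub>R x))"
      by (rule integrable_torus_dilation[OF M on_torus_section(3)[OF \<rho>T r]
            integrable_bounded_section[OF \<rho>T r \<rho>(1)[OF r]]])
    then have "integrable torus (\<lambda>x. \<phi> (a + \<tau> * r, x) *\<^sub>R \<rho> r (real M *\<^sub>R x))"
      by (rule integrable_continuous_scaleR[OF smooth_continuous[OF smooth_slice[OF \<phi>(1)]]])
    from torus_integral_dilation_average[OF M on_torus_section(3)[OF \<rho>T r] this]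
    show ?thesis by (simp add: \<Phi>_avg mult.commute)
  qed
  have "(LINT t:{a..a + \<tau>}|lborel. \<integral>x. transport \<phi> uM \<rho>M t x \<partial>torus)
      = \<bar>\<tau>\<bar> *\<^sub>R (\<integral>r. indicator {a..a + \<tau>} (a + \<tau> * r) *\<^sub>R (\<integral>x. transport \<phi> uM \<rho>M (a + \<tau> * r) x \<partial>torus) \<partial>lborel)"
    unfolding set_lebesgue_integral_def using \<tau> by (intro lborel_integral_real_affine) auto
  also have "\<dots> = (\<integral>r. \<tau> * (indicator {a..a + \<tau>} (a + \<tau> * r) *\<^sub>R (\<integral>x. transport \<phi> uM \<rho>M (a + \<tau> * r) x \<partial>torus)) \<partial>lborel)"
    using \<tau> by simp
  also have "\<dots> = (LINT r:{0..1}|lborel. \<integral>y. transport \<Phi> u \<rho> r y \<partial>torus)"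
    unfolding set_lebesgue_integral_def
  proof (intro Bochner_Integration.integral_cong refl)
    fix r :: real
    have "a + \<tau> * r \<in> {a..a + \<tau>} \<longleftrightarrow> r \<in> {0..1}"
      using \<tau> by (auto simp: zero_le_mult_iff mult_le_cancel_left1)
    then show "\<tau> * (indicator {a..a + \<tau>} (a + \<tau> * r) *\<^sub>R (\<integral>x. transport \<phi> uM \<rho>M (a + \<tau> * r) x \<partial>torus))
        = indicator {0..1} r *\<^sub>R (\<integral>y. transport \<Phi> u \<rho> r y \<partial>torus)"
      using stage[of r] by (simp add: indicator_def)
  qed
  also have "\<dots> = (\<integral>y. \<rho> 1 y * \<Phi> (1, y) \<partial>torus) - (\<integral>y. \<rho> 0 y * \<Phi> (0, y) \<partial>torus)"
    by (rule weak_solution_increment[OF sol u \<rho> sm per])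
  also have "\<dots> = (\<integral>x. \<rho> 1 (real M *\<^sub>R x) * \<phi> (a + \<tau>, x) \<partial>torus)
      - (\<integral>x. \<rho> 0 (real M *\<^sub>R x) * \<phi> (a, x) \<partial>torus)"
    using pairing[of 1] pairing[of 0] by simp
  finally show ?thesis by (simp add: uM_def[abs_def] \<rho>M_def[abs_def])
qed

section \<open>The self-similar cascade\<close>

text \<open>
  Here \<open>N\<close> is the inverse of the contraction ratio, and \<open>U\<close>, \<open>R\<close> are essential bounds of the building block.
\<close>

locale self_similar_cascade =
  fixes s :: real and p :: ennreal and N :: nat
    and u0 :: "real \<Rightarrow> real^2 \<Rightarrow> real^2" and \<rho>0 :: "real \<Rightarrow> real^2 \<Rightarrow> real"
    and U R :: real
  assumes s: "s \<ge> 0" and N: "N \<ge> 2"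
    and velocity: "velocity_field {0..1} s p u0"
    and solution: "weak_solution {0..1} u0 \<rho>0"
    and self_similar: "AE x in torus. \<rho>0 1 x = \<rho>0 0 (real N *\<^sub>R x)"
    and u0_bound: "\<And>t. t \<in> {0..1} \<Longrightarrow> AE x in torus. norm (u0 t x) \<le> U"
    and \<rho>0_bound: "\<And>t. t \<in> {0..1} \<Longrightarrow> AE x in torus. norm (\<rho>0 t x) \<le> R" and R: "R \<ge> 0"
begin

definition \<tau> :: real where "\<tau> = real N powr (s - 1)"

definition stage_start :: "nat \<Rightarrow> real" where "stage_start n = (\<Sum>i<n. \<tau> ^ i)"

definition lifespan :: "real set" where "lifespan = {t. 0 \<le> t \<and> (\<exists>n. t < stage_start n)}"

definition stage :: "real \<Rightarrow> nat" where "stage t = (LEAST n. t < stage_start (Suc n))"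

definition u :: "real \<Rightarrow> real^2 \<Rightarrow> real^2" where
  "u t x = (real (N ^ stage t) powr (- s)) *\<^sub>R u0 ((t - stage_start (stage t)) / \<tau> ^ stage t) (real (N ^ stage t) *\<^sub>R x)"

definition \<rho> :: "real \<Rightarrow> real^2 \<Rightarrow> real" where
  "\<rho> t x = \<rho>0 ((t - stage_start (stage t)) / \<tau> ^ stage t) (real (N ^ stage t) *\<^sub>R x)"

lemma u0_torus: "on_torus {0..1} u0"
  using velocity by (simp add: velocity_field_def)

lemma \<rho>0_torus: "on_torus {0..1} \<rho>0"
  using solution by (simp add: weak_solution_def)

lemma N_pow_pos: "N ^ n > 0"
  using N by simp

lemma \<tau>_pos: "\<tau> > 0"
  using N by (simp add: \<tau>_def)

lemma stage_start_0 [simp]: "stage_start 0 = 0"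
  by (simp add: stage_start_def)

lemma stage_start_Suc: "stage_start (Suc n) = stage_start n + \<tau> ^ n"
  by (simp add: stage_start_def)

lemma stage_start_less: "stage_start n < stage_start (Suc n)"
  using \<tau>_pos by (simp add: stage_start_Suc)

lemma stage_start_mono: "m \<le> n \<Longrightarrow> stage_start m \<le> stage_start n"
  by (rule lift_Suc_mono_le[of stage_start]) (rule less_imp_le[OF stage_start_less])

lemma stage_eqI:
  assumes "stage_start n \<le> t" and "t < stage_start (Suc n)" shows "stage t = n"
  unfolding stage_def
proof (rule Least_equality)
  show "t < stage_start (Suc n)" by (rule assms(2))
  fix m assume "t < stage_start (Suc m)"
  then have "stage_start n < stage_start (Suc m)" using assms(1) by linarith
  then show "n \<le> m" using stage_start_mono[of "Suc m" n] by (meson not_less not_less_eq_eq)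
qed

lemma stage_bounds:
  assumes "t \<in> lifespan" shows "stage_start (stage t) \<le> t" and "t < stage_start (Suc (stage t))"
proof -
  from assms obtain n where t: "0 \<le> t" "t < stage_start n" by (auto simp: lifespan_def)
  then obtain k where k: "n = Suc k" by (cases n) auto
  have "t < stage_start (Suc k)" using t(2) k by simp
  then show "t < stage_start (Suc (stage t))" unfolding stage_def by (rule LeastI)
  show "stage_start (stage t) \<le> t"
  proof (cases "stage t")
    case 0 then show ?thesis using t by simp
  next
    case (Suc m)
    then have "\<not> t < stage_start (Suc m)" unfolding stage_def by (intro not_less_Least) simp
    then show ?thesis using Suc by simp
  qed
qed

lemma local_time:
  assumes "t \<in> {stage_start n..stage_start (Suc n)}" shows "(t - stage_start n) / \<tau> ^ n \<in> {0..1}"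
  using assms \<tau>_pos by (auto simp: stage_start_Suc field_simps)

lemma stage_time:
  assumes "t \<in> lifespan" shows "(t - stage_start (stage t)) / \<tau> ^ stage t \<in> {0..1}"
  by (rule local_time) (use stage_bounds[OF assms] in simp)

lemma stage_start_in_lifespan: "stage_start n \<in> lifespan"
  using stage_start_mono[of 0 n] stage_start_less[of n] by (auto simp: lifespan_def)

lemma atLeastAtMost_lifespan: "b \<in> lifespan \<Longrightarrow> {0..b} \<subseteq> lifespan"
  unfolding lifespan_def by (auto, meson le_less_trans)

lemma N_powr: "real (N ^ n) powr a = (real N powr a) ^ n"
  using N by (simp add: powr_realpow[symmetric] powr_powr powr_power mult.commute)

lemma scaling_identity: "real (N ^ n) powr (- s) * (\<tau> ^ n * real (N ^ n)) = 1"
proof -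
  have "\<tau> ^ n * real (N ^ n) = real (N ^ n) powr (s - 1) * real (N ^ n) powr 1"
    using N by (simp only: \<tau>_def N_powr) simp
  also have "\<dots> = real (N ^ n) powr s" by (simp only: powr_add[symmetric] diff_add_cancel)
  finally show ?thesis using N by (simp add: powr_minus)
qed

lemma amplitude_le_1: "real (N ^ n) powr (- s) \<le> 1"
proof -
  have "real N powr (- s) \<le> real N powr 0" using N s by (intro powr_mono) auto
  then show ?thesis unfolding N_powr using N by (intro power_le_one) auto
qed

lemma on_torus_staged:
  fixes f :: "real \<Rightarrow> real^2 \<Rightarrow> 'b::{real_normed_vector, second_countable_topology}"
  assumes f: "on_torus {0..1} f"
  shows "on_torus lifespan (\<lambda>t x. c (stage t) *\<^sub>R f ((t - stage_start (stage t)) / \<tau> ^ stage t) (real (N ^ stage t) *\<^sub>R x))"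
    (is "on_torus _ ?F")
  unfolding on_torus_def
proof (intro conjI ballI)
  let ?M = "restrict_space borel (lifespan \<times> UNIV) :: (real \<times> (real^2)) measure"
  define \<Omega> where "\<Omega> n = {stage_start n..<stage_start (Suc n)} \<times> (UNIV :: (real^2) set)" for n
  have sets: "A \<times> (UNIV :: (real^2) set) \<in> sets borel" if "A \<in> sets borel" for A :: "real set"
    using that by (simp add: borel_prod[symmetric])
  have "lifespan = (\<Union>n. {0..<stage_start n})" by (auto simp: lifespan_def)
  then have life: "lifespan \<in> sets borel" by simp
  have \<Omega>: "\<Omega> n \<subseteq> lifespan \<times> UNIV" for n
    using stage_start_mono[of 0 n] by (force simp: \<Omega>_def lifespan_def)
  show "(\<lambda>(t, x). ?F t x) \<in> borel_measurable ?M"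
  proof (rule measurable_piecewise_restrict[of "range \<Omega>"])
    show "space ?M \<subseteq> \<Union> (range \<Omega>)"
      using stage_bounds by (fastforce simp: \<Omega>_def space_restrict_space)
  next
    fix X assume "X \<in> range \<Omega>"
    then obtain n where X: "X = \<Omega> n" by auto
    have "\<Omega> n \<in> sets borel" by (simp add: \<Omega>_def sets)
    then show "X \<inter> space ?M \<in> sets ?M"
      using sets[OF life] \<Omega>[of n] by (auto simp: X sets_restrict_space_iff space_restrict_space Int_absorb2)
    have "restrict_space ?M X = restrict_space borel (\<Omega> n)"
      using sets[OF life] \<open>\<Omega> n \<in> sets borel\<close> \<Omega>[of n] by (simp add: X restrict_restrict_space Int_absorb1)
    moreover have "(\<lambda>(t, x). ?F t x) \<in> borel_measurable (restrict_space borel (\<Omega> n))"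
    proof -
      have "(\<lambda>(t, x). c n *\<^sub>R f ((t - stage_start n) / \<tau> ^ n) (real (N ^ n) *\<^sub>R x))
          \<in> borel_measurable (restrict_space borel ({stage_start n..stage_start n + \<tau> ^ n} \<times> UNIV))"
        using on_torus_rescale[OF f, of "\<tau> ^ n" "stage_start n" "c n" "N ^ n"] \<tau>_pos by (simp add: on_torus_def)
      then have "(\<lambda>(t, x). c n *\<^sub>R f ((t - stage_start n) / \<tau> ^ n) (real (N ^ n) *\<^sub>R x))
          \<in> borel_measurable (restrict_space borel (\<Omega> n))"
        by (rule measurable_restrict_mono) (auto simp: \<Omega>_def stage_start_Suc)
      then show ?thesis
        by (subst measurable_cong) (auto simp: \<Omega>_def stage_eqI space_restrict_space)
    qed
    ultimately show "(\<lambda>(t, x). ?F t x) \<in> borel_measurable (restrict_space ?M X)" by simp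
  qed auto
  show "periodic (?F t)" if "t \<in> lifespan" for t
    by (rule periodic_dilation[OF on_torus_section(3)[OF f stage_time[OF that]]])
qed

lemma u_torus: "on_torus lifespan u"
  using on_torus_staged[OF u0_torus, of "\<lambda>n. real (N ^ n) powr (- s)"] by (simp add: u_def[abs_def])

lemma \<rho>_torus: "on_torus lifespan \<rho>"
  using on_torus_staged[OF \<rho>0_torus, of "\<lambda>n. 1"] by (simp add: \<rho>_def[abs_def])

lemma u_bound:
  assumes t: "t \<in> lifespan" shows "AE x in torus. norm (u t x) \<le> U"
proof -
  note r = stage_time[OF t]
  from AE_torus_dilation[OF N_pow_pos on_torus_section(3)[OF u0_torus r] u0_bound[OF r], of "stage t"]
  show ?thesis
  proof eventually_elim
    case (elim x)
    then have "norm (u t x) \<le> 1 * U"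
      unfolding u_def norm_scaleR using amplitude_le_1[of "stage t"]
      by (intro mult_mono) auto
    then show ?case by simp
  qed
qed

lemma \<rho>_bound:
  assumes t: "t \<in> lifespan" shows "AE x in torus. norm (\<rho> t x) \<le> R"
  unfolding \<rho>_def
  by (rule AE_torus_dilation[OF N_pow_pos on_torus_section(3)[OF \<rho>0_torus stage_time[OF t]]])
     (rule \<rho>0_bound[OF stage_time[OF t]])

lemma velocity_field_u: "velocity_field lifespan s p u"
  unfolding velocity_field_def
proof (intro conjI ballI)
  show "bounded_field lifespan u" by (rule bounded_fieldI[OF u_torus u_bound])
  show "div_free (u t)" if t: "t \<in> lifespan" for t
  proof -
    note r = stage_time[OF t]
    show ?thesis unfolding u_def[abs_def]
      using velocity r integrable_bounded_section[OF u0_torus r u0_bound[OF r]]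
      by (intro div_free_dilation N_pow_pos on_torus_section(3)[OF u0_torus r]) (auto simp: velocity_field_def)
  qed
  have "Wdot_norm s p (u t) \<le> (SUP r\<in>{0..1}. Wdot_norm s p (u0 r))" if t: "t \<in> lifespan" for t
  proof -
    note r = stage_time[OF t]
    have "Wdot_norm s p (u t) \<le> Wdot_norm s p (u0 ((t - stage_start (stage t)) / \<tau> ^ stage t))"
      unfolding u_def[abs_def]
      by (rule Wdot_norm_dilation[OF N_pow_pos s on_torus_section(3,2)[OF u0_torus r]])
    also have "\<dots> \<le> (SUP r\<in>{0..1}. Wdot_norm s p (u0 r))" by (rule SUP_upper[OF r])
    finally show ?thesis .
  qed
  then have "(SUP t\<in>lifespan. Wdot_norm s p (u t)) \<le> (SUP r\<in>{0..1}. Wdot_norm s p (u0 r))" by (rule SUP_least)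
  also have "\<dots> < \<infinity>" using velocity by (simp add: velocity_field_def)
  finally show "(SUP t\<in>lifespan. Wdot_norm s p (u t)) < \<infinity>" .
qed (rule u_torus)

text \<open>
  Where two stages meet, self-similarity says that the end of one is, almost everywhere, the beginning
  of the next; so the formula of a stage stays valid at its final time.
\<close>

lemma \<rho>_closed_stage:
  assumes t: "t \<in> {stage_start n..stage_start (Suc n)}"
  shows "AE x in torus. \<rho> t x = \<rho>0 ((t - stage_start n) / \<tau> ^ n) (real (N ^ n) *\<^sub>R x)"
proof (cases "t = stage_start (Suc n)")
  case False
  then have "stage t = n" using t by (intro stage_eqI) auto
  then show ?thesis by (simp add: \<rho>_def)
next
  case True
  have "stage t = Suc n" unfolding True by (rule stage_eqI[OF order_refl stage_start_less])
  then have \<rho>t: "\<rho> t x = \<rho>0 0 (real N *\<^sub>R (real (N ^ n) *\<^sub>R x))" for x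
    by (simp add: \<rho>_def True)
  have one: "(t - stage_start n) / \<tau> ^ n = 1" using \<tau>_pos by (simp add: True stage_start_Suc)
  have "periodic (\<rho>0 1)" "periodic (\<rho>0 0)" using on_torus_section(3)[OF \<rho>0_torus] by auto
  then have "periodic (\<lambda>x. (\<rho>0 1 x, \<rho>0 0 (real N *\<^sub>R x)))"
    using periodic_dilation[of "\<rho>0 0" "\<lambda>x. x" N] by (simp add: periodic_def)
  from AE_torus_dilation[OF N_pow_pos[of n] this, of "\<lambda>(a, b). a = b"] self_similar
  show ?thesis unfolding \<rho>t one by (simp add: eq_commute)
qed

lemma pairing_closed_stage:
  assumes t: "t \<in> {stage_start n..stage_start (Suc n)}" and \<psi>: "continuous_on UNIV \<psi>"
  shows "(\<integral>x. \<rho> t x * \<psi> x \<partial>torus) = (\<integral>x. \<rho>0 ((t - stage_start n) / \<tau> ^ n) (real (N ^ n) *\<^sub>R x) * \<psi> x \<partial>torus)"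
proof (rule integral_cong_AE)
  have "t \<in> lifespan" using atLeastAtMost_lifespan[OF stage_start_in_lifespan[of "Suc n"]] stage_start_mono[of 0 n] t by auto
  note m = on_torus_section(2)[OF \<rho>_torus this]
  have \<psi>m: "\<psi> \<in> borel_measurable torus"
    using borel_measurable_continuous_onI[OF \<psi>] by (simp add: measurable_restrict_space1)
  show "(\<lambda>x. \<rho> t x * \<psi> x) \<in> borel_measurable torus" using m \<psi>m by simp
  note r = local_time[OF t]
  show "(\<lambda>x. \<rho>0 ((t - stage_start n) / \<tau> ^ n) (real (N ^ n) *\<^sub>R x) * \<psi> x) \<in> borel_measurable torus"
    using measurable_torus_dilation[OF N_pow_pos on_torus_section(3,2)[OF \<rho>0_torus r], of n] \<psi>m by simp
  show "AE x in torus. \<rho> t x * \<psi> x = \<rho>0 ((t - stage_start n) / \<tau> ^ n) (real (N ^ n) *\<^sub>R x) * \<psi> x"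
    using \<rho>_closed_stage[OF t] by eventually_elim simp
qed

text \<open>
  Continuous on each closed stage, because the closed stages overlap in their end points and agree there;
  each time of the lifespan is interior, relative to the lifespan, to a finite union of stages.
\<close>

lemma continuous_on_pairing:
  assumes \<psi>: "test_fun \<psi>"
  shows "continuous_on lifespan (\<lambda>t. \<integral>x. \<rho> t x * \<psi> x \<partial>torus)" (is "continuous_on _ ?F")
proof -
  have \<psi>c: "continuous_on UNIV \<psi>" using \<psi> by (simp add: test_fun_def smooth_continuous)
  have stage: "continuous_on {stage_start n..stage_start (Suc n)} ?F" for n
  proof -
    have eq: "?F t = (\<integral>y. \<rho>0 ((t - stage_start n) / \<tau> ^ n) y * cell_average (N ^ n) \<psi> y \<partial>torus)"
      if t: "t \<in> {stage_start n..stage_start (Suc n)}" for t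
    proof -
      note r = local_time[OF t]
      have "integrable torus (\<lambda>x. \<psi> x *\<^sub>R \<rho>0 ((t - stage_start n) / \<tau> ^ n) (real (N ^ n) *\<^sub>R x))"
        by (intro integrable_continuous_scaleR \<psi>c integrable_torus_dilation N_pow_pos
            on_torus_section(3)[OF \<rho>0_torus r] integrable_bounded_section[OF \<rho>0_torus r \<rho>0_bound[OF r]])
      from torus_integral_dilation_average[OF N_pow_pos on_torus_section(3)[OF \<rho>0_torus r] this]
      show ?thesis unfolding pairing_closed_stage[OF t \<psi>c] by (simp add: mult.commute)
    qed
    have "continuous_on {stage_start n..stage_start (Suc n)}
        (\<lambda>t. \<integral>y. \<rho>0 ((t - stage_start n) / \<tau> ^ n) y * cell_average (N ^ n) \<psi> y \<partial>torus)"
    proof (rule continuous_on_compose2[where g = "\<lambda>r. \<integral>y. \<rho>0 r y * cell_average (N ^ n) \<psi> y \<partial>torus"])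
      show "continuous_on {0..1} (\<lambda>r. \<integral>y. \<rho>0 r y * cell_average (N ^ n) \<psi> y \<partial>torus)"
        using solution cell_average_test_fun[OF N_pow_pos \<psi>] by (simp add: weak_solution_def)
      show "continuous_on {stage_start n..stage_start (Suc n)} (\<lambda>t. (t - stage_start n) / \<tau> ^ n)"
        using \<tau>_pos by (intro continuous_intros) auto
      show "(\<lambda>t. (t - stage_start n) / \<tau> ^ n) ` {stage_start n..stage_start (Suc n)} \<subseteq> {0..1}"
        using local_time by blast
    qed
    then show ?thesis by (rule continuous_on_eq) (rule eq[symmetric])
  qed
  have initial: "continuous_on {0..stage_start n} ?F" for n
  proof (induction n)
    case (Suc n)
    have "{0..stage_start (Suc n)} = {0..stage_start n} \<union> {stage_start n..stage_start (Suc n)}"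
      using stage_start_mono[of 0 n] stage_start_less[of n] by auto
    then show ?case using continuous_on_closed_Un[OF _ _ Suc stage] by simp
  qed simp
  show ?thesis
    unfolding continuous_on_eq_continuous_within
  proof
    fix t assume t: "t \<in> lifespan"
    then obtain n where n: "t < stage_start n" "0 \<le> t" by (auto simp: lifespan_def)
    have "continuous (at t within {0..stage_start n}) ?F"
      using initial[of n] n by (simp add: continuous_on_eq_continuous_within)
    moreover have "at t within lifespan = at t within {0..stage_start n}"
      by (rule at_within_nhd[of t "{..<stage_start n}"])
         (use n atLeastAtMost_lifespan[OF stage_start_in_lifespan[of n]] in \<open>auto simp: lifespan_def\<close>)
    ultimately show "continuous (at t within lifespan) ?F" by simp
  qed
qed

text \<open>
  The velocity at the single final instant of the stage already belongs to the next stage, which does not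
  matter for an integral over time.
\<close>

lemma stage_increment:
  assumes \<phi>: "smooth \<phi>" "\<And>t. periodic (\<lambda>x. \<phi> (t, x))"
  shows "(LINT t:{stage_start n..stage_start (Suc n)}|lborel. \<integral>x. transport \<phi> u \<rho> t x \<partial>torus)
    = (\<integral>x. \<rho> (stage_start (Suc n)) x * \<phi> (stage_start (Suc n), x) \<partial>torus) - (\<integral>x. \<rho> (stage_start n) x * \<phi> (stage_start n, x) \<partial>torus)"
proof -
  define uS where "uS t x = (real (N ^ n) powr (- s)) *\<^sub>R u0 ((t - stage_start n) / \<tau> ^ n) (real (N ^ n) *\<^sub>R x)" for t x
  define \<rho>S where "\<rho>S t x = \<rho>0 ((t - stage_start n) / \<tau> ^ n) (real (N ^ n) *\<^sub>R x)" for t x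
  have "(LINT t:{stage_start n..stage_start (Suc n)}|lborel. \<integral>x. transport \<phi> u \<rho> t x \<partial>torus)
      = (LINT t:{stage_start n..stage_start (Suc n)}|lborel. \<integral>x. transport \<phi> uS \<rho>S t x \<partial>torus)"
    unfolding set_lebesgue_integral_def
  proof (rule integral_discrete_difference[of "{stage_start (Suc n)}"])
    fix t assume "t \<notin> {stage_start (Suc n)}"
    then have "stage t = n" if "t \<in> {stage_start n..stage_start (Suc n)}" using that by (intro stage_eqI) auto
    then show "indicator {stage_start n..stage_start (Suc n)} t *\<^sub>R (\<integral>x. transport \<phi> u \<rho> t x \<partial>torus)
        = indicator {stage_start n..stage_start (Suc n)} t *\<^sub>R (\<integral>x. transport \<phi> uS \<rho>S t x \<partial>torus)"
      by (auto simp: indicator_def transport_def u_def \<rho>_def uS_def \<rho>S_def)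
  qed auto
  also have "\<dots> = (\<integral>x. \<rho>0 1 (real (N ^ n) *\<^sub>R x) * \<phi> (stage_start n + \<tau> ^ n, x) \<partial>torus)
      - (\<integral>x. \<rho>0 0 (real (N ^ n) *\<^sub>R x) * \<phi> (stage_start n, x) \<partial>torus)"
    unfolding uS_def[abs_def] \<rho>S_def[abs_def] stage_start_Suc
    by (rule rescaled_increment[OF solution u0_torus u0_bound \<rho>0_bound R \<phi> N_pow_pos _ scaling_identity])
       (use \<tau>_pos in auto)
  also have "(\<integral>x. \<rho>0 1 (real (N ^ n) *\<^sub>R x) * \<phi> (stage_start n + \<tau> ^ n, x) \<partial>torus)
      = (\<integral>x. \<rho> (stage_start (Suc n)) x * \<phi> (stage_start (Suc n), x) \<partial>torus)"
    using pairing_closed_stage[of "stage_start (Suc n)" n, OF _ smooth_continuous[OF smooth_slice[OF \<phi>(1)]]]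
      stage_start_less[of n] \<tau>_pos by (simp add: stage_start_Suc)
  also have "(\<integral>x. \<rho>0 0 (real (N ^ n) *\<^sub>R x) * \<phi> (stage_start n, x) \<partial>torus) = (\<integral>x. \<rho> (stage_start n) x * \<phi> (stage_start n, x) \<partial>torus)"
    using stage_eqI[OF order_refl stage_start_less, of n] by (simp add: \<rho>_def)
  finally show ?thesis .
qed

lemma transport_fubini:
  assumes \<phi>: "smooth \<phi>" "\<And>t. periodic (\<lambda>x. \<phi> (t, x))" and b: "b \<in> lifespan"
  shows "set_integrable lborel {0..b} (\<lambda>t. \<integral>x. transport \<phi> u \<rho> t x \<partial>torus)"
    and "set_lebesgue_integral lborel ({0..b} \<times> cbox 0 1) (\<lambda>(t, x). transport \<phi> u \<rho> t x)
      = (LINT t:{0..b}|lborel. \<integral>x. transport \<phi> u \<rho> t x \<partial>torus)"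
proof -
  note sub = atLeastAtMost_lifespan[OF b]
  have "AE x in torus. norm (u t x) \<le> U" "AE x in torus. norm (\<rho> t x) \<le> R" if "t \<in> {0..b}" for t
    using u_bound \<rho>_bound that sub by auto
  then obtain C where "\<forall>t\<in>{0..b}. AE x in torus. norm (transport \<phi> u \<rho> t x) \<le> C"
    using transport_bounded[OF \<phi>(1), of 0 b u U \<rho> R] R by blast
  note C = bspec[OF this]
  note T = on_torus_transport[OF \<phi> on_torus_subset[OF u_torus sub] on_torus_subset[OF \<rho>_torus sub]]
  show "set_integrable lborel {0..b} (\<lambda>t. \<integral>x. transport \<phi> u \<rho> t x \<partial>torus)"
    and "set_lebesgue_integral lborel ({0..b} \<times> cbox 0 1) (\<lambda>(t, x). transport \<phi> u \<rho> t x)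
      = (LINT t:{0..b}|lborel. \<integral>x. transport \<phi> u \<rho> t x \<partial>torus)"
    using space_time_fubini(2,3)[OF T C] by auto
qed

lemma cumulative_increment:
  assumes \<phi>: "smooth \<phi>" "\<And>t. periodic (\<lambda>x. \<phi> (t, x))"
  shows "(LINT t:{0..stage_start K}|lborel. \<integral>x. transport \<phi> u \<rho> t x \<partial>torus)
    = (\<integral>x. \<rho> (stage_start K) x * \<phi> (stage_start K, x) \<partial>torus) - (\<integral>x. \<rho> 0 x * \<phi> (0, x) \<partial>torus)"
proof (induction K)
  case 0
  have "(LINT t:{0..0}|lborel. \<integral>x. transport \<phi> u \<rho> t x \<partial>torus) = (LINT t:{}|lborel. \<integral>x. transport \<phi> u \<rho> t x \<partial>torus)"
    unfolding set_lebesgue_integral_def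
    by (rule integral_discrete_difference[of "{0}"]) (auto simp: indicator_def)
  then show ?case by (simp add: set_lebesgue_integral_def)
next
  case (Suc K)
  let ?h = "\<lambda>t. \<integral>x. transport \<phi> u \<rho> t x \<partial>torus"
  have split: "{0..stage_start (Suc K)} = {0..stage_start K} \<union> {stage_start K..stage_start (Suc K)}"
    using stage_start_mono[of 0 K] stage_start_less[of K] by auto
  have I: "set_integrable lborel {0..stage_start (Suc K)} ?h"
    by (rule transport_fubini(1)[OF \<phi> stage_start_in_lifespan])
  have "AE t in lborel. \<not> (t \<in> {0..stage_start K} \<and> t \<in> {stage_start K..stage_start (Suc K)})"
    using AE_lborel_singleton[of "stage_start K"] by eventually_elim auto
  then have "(LINT t:{0..stage_start (Suc K)}|lborel. ?h t) = (LINT t:{0..stage_start K}|lborel. ?h t) + (LINT t:{stage_start K..stage_start (Suc K)}|lborel. ?h t)"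
    unfolding split
    by (rule set_integral_Un_AE) (use split in \<open>auto intro: set_integrable_subset[OF I]\<close>)
  then show ?case using Suc stage_increment[OF \<phi>, of K] by simp
qed

text \<open>
  A test function vanishes from some time before the end of the lifespan on, so finitely many stages
  matter. The increments over them telescope, and of the boundary terms only the initial one survives.
\<close>

lemma weak_solution_\<rho>: "weak_solution lifespan u \<rho>"
  unfolding weak_solution_def
proof (intro conjI ballI allI impI)
  show "on_torus lifespan \<rho>" by (rule \<rho>_torus)
  show "integrable torus (\<rho> t)" if "t \<in> lifespan" for t
    by (rule integrable_bounded_section[OF \<rho>_torus that \<rho>_bound[OF that]])
  show "continuous_on lifespan (\<lambda>t. \<integral>x. \<rho> t x * \<psi> x \<partial>torus)" if "test_fun \<psi>" for \<psi>
    by (rule continuous_on_pairing[OF that])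
next
  fix b assume b: "b \<in> lifespan"
  note sub = atLeastAtMost_lifespan[OF b]
  show "set_integrable lborel ({0..b} \<times> cbox 0 1) (\<lambda>(t, x). \<rho> t x)"
    by (rule space_time_fubini(1)[OF on_torus_subset[OF \<rho>_torus sub]]) (use \<rho>_bound sub in blast)
  have "on_torus lifespan (\<lambda>t x. \<rho> t x *\<^sub>R u t x)"
    using \<rho>_torus u_torus by (auto simp: on_torus_def periodic_def case_prod_beta')
  moreover have "AE x in torus. norm (\<rho> t x *\<^sub>R u t x) \<le> R * U" if "t \<in> {0..b}" for t
  proof -
    have "t \<in> lifespan" using that sub by blast
    from \<rho>_bound[OF this] u_bound[OF this] show ?thesis
      by eventually_elim (use R in \<open>auto intro!: mult_mono\<close>)
  qed
  ultimately show "set_integrable lborel ({0..b} \<times> cbox 0 1) (\<lambda>(t, x). \<rho> t x *\<^sub>R u t x)"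
    by (intro space_time_fubini(1) on_torus_subset[OF _ sub])
next
  fix \<phi> :: "real \<times> (real^2) \<Rightarrow> real"
  assume sm: "smooth \<phi>" and per: "\<forall>t. periodic (\<lambda>x. \<phi> (t, x))"
    and vanish: "\<exists>b\<in>interior lifespan. \<forall>t>b. \<forall>x. \<phi> (t, x) = 0"
  have per': "periodic (\<lambda>x. \<phi> (t, x))" for t using per by blast
  obtain b where b: "b \<in> lifespan" "\<And>t x. t > b \<Longrightarrow> \<phi> (t, x) = 0"
    using vanish interior_subset by blast
  then obtain K where K: "b < stage_start K" by (auto simp: lifespan_def)
  \<comment> \<open>also the derivatives vanish there, since the set is open\<close>
  have zero: "transport \<phi> u \<rho> t x = 0" if "t > b" for t x
  proof -
    have "open ({b<..} \<times> (UNIV :: (real^2) set))" by (intro open_Times) auto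
    from has_derivative_transform_within_open[OF has_derivative_const this, of "(t, x)" 0 \<phi>] that b(2)
    have "(\<phi> has_derivative (\<lambda>v. 0)) (at (t, x))" by auto
    from frechet_derivative_eqI[OF this] show ?thesis by (simp add: transport_def)
  qed
  have "set_lebesgue_integral lborel (lifespan \<times> cbox 0 1)
        (\<lambda>(t, x). \<rho> t x * frechet_derivative \<phi> (at (t, x)) (1, u t x))
      = set_lebesgue_integral lborel ({0..stage_start K} \<times> cbox 0 1) (\<lambda>(t, x). transport \<phi> u \<rho> t x)"
    unfolding set_lebesgue_integral_def
  proof (intro Bochner_Integration.integral_cong refl)
    fix z :: "real \<times> (real^2)"
    obtain t x where z: "z = (t, x)" by (cases z)
    have "t \<in> lifespan \<longleftrightarrow> t \<in> {0..stage_start K}" if "t \<le> b"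
      using that K atLeastAtMost_lifespan[OF b(1)] by (auto simp: lifespan_def)
    then show "indicator (lifespan \<times> cbox 0 1) z *\<^sub>R (case z of (t, x) \<Rightarrow> \<rho> t x * frechet_derivative \<phi> (at (t, x)) (1, u t x))
        = indicator ({0..stage_start K} \<times> cbox 0 1) z *\<^sub>R (case z of (t, x) \<Rightarrow> transport \<phi> u \<rho> t x)"
      using zero[of t x] unfolding z by (cases "t \<le> b") (auto simp: transport_def indicator_def)
  qed
  also have "\<dots> = (LINT t:{0..stage_start K}|lborel. \<integral>x. transport \<phi> u \<rho> t x \<partial>torus)"
    by (rule transport_fubini(2)[OF sm per' stage_start_in_lifespan])
  also have "\<dots> = - (\<integral>x. \<rho> 0 x * \<phi> (0, x) \<partial>torus)"
    using cumulative_increment[OF sm per', of K] b(2)[OF K] by simp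
  finally show "set_lebesgue_integral lborel (lifespan \<times> cbox 0 1)
        (\<lambda>(t, x). \<rho> t x * frechet_derivative \<phi> (at (t, x)) (1, u t x))
      + (\<integral>x. \<rho> 0 x * \<phi> (0, x) \<partial>torus) = 0" by simp
qed

lemma \<rho>_initial: "\<rho> 0 x = \<rho>0 0 x"
  using stage_eqI[of 0 0] stage_start_less[of 0] by (simp add: \<rho>_def)

lemma Hm1_norm_\<rho>:
  assumes t: "t \<in> lifespan" shows "Hm1_norm (\<rho> t) \<le> ennreal (R / real N ^ stage t)"
proof -
  note r = stage_time[OF t]
  have "Hm1_norm (\<rho> t) \<le> ennreal (R / real (N ^ stage t))"
    unfolding \<rho>_def[abs_def] using \<rho>0_bound[OF r] R
    by (intro Hm1_norm_dilation N_pow_pos on_torus_section[OF \<rho>0_torus r]) auto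
  then show ?thesis by simp
qed

section \<open>Lifespan and rates of mixing\<close>

text \<open>
  The sum of the lengths \<open>\<tau>^n\<close> of all stages. The ratio \<open>\<tau> = N^{s - 1}\<close> is less than \<open>1\<close> exactly if \<open>s < 1\<close>.
\<close>

definition horizon :: ereal where
  "horizon = (if s < 1 then ereal (1 / (1 - \<tau>)) else \<infinity>)"

lemma stage_start_geometric: "\<tau> \<noteq> 1 \<Longrightarrow> stage_start n = (1 - \<tau> ^ n) / (1 - \<tau>)"
  using sum_gp_strict[of \<tau> n] by (simp add: stage_start_def)

lemma \<tau>_less_1: "s < 1 \<Longrightarrow> \<tau> < 1"
  using N powr_less_mono[of "s - 1" 0 "real N"] by (simp add: \<tau>_def)

lemma \<tau>_eq_1: "s = 1 \<Longrightarrow> \<tau> = 1"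
  unfolding \<tau>_def using N by simp

lemma \<tau>_greater_1: "s > 1 \<Longrightarrow> \<tau> > 1"
  using N powr_less_mono[of 0 "s - 1" "real N"] by (simp add: \<tau>_def)

lemma stage_start_less_horizon: "ereal (stage_start n) < horizon"
proof (cases "s < 1")
  case True
  then show ?thesis
    using \<tau>_less_1[OF True] \<tau>_pos stage_start_geometric[of n] by (simp add: horizon_def divide_strict_right_mono)
qed (simp add: horizon_def)

lemma stage_start_reaches_horizon:
  assumes "ereal t < horizon" obtains n where "t < stage_start n"
proof (cases "s < 1")
  case True
  have \<tau>1: "\<tau> < 1" by (rule \<tau>_less_1[OF True])
  have t: "t < 1 / (1 - \<tau>)" using assms True by (simp add: horizon_def)
  have "(\<lambda>n. \<tau> ^ n) \<longlonglongrightarrow> 0" using \<tau>1 \<tau>_pos by (intro LIMSEQ_realpow_zero) auto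
  then have "(\<lambda>n. (1 - \<tau> ^ n) / (1 - \<tau>)) \<longlonglongrightarrow> (1 - 0) / (1 - \<tau>)"
    using \<tau>1 by (intro tendsto_divide tendsto_diff tendsto_const) auto
  then have "stage_start \<longlonglongrightarrow> (1 - 0) / (1 - \<tau>)"
    using \<tau>1 by (simp add: stage_start_geometric[symmetric])
  from order_tendstoD(1)[OF this, of t] t have "\<forall>\<^sub>F n in sequentially. t < stage_start n" by simp
  then show thesis using that unfolding eventually_sequentially by blast
next
  case False
  have "\<tau> \<ge> 1" using False \<tau>_eq_1 \<tau>_greater_1 by (cases "s = 1") auto
  then have "(\<Sum>i<n. 1) \<le> stage_start n" for n
    unfolding stage_start_def by (intro sum_mono one_le_power)
  then have "real n \<le> stage_start n" for n by simp
  moreover obtain n where "t < real n" using reals_Archimedean2 by blast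
  ultimately show thesis using that[of n] by (meson less_le_trans)
qed

lemma lifespan_eq: "lifespan = {t. 0 \<le> t \<and> ereal t < horizon}"
proof -
  have "ereal t < horizon" if "t < stage_start n" for t n
    using that stage_start_less_horizon[of n] by (meson ereal_less_eq(3) less_imp_le le_less_trans)
  then show ?thesis using stage_start_reaches_horizon by (fastforce simp: lifespan_def)
qed

lemma horizon_infinite: "1 \<le> s \<Longrightarrow> horizon = \<infinity>"
  by (simp add: horizon_def)

lemma lifespan_infinite: "1 \<le> s \<Longrightarrow> 0 \<le> t \<Longrightarrow> t \<in> lifespan"
  by (simp add: lifespan_eq horizon_infinite)

lemma horizon_pos: "0 < horizon"
  using stage_start_less_horizon[of 0] by (simp add: zero_ereal_def)

lemma perfect_mixing:
  assumes "s < 1"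
  shows "((\<lambda>t. Hm1_norm (\<rho> t)) \<longlongrightarrow> 0) (at_left (real_of_ereal horizon))"
proof (rule order_tendstoI)
  fix a :: ennreal assume "0 < a"
  have "(\<lambda>n. R * inverse (real N) ^ n) \<longlonglongrightarrow> R * 0"
    using N by (intro tendsto_mult tendsto_const LIMSEQ_realpow_zero) (auto simp: inverse_less_1_iff)
  then have "(\<lambda>n. ennreal (R / real N ^ n)) \<longlonglongrightarrow> 0"
    using tendsto_ennrealI[of "\<lambda>n. R * inverse (real N) ^ n" 0] by (simp add: power_inverse divide_inverse)
  from order_tendstoD(2)[OF this \<open>0 < a\<close>] obtain n where n: "ennreal (R / real N ^ n) < a"
    unfolding eventually_sequentially by blast
  have T: "horizon = ereal (real_of_ereal horizon)" using assms by (simp add: horizon_def)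
  have "stage_start n < real_of_ereal horizon"
    using stage_start_less_horizon[of n] assms by (simp add: horizon_def)
  have "Hm1_norm (\<rho> t) < a" if t: "t \<in> {stage_start n<..<real_of_ereal horizon}" for t
  proof -
    have life: "t \<in> lifespan"
      using t stage_start_mono[of 0 n] by (subst lifespan_eq, subst T) auto
    have "n \<le> stage t"
    proof (rule ccontr)
      assume "\<not> n \<le> stage t"
      then have "stage_start (Suc (stage t)) \<le> stage_start n" by (intro stage_start_mono) simp
      then show False using stage_bounds(2)[OF life] t by simp
    qed
    then have "R / real N ^ stage t \<le> R / real N ^ n"
      using N R by (intro divide_left_mono power_increasing) auto
    then have "Hm1_norm (\<rho> t) \<le> ennreal (R / real N ^ n)"
      using Hm1_norm_\<rho>[OF life] by (meson ennreal_leI order_trans)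
    then show ?thesis using n by simp
  qed
  then show "\<forall>\<^sub>F t in at_left (real_of_ereal horizon). Hm1_norm (\<rho> t) < a"
    using \<open>stage_start n < real_of_ereal horizon\<close> by (rule eventually_at_leftI)
qed simp

text \<open>
  All stages have length \<open>1\<close>, so the number of completed stages exceeds \<open>t - 1\<close>, and the norm is at most
  \<open>R N^{1 - t}\<close>.
\<close>

lemma exponential_decay:
  assumes "s = 1" and "t \<ge> 0"
  shows "Hm1_norm (\<rho> t) \<le> ennreal ((R + 1) * real N * exp (- ln (real N) * t))"
proof -
  have life: "t \<in> lifespan" using assms by (intro lifespan_infinite) auto
  have "t < real (Suc (stage t))"
    using stage_bounds(2)[OF life] \<tau>_eq_1[OF assms(1)] by (simp add: stage_start_def)
  then have "exp (ln (real N) * t) \<le> exp (ln (real N) * real (Suc (stage t)))"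
    using N by (simp add: mult_left_mono)
  also have "\<dots> = real N * real N ^ stage t"
    using N exp_of_nat_mult[of "Suc (stage t)" "ln (real N)"] by (simp add: mult.commute)
  finally have "inverse (real N ^ stage t) \<le> real N * exp (- ln (real N) * t)"
    using N by (simp add: exp_minus field_simps)
  then have "R * inverse (real N ^ stage t) \<le> (R + 1) * (real N * exp (- ln (real N) * t))"
    using R by (intro mult_mono) auto
  then show ?thesis
    using Hm1_norm_\<rho>[OF life] by (auto simp: divide_inverse mult.assoc intro: order_trans ennreal_leI)
qed

text \<open>
  Stages grow geometrically: \<open>(\<tau> - 1) t\<close> is less than \<open>\<tau>^{n + 1}\<close> in stage \<open>n\<close>. Since
  \<open>N^{n + 1}\<close> is the power \<open>1 / (s - 1)\<close> of \<open>\<tau>^{n + 1}\<close>, this is a lower bound for \<open>N^n\<close> by a power of \<open>t\<close>.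
\<close>

lemma polynomial_decay:
  assumes s1: "s > 1" and t: "t > 0"
  shows "Hm1_norm (\<rho> t)
    \<le> ennreal ((R + 1) * real N * (\<tau> - 1) powr (- (1 / (s - 1))) * t powr (- (1 / (s - 1))))"
proof -
  let ?a = "1 / (s - 1)"
  have life: "t \<in> lifespan" using assms by (intro lifespan_infinite) auto
  have \<tau>1: "\<tau> > 1" by (rule \<tau>_greater_1[OF s1])
  have "t < (\<tau> ^ Suc (stage t) - 1) / (\<tau> - 1)"
    using stage_bounds(2)[OF life] stage_start_geometric[of "Suc (stage t)"] \<tau>1
      minus_divide_divide[of "\<tau> ^ Suc (stage t) - 1" "\<tau> - 1"]
    by simp
  then have "(\<tau> - 1) * t \<le> \<tau> ^ Suc (stage t)"
    using \<tau>1 by (simp add: field_simps)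
  then have "((\<tau> - 1) * t) powr ?a \<le> (\<tau> ^ Suc (stage t)) powr ?a"
    using \<tau>1 t s1 by (intro powr_mono2) auto
  also have "(\<tau> ^ Suc (stage t)) powr ?a = real N * real N ^ stage t"
  proof -
    have "\<tau> ^ Suc (stage t) = real (N ^ Suc (stage t)) powr (s - 1)"
      unfolding N_powr \<tau>_def ..
    then show ?thesis using s1 N by (simp add: powr_powr)
  qed
  finally have "((\<tau> - 1) * t) powr ?a \<le> real N * real N ^ stage t" .
  then have "inverse (real N ^ stage t) \<le> real N * inverse (((\<tau> - 1) * t) powr ?a)"
    using N \<tau>1 t by (simp add: field_simps)
  also have "\<dots> = real N * ((\<tau> - 1) powr (- ?a) * t powr (- ?a))"
    using \<tau>1 t by (simp add: powr_minus powr_mult)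
  finally have "R * inverse (real N ^ stage t) \<le> (R + 1) * (real N * ((\<tau> - 1) powr (- ?a) * t powr (- ?a)))"
    using R by (intro mult_mono) auto
  then show ?thesis
    using Hm1_norm_\<rho>[OF life] by (auto simp: divide_inverse mult.assoc intro: order_trans ennreal_leI)
qed

end

theorem theorem3p4:
  fixes s :: real and p :: ennreal and lam :: real
    and u0 :: "real \<Rightarrow> real^2 \<Rightarrow> real^2" and \<rho>0 :: "real \<Rightarrow> real^2 \<Rightarrow> real"
  assumes "s \<ge> 0" and "1 \<le> p"
    and "velocity_field {0..1} s p u0"
    and "weak_solution {0..1} u0 \<rho>0"
    and "\<exists>t\<in>{0..1}. \<not> (AE x in torus. \<rho>0 t x = 0)"
    and "bounded_field {0..1} \<rho>0"
    and "\<forall>t\<in>{0..1}. (\<integral>x. \<rho>0 t x \<partial>torus) = 0"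
    and "lam > 0" and "1 / lam \<in> \<int>" and "1 / lam \<ge> 2"
    and "AE x in torus. \<rho>0 1 x = \<rho>0 0 (x /\<^sub>R lam)"
  shows "\<exists>(T :: ereal) u \<rho>. 0 < T \<and>
    (let I = {t. 0 \<le> t \<and> ereal t < T} in
      velocity_field I s p u \<and>
      weak_solution I u \<rho> \<and>
      (AE x in torus. \<rho> 0 x = \<rho>0 0 x)) \<and>
    (s < 1 \<longrightarrow> T < \<infinity> \<and> ((\<lambda>t. Hm1_norm (\<rho> t)) \<longlongrightarrow> 0) (at_left (real_of_ereal T))) \<and>
    (s = 1 \<longrightarrow> T = \<infinity> \<and>
      (\<exists>C>0. \<exists>c>0. \<forall>t\<ge>0. Hm1_norm (\<rho> t) \<le> ennreal (C * exp (- c * t)))) \<and>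
    (s > 1 \<longrightarrow> T = \<infinity> \<and>
      (\<exists>C>0. \<exists>\<alpha>>0. \<forall>t>0. Hm1_norm (\<rho> t) \<le> ennreal (C * t powr (- \<alpha>))))"
proof -
  obtain k where "1 / lam = real_of_int k" using assms(9) by (elim Ints_cases)
  then have lam: "inverse lam = real (nat k)" "nat k \<ge> 2"
    using assms(10) by (auto simp: inverse_eq_divide)
  obtain U where U: "\<And>t. t \<in> {0..1} \<Longrightarrow> AE x in torus. norm (u0 t x) \<le> U"
    using assms(3) bounded_fieldD[of "{0..1}" u0] unfolding velocity_field_def by blast
  obtain R where R: "R \<ge> 0" "\<And>t. t \<in> {0..1} \<Longrightarrow> AE x in torus. norm (\<rho>0 t x) \<le> R"
    using bounded_fieldD[OF assms(6)] by blast
  interpret self_similar_cascade s p "nat k" u0 \<rho>0 U R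
    by unfold_locales (use assms U R lam in auto)
  show ?thesis
  proof (intro exI[of _ horizon] exI[of _ u] exI[of _ \<rho>] conjI impI)
    show "let I = {t. 0 \<le> t \<and> ereal t < horizon} in velocity_field I s p u \<and> weak_solution I u \<rho> \<and>
        (AE x in torus. \<rho> 0 x = \<rho>0 0 x)"
      using velocity_field_u weak_solution_\<rho> by (simp add: lifespan_eq \<rho>_initial)
    \<comment> \<open>the factor \<open>R + 1\<close> instead of \<open>R\<close> makes the constant positive\<close>
    show "\<exists>C>0. \<exists>c>0. \<forall>t\<ge>0. Hm1_norm (\<rho> t) \<le> ennreal (C * exp (- c * t))" if "s = 1"
      using exponential_decay[OF that] N R(1)
      by (intro exI[of _ "(R + 1) * real (nat k)"] conjI exI[of _ "ln (real (nat k))"]) auto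
    show "\<exists>C>0. \<exists>\<alpha>>0. \<forall>t>0. Hm1_norm (\<rho> t) \<le> ennreal (C * t powr (- \<alpha>))" if "s > 1"
      using polynomial_decay[OF that] \<tau>_greater_1[OF that] that N R(1)
      by (intro exI[of _ "(R + 1) * real (nat k) * (\<tau> - 1) powr (- (1 / (s - 1)))"] conjI
            exI[of _ "1 / (s - 1)"]) auto
    show "horizon < \<infinity>" if "s < 1" using that by (simp add: horizon_def)
    show "horizon = \<infinity>" if "s = 1" using that by (intro horizon_infinite) simp
    show "horizon = \<infinity>" if "s > 1" using that by (intro horizon_infinite) simp
  qed (use horizon_pos perfect_mixing in auto)
qed

end
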